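(* Let $A,B$ be two normal multiplicity-free elements in $\mathbb{K}(C(S^1))$ with $\mathrm{Eig}(A(x))=\mathrm{Eig}(B(x))\subset\mathbb{C}\setminus\{0\}$ for all $x\in S^1$. If $A$ satisfies condition (1), then $A$ and $B$ are approximately unitarily equivalent.
   Context: $H$ is a separable infinite-dimensional complex Hilbert space with a fixed orthonormal basis. For compact $X$, $\mathbb{K}(C(X))$ is the ring of compact operators over $X$, i.e. norm limits of (finite) matrices with entries in $C(X)$, viewed as norm-continuous families $x\mapsto A(x)$ of compact operators on $H$. Normality is pointwise. $\mathrm{Eig}(A(x))$ is the set of eigenvalues of $A(x)$; $A$ is multiplicity-free if for every $x$ every eigenvalue of $A(x)$ has multiplicity one. Condition (1): $\bar A\in\mathbb{K}(C[0,1])$ satisfies condition (1) if for every $x_0\in[0,1]$ and every $\mu\in\mathrm{Eig}(\bar A(x_0))$ there is $\lambda\in C[0,1]$ with $\lambda(x_0)=\mu$ and $\lambda(x)\in\mathrm{Eig}(\bar A(x))$ for all $x\in[0,1]$. $A\in\mathbb{K}(C(S^1))$ satisfies condition (1) if $\bar A(x)=A(e^{2\pi xi})$, $x\in[0,1]$, does. $A,B\in\mathbb{K}(C(X))$ are approximately unitarily equivalent if for every $\epsilon>0$ there is a norm-continuous unitary $U\in I+\mathbb{K}(C(X))$ with $\|B(x)-U(x)^*A(x)U(x)\|<\epsilon$ for all $x\in X$. *)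

theory Defs
  imports "HOL-Analysis.Analysis"
begin

section \<open>Complex Hilbert spaces\<close>

text \<open>
  The real structure inherited from \<^class>\<open>real_inner\<close> is the underlying real one: the real inner
  product is the real part of the complex one, so norm and topology are the usual ones, and positive
  definiteness of \<open>cinner\<close> is that of \<open>inner\<close>. The complex inner product is linear in its second
  argument.
\<close>

class complex_inner = real_inner +
  fixes scaleC :: "complex \<Rightarrow> 'a \<Rightarrow> 'a"  (infixr "*\<^sub>C" 75)
    and cinner :: "'a \<Rightarrow> 'a \<Rightarrow> complex"
  assumes scaleC_add_right: "c *\<^sub>C (x + y) = c *\<^sub>C x + c *\<^sub>C y"
    and scaleC_add_left: "(c + d) *\<^sub>C x = c *\<^sub>C x + d *\<^sub>C x"
    and scaleC_scaleC: "c *\<^sub>C (d *\<^sub>C x) = (c * d) *\<^sub>C x"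
    and scaleR_scaleC: "scaleR r x = complex_of_real r *\<^sub>C x"
    and cinner_commute: "cinner x y = cnj (cinner y x)"
    and cinner_add_right: "cinner x (y + z) = cinner x y + cinner x z"
    and cinner_scaleC_right: "cinner x (c *\<^sub>C y) = c * cinner x y"
    and inner_eq_Re_cinner: "inner x y = Re (cinner x y)"

class complex_hilbert = complex_inner + complete_space

lemma scaleC_one: "1 *\<^sub>C (x::'a::complex_inner) = x"
  using scaleR_scaleC[of 1 x] by simp

global_interpretation complex_vector: vector_space "scaleC :: complex \<Rightarrow> 'a \<Rightarrow> 'a::complex_inner"
  defines cspan = complex_vector.span
    and cdim = complex_vector.dim
  by unfold_locales (simp_all add: scaleC_add_right scaleC_add_left scaleC_scaleC scaleC_one)

lemma cinner_eq: "cinner x y = Complex (inner x y) (- inner x (\<i> *\<^sub>C y))"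
  by (simp add: inner_eq_Re_cinner cinner_scaleC_right)

lemma cinner_add_left: "cinner (x + y) z = cinner x z + cinner y z"
  by (metis cinner_add_right cinner_commute complex_cnj_add)

lemma cinner_scaleC_left: "cinner (c *\<^sub>C x) y = cnj c * cinner x y"
  by (metis cinner_commute cinner_scaleC_right complex_cnj_mult)

lemma norm_scaleC: "norm (c *\<^sub>C (x::'a::complex_inner)) = cmod c * norm x"
proof -
  have "inner (c *\<^sub>C x) (c *\<^sub>C x) = Re ((cnj c * c) * cinner x x)"
    by (simp only: inner_eq_Re_cinner cinner_scaleC_left cinner_scaleC_right
        mult.assoc mult.left_commute)
  also have "cnj c * c = complex_of_real ((cmod c)\<^sup>2)"
    by (simp only: complex_norm_square mult.commute)
  finally have "(norm (c *\<^sub>C x))\<^sup>2 = (cmod c * norm x)\<^sup>2"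
    by (simp add: power2_norm_eq_inner inner_eq_Re_cinner power_mult_distrib)
  then show ?thesis by (simp add: power2_eq_iff_nonneg)
qed

lemma bounded_linear_scaleC: "bounded_linear (\<lambda>x::'a::complex_inner. c *\<^sub>C x)"
  by (rule bounded_linear_intro[where K = "cmod c"])
    (simp_all add: scaleC_add_right scaleR_scaleC scaleC_scaleC norm_scaleC mult.commute)

lemma bounded_linear_cinner_right: "bounded_linear (\<lambda>y::'a::complex_inner. cinner x y)"
proof (rule bounded_linear_intro[where K = "2 * norm x"])
  fix y z :: 'a and r
  show "cinner x (y + z) = cinner x y + cinner x z" by (rule cinner_add_right)
  show "cinner x (r *\<^sub>R y) = r *\<^sub>R cinner x y"
    by (simp add: scaleR_scaleC cinner_scaleC_right scaleR_conv_of_real)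
  have "norm (\<i> *\<^sub>C y) = norm y"
    by (simp add: norm_eq_sqrt_inner inner_eq_Re_cinner cinner_scaleC_left cinner_scaleC_right)
  then have "\<bar>inner x y\<bar> \<le> norm x * norm y" "\<bar>inner x (\<i> *\<^sub>C y)\<bar> \<le> norm x * norm y"
    using Cauchy_Schwarz_ineq2[of x y] Cauchy_Schwarz_ineq2[of x "\<i> *\<^sub>C y"] by auto
  moreover have "cmod (cinner x y) \<le> \<bar>inner x y\<bar> + \<bar>inner x (\<i> *\<^sub>C y)\<bar>"
    using cmod_le[of "cinner x y"] by (simp add: cinner_eq[of x y])
  ultimately have "cmod (cinner x y) \<le> 2 * (norm x * norm y)" by linarith
  then show "cmod (cinner x y) \<le> norm y * (2 * norm x)" by (simp add: mult_ac)
qed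

definition orthonormal_basis :: "(nat \<Rightarrow> 'h::complex_hilbert) \<Rightarrow> bool" where
  "orthonormal_basis e \<longleftrightarrow>
     (\<forall>i j. cinner (e i) (e j) = (if i = j then 1 else 0)) \<and> closure (cspan (range e)) = UNIV"

section \<open>Bounded operators\<close>

text \<open>
  Operators are elements of \<^typ>\<open>'h \<Rightarrow>\<^sub>L 'h\<close>, with the operator norm. Elements of this type are only
  real-linear, but all operators below are complex-linear: norm limits of complex matrices are
  (lemma \<open>compact_over_clinear\<close>).
\<close>

definition clinear_op :: "('h::complex_inner \<Rightarrow>\<^sub>L 'h) \<Rightarrow> bool" where
  "clinear_op T \<longleftrightarrow> (\<forall>c x. blinfun_apply T (c *\<^sub>C x) = c *\<^sub>C blinfun_apply T x)"

definition adj :: "('h::complex_hilbert \<Rightarrow>\<^sub>L 'h) \<Rightarrow> ('h \<Rightarrow>\<^sub>L 'h)" where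
  "adj T = (THE S. \<forall>x y. cinner (blinfun_apply T x) y = cinner x (blinfun_apply S y))"

definition normal_op :: "('h::complex_hilbert \<Rightarrow>\<^sub>L 'h) \<Rightarrow> bool" where
  "normal_op T \<longleftrightarrow> adj T o\<^sub>L T = T o\<^sub>L adj T"

definition unitary_op :: "('h::complex_hilbert \<Rightarrow>\<^sub>L 'h) \<Rightarrow> bool" where
  "unitary_op U \<longleftrightarrow> adj U o\<^sub>L U = id_blinfun \<and> U o\<^sub>L adj U = id_blinfun"

definition eigenspace :: "('h::complex_inner \<Rightarrow>\<^sub>L 'h) \<Rightarrow> complex \<Rightarrow> 'h set" where
  "eigenspace T \<mu> = {v. blinfun_apply T v = \<mu> *\<^sub>C v}"

definition Eig :: "('h::complex_inner \<Rightarrow>\<^sub>L 'h) \<Rightarrow> complex set" where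
  "Eig T = {\<mu>. \<exists>v. v \<noteq> 0 \<and> blinfun_apply T v = \<mu> *\<^sub>C v}"

text \<open>Infinite-dimensional spaces have \<^const>\<open>cdim\<close> equal to 0, so they are excluded here as well.\<close>

definition multiplicity_free :: "('h::complex_inner \<Rightarrow>\<^sub>L 'h) \<Rightarrow> bool" where
  "multiplicity_free T \<longleftrightarrow> (\<forall>\<mu>\<in>Eig T. cdim (eigenspace T \<mu>) = 1)"

subsection \<open>Existence of adjoints\<close>

lemma riesz_real:
  fixes f :: "'a::{real_inner,complete_space} \<Rightarrow> real"
  assumes "bounded_linear f"
  shows "\<exists>z. \<forall>x. f x = inner z x"
proof -
  interpret f: bounded_linear f by fact
  define J where "J v = inner v v - 2 * f v" for v
  obtain K where K: "\<And>v. norm (f v) \<le> norm v * K" using f.bounded by blast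
  have bdd: "- (K\<^sup>2) \<le> J v" for v
  proof -
    have "f v \<le> norm v * K" using K[of v] by (simp add: abs_le_iff)
    moreover have "0 \<le> (norm v - K)\<^sup>2" by simp
    ultimately show ?thesis
      by (simp add: J_def power2_diff flip: power2_norm_eq_inner)
  qed
  define m where "m = (INF v. J v)"
  have bb: "bdd_below (range J)" using bdd by (intro bdd_belowI[where m = "- (K\<^sup>2)"]) auto
  have m_le: "m \<le> J v" for v unfolding m_def using bb by (rule cINF_lower) simp
  have "\<exists>v. J v < m + inverse (real (Suc n))" for n
    using cINF_less_iff[OF _ bb, of "m + inverse (real (Suc n))"]
    by (simp add: m_def[symmetric])
  then obtain v where v: "\<And>n. J (v n) < m + inverse (real (Suc n))" by metis
  have par: "(norm (x - y))\<^sup>2 = 2 * J x + 2 * J y - 4 * J ((1/2) *\<^sub>R (x + y))" for x y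
    unfolding J_def power2_norm_eq_inner
    by (simp add: f.scaleR f.add inner_add_left inner_add_right inner_diff_left inner_diff_right
        inner_commute algebra_simps)
  have "Cauchy v"
  proof (rule metric_CauchyI)
    fix \<epsilon> :: real assume "\<epsilon> > 0"
    then obtain N where N: "inverse (real (Suc N)) < \<epsilon>\<^sup>2 / 4"
      using reals_Archimedean[of "\<epsilon>\<^sup>2 / 4"] by auto
    show "\<exists>M. \<forall>i\<ge>M. \<forall>j\<ge>M. dist (v i) (v j) < \<epsilon>"
    proof (intro exI allI impI)
      fix i j assume "N \<le> i" "N \<le> j"
      then have "inverse (real (Suc i)) \<le> inverse (real (Suc N))"
        "inverse (real (Suc j)) \<le> inverse (real (Suc N))" by (auto intro: le_imp_inverse_le)
      then have "J (v i) < m + \<epsilon>\<^sup>2 / 4" "J (v j) < m + \<epsilon>\<^sup>2 / 4" using v[of i] v[of j] N by linarith+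
      then have "(norm (v i - v j))\<^sup>2 < \<epsilon>\<^sup>2"
        using par[of "v i" "v j"] m_le[of "(1/2) *\<^sub>R (v i + v j)"] by linarith
      then show "dist (v i) (v j) < \<epsilon>"
        using \<open>\<epsilon> > 0\<close> by (simp add: dist_norm power2_less_imp_less)
    qed
  qed
  then obtain z where z: "v \<longlonglongrightarrow> z" by (auto simp: Cauchy_convergent_iff convergent_def)
  have "(\<lambda>n. J (v n)) \<longlonglongrightarrow> J z"
    unfolding J_def by (intro tendsto_intros z f.tendsto)
  moreover have "(\<lambda>n. m + inverse (real (Suc n))) \<longlonglongrightarrow> m + 0"
    by (intro tendsto_intros LIMSEQ_inverse_real_of_nat)
  ultimately have "J z \<le> m + 0"
    by (rule LIMSEQ_le) (intro exI allI impI less_imp_le v)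
  then have min: "J z \<le> J w" for w using m_le[of w] by simp
  have "f w = inner z w" for w
  proof -
    define d where "d = inner z w - f w"
    have "0 \<le> 2 * t * d + t\<^sup>2 * inner w w" for t
      using min[of "z + t *\<^sub>R w"]
      by (simp add: J_def d_def f.add f.scaleR inner_add_left inner_add_right inner_commute
          power2_eq_square algebra_simps)
    note quadratic = this
    define k where "k = 1 / (inner w w + 1)"
    have pos: "0 < inner w w + 1" using inner_ge_zero[of w] by linarith
    then have "k > 0" and k: "k * inner w w = 1 - k" by (simp_all add: k_def field_simps)
    have "2 * (- d * k) * d + (- d * k)\<^sup>2 * inner w w = - 2 * k * d\<^sup>2 + d\<^sup>2 * k * (k * inner w w)"
      by (simp add: power2_eq_square)
    also have "\<dots> = - (k * d\<^sup>2) - k\<^sup>2 * d\<^sup>2"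
      unfolding k by (simp add: power2_eq_square algebra_simps)
    finally have "k * d\<^sup>2 + k\<^sup>2 * d\<^sup>2 \<le> 0" using quadratic[of "- d * k"] by linarith
    moreover have "0 \<le> k\<^sup>2 * d\<^sup>2" by simp
    ultimately have "k * d\<^sup>2 \<le> 0" by linarith
    then have "d = 0" using \<open>k > 0\<close> by (simp add: mult_le_0_iff)
    then show ?thesis by (simp add: d_def)
  qed
  then show ?thesis by blast
qed

lemma adj_ex1:
  fixes T :: "'h::complex_hilbert \<Rightarrow>\<^sub>L 'h"
  assumes "clinear_op T"
  shows "\<exists>!S. \<forall>x y. cinner (blinfun_apply T x) y = cinner x (blinfun_apply S y)"
proof (rule ex_ex1I)
  have "\<exists>z. \<forall>x. inner (blinfun_apply T x) y = inner x z" for y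
  proof -
    have "bounded_linear (\<lambda>x. inner (blinfun_apply T x) y)"
      by (rule bounded_linear_compose[OF bounded_linear_inner_left blinfun.bounded_linear_right])
    from riesz_real[OF this] obtain z where "\<forall>x. inner (blinfun_apply T x) y = inner z x" ..
    then have "\<forall>x. inner (blinfun_apply T x) y = inner x z" by (simp add: inner_commute)
    then show ?thesis ..
  qed
  then have "\<exists>s. \<forall>y x. inner (blinfun_apply T x) y = inner x (s y)" by (intro choice allI)
  then obtain s where s: "\<And>x y. inner (blinfun_apply T x) y = inner x (s y)" by blast
  have "bounded_linear s"
  proof (rule bounded_linear_intro[where K = "norm T"])
    fix x y :: 'h and r
    show "s (x + y) = s x + s y"
      by (rule vector_eq_ldot[THEN iffD1], rule allI) (simp add: inner_add_right flip: s)
    show "s (r *\<^sub>R x) = r *\<^sub>R s x"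
      by (rule vector_eq_ldot[THEN iffD1], rule allI) (simp add: inner_scaleR_right flip: s)
    have "(norm (s x))\<^sup>2 = inner (blinfun_apply T (s x)) x" by (simp add: s power2_norm_eq_inner)
    also have "\<dots> \<le> norm (blinfun_apply T (s x)) * norm x" by (rule norm_cauchy_schwarz)
    also have "\<dots> \<le> (norm T * norm (s x)) * norm x" by (intro mult_right_mono norm_blinfun) simp
    finally show "norm (s x) \<le> norm x * norm T"
      by (cases "norm (s x) = 0") (auto simp: power2_eq_square mult_ac)
  qed
  moreover have "cinner (blinfun_apply T x) y = cinner x (s y)" for x y
  proof -
    have *: "inner u (\<i> *\<^sub>C w) = - inner (\<i> *\<^sub>C u) w" for u w :: 'h
      by (simp add: inner_eq_Re_cinner cinner_scaleC_left cinner_scaleC_right)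
    have "inner (blinfun_apply T x) (\<i> *\<^sub>C y) = inner x (\<i> *\<^sub>C s y)"
      using assms by (simp add: * clinear_op_def flip: s)
    then show ?thesis by (simp add: cinner_eq s)
  qed
  ultimately show "\<exists>S. \<forall>x y. cinner (blinfun_apply T x) y = cinner x (blinfun_apply S y)"
    by (intro exI[of _ "Blinfun s"]) (simp add: bounded_linear_Blinfun_apply)
next
  fix S S' :: "'h \<Rightarrow>\<^sub>L 'h"
  assume "\<forall>x y. cinner (blinfun_apply T x) y = cinner x (blinfun_apply S y)"
    and "\<forall>x y. cinner (blinfun_apply T x) y = cinner x (blinfun_apply S' y)"
  then have "inner x (blinfun_apply S y) = inner x (blinfun_apply S' y)" for x y
    by (simp add: inner_eq_Re_cinner)
  then show "S = S'" by (intro blinfun_eqI) (metis vector_eq_ldot)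
qed

lemma cinner_adj:
  fixes T :: "'h::complex_hilbert \<Rightarrow>\<^sub>L 'h"
  assumes "clinear_op T"
  shows "cinner (blinfun_apply T x) y = cinner x (blinfun_apply (adj T) y)"
  using theI'[OF adj_ex1[OF assms]] unfolding adj_def by blast

section \<open>Compact operators over a space\<close>

definition matrix_op :: "(nat \<Rightarrow> 'h::complex_hilbert) \<Rightarrow> nat \<Rightarrow> (nat \<Rightarrow> nat \<Rightarrow> complex) \<Rightarrow> 'h \<Rightarrow>\<^sub>L 'h" where
  "matrix_op e n a = Blinfun (\<lambda>v. \<Sum>i<n. \<Sum>j<n. (a i j * cinner (e j) v) *\<^sub>C e i)"

lemma matrix_op_apply:
  "blinfun_apply (matrix_op e n a) v = (\<Sum>i<n. \<Sum>j<n. (a i j * cinner (e j) v) *\<^sub>C e i)"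
proof -
  have bl: "bounded_linear (\<lambda>c. c *\<^sub>C x)" for x :: 'a
    by (rule bounded_linear_intro[where K = "norm x"])
      (simp_all add: scaleC_add_left scaleR_scaleC scaleC_scaleC scaleR_conv_of_real norm_scaleC)
  have "bounded_linear (\<lambda>v. \<Sum>i<n. \<Sum>j<n. (a i j * cinner (e j) v) *\<^sub>C e i)"
    by (intro bounded_linear_sum bounded_linear_compose[OF bl] bounded_linear_const_mult
        bounded_linear_cinner_right)
  then show ?thesis by (simp add: matrix_op_def bounded_linear_Blinfun_apply)
qed

definition finite_matrices_over ::
    "(nat \<Rightarrow> 'h::complex_hilbert) \<Rightarrow> 'x::topological_space set \<Rightarrow> ('x \<Rightarrow> 'h \<Rightarrow>\<^sub>L 'h) set" where
  "finite_matrices_over e X =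
     {M. \<exists>n a. (\<forall>i<n. \<forall>j<n. continuous_on X (a i j)) \<and> M = (\<lambda>x. matrix_op e n (\<lambda>i j. a i j x))}"

text \<open>
  The ring of compact operators over \<open>X\<close>, as a set of families. Families are total functions of which
  only the values on \<open>X\<close> matter.
\<close>

definition compact_over ::
    "(nat \<Rightarrow> 'h::complex_hilbert) \<Rightarrow> 'x::topological_space set \<Rightarrow> ('x \<Rightarrow> 'h \<Rightarrow>\<^sub>L 'h) set" where
  "compact_over e X =
     {A. \<exists>M. (\<forall>n. M n \<in> finite_matrices_over e X) \<and> uniform_limit X M A sequentially}"

lemma compact_over_clinear:
  assumes "A \<in> compact_over e X" "x \<in> X"
  shows "clinear_op (A x)"
  unfolding clinear_op_def
proof (intro allI)
  fix c v
  obtain M where M: "\<And>n. M n \<in> finite_matrices_over e X" "uniform_limit X M A sequentially"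
    using assms(1) by (auto simp: compact_over_def)
  have lim: "(\<lambda>n. M n x) \<longlonglongrightarrow> A x" using tendsto_uniform_limitI[OF M(2) assms(2)] .
  have lin: "blinfun_apply (M n x) (c *\<^sub>C v) = c *\<^sub>C blinfun_apply (M n x) v" for n
  proof -
    obtain k a where "M n = (\<lambda>x. matrix_op e k (\<lambda>i j. a i j x))"
      using M(1)[of n] by (auto simp: finite_matrices_over_def)
    then show ?thesis
      by (simp add: matrix_op_apply complex_vector.scale_sum_right cinner_scaleC_right
          scaleC_scaleC mult_ac)
  qed
  have "(\<lambda>n. blinfun_apply (M n x) (c *\<^sub>C v)) \<longlonglongrightarrow> blinfun_apply (A x) (c *\<^sub>C v)"
    by (intro tendsto_intros lim)
  moreover have "(\<lambda>n. blinfun_apply (M n x) (c *\<^sub>C v)) \<longlonglongrightarrow> c *\<^sub>C blinfun_apply (A x) v"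
    unfolding lin by (intro bounded_linear.tendsto[OF bounded_linear_scaleC] tendsto_intros lim)
  ultimately show "blinfun_apply (A x) (c *\<^sub>C v) = c *\<^sub>C blinfun_apply (A x) v"
    by (rule LIMSEQ_unique)
qed

definition condition1_interval :: "(real \<Rightarrow> 'h::complex_hilbert \<Rightarrow>\<^sub>L 'h) \<Rightarrow> bool" where
  "condition1_interval A \<longleftrightarrow>
     (\<forall>x0\<in>{0..1}. \<forall>\<mu>\<in>Eig (A x0).
        \<exists>l. continuous_on {0..1} l \<and> l x0 = \<mu> \<and> (\<forall>x\<in>{0..1}. l x \<in> Eig (A x)))"

definition condition1_circle :: "(complex \<Rightarrow> 'h::complex_hilbert \<Rightarrow>\<^sub>L 'h) \<Rightarrow> bool" where
  "condition1_circle A \<longleftrightarrow>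
     condition1_interval (\<lambda>x. A (exp (2 * complex_of_real pi * complex_of_real x * \<i>)))"

definition approx_unitarily_equivalent ::
    "(nat \<Rightarrow> 'h::complex_hilbert) \<Rightarrow> 'x::topological_space set
      \<Rightarrow> ('x \<Rightarrow> 'h \<Rightarrow>\<^sub>L 'h) \<Rightarrow> ('x \<Rightarrow> 'h \<Rightarrow>\<^sub>L 'h) \<Rightarrow> bool" where
  "approx_unitarily_equivalent e X A B \<longleftrightarrow>
     (\<forall>\<epsilon>>0. \<exists>U. continuous_on X U
        \<and> (\<forall>x\<in>X. unitary_op (U x))
        \<and> (\<lambda>x. U x - id_blinfun) \<in> compact_over e X
        \<and> (\<forall>x\<in>X. norm (B x - (adj (U x) o\<^sub>L A x o\<^sub>L U x)) < \<epsilon>))"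

end

theory Submission
  imports Defs
begin

text \<open>
  Pull \<open>A\<close> and \<open>B\<close> back to closed paths over the interval \<open>[0, 1]\<close>. Simple eigenvalues of a
  continuous family of normal compact operators that stay away from \<open>0\<close> vary continuously, and two
  continuous selections of eigenvalues that meet once coincide. Condition (1) therefore splits the
  spectrum into continuous functions with pairwise disjoint graphs, and by compactness only finitely
  many of them, the large ones, ever reach modulus \<open>\<epsilon>\<close> (\<open>finitely_many_large_selections\<close>). Over an interval each large
  one has a continuous unit eigenvector \<open>v\<^sub>i\<close> for \<open>A\<close> and \<open>w\<^sub>i\<close> for \<open>B\<close> (\<open>continuous_unit_eigenvector\<close>).
  If unitaries \<open>U x\<close> send \<open>w\<^sub>i x\<close> to \<open>v\<^sub>i x\<close>, then \<open>B\<close> and \<open>U* A U\<close> agree on the span of the \<open>w\<^sub>i\<close>, and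
  what is left of either operator has norm at most \<open>\<epsilon>\<close> (\<open>conjugation_error_le\<close>).

  Two points need care. The first is to find \<open>U\<close> in \<open>I + K\<close>, depending continuously on \<open>x\<close>. In infinite
  dimension this is easy: a continuous unit vector field \<open>u\<close> on a compact space stays away from some
  basis vector \<open>e k\<close> with \<open>k\<close> large, and the complex Householder reflection that sends \<open>u\<close> to \<open>e k\<close> is
  then continuous and a rank-one perturbation of the identity. Induction moves any finite orthonormal
  frame to basis vectors, hence any frame to any other (\<open>frames_conjugate\<close>).

  The second is that \<open>U\<close> lives on the interval, while a family on the circle needs \<open>U 0 = U 1\<close>. Following
  an eigenvalue once around the circle may lead to another one, and the monodromy permutation can have
  infinite cycles, so the finite set of large selections need not be invariant under it. But an
  eigenvalue of modulus at least \<open>\<epsilon>\<close> at the base point belongs to a large selection at both ends, so both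
  \<open>U 0\<close> and \<open>U 1\<close> send its eigenline for \<open>B\<close> to its eigenline for \<open>A\<close>. Hence \<open>U 1* U 0\<close> preserves the
  finitely many large eigenlines of \<open>B\<close> at the base point. It is joined to the identity by the path
  \<open>U 1* U t\<close>; along this path the eigenlines trace a closed path of frames, and moving that frame back
  by \<open>frames_conjugate\<close> yields a path from \<open>U 1* U 0\<close> to the identity that preserves the eigenlines all
  the time (\<open>ends_correction\<close>). Inserting it near the end point, where \<open>B\<close> is almost constant, closes
  \<open>U\<close> up at the cost of a few more \<open>\<epsilon>\<close>.
\<close>

section \<open>Sesquilinear algebra and adjoints\<close>

lemma cmod_cinner_le: "cmod (cinner x y) \<le> norm x * norm (y::'a::complex_inner)"
proof -
  define z where "z = cinner x y"
  obtain c where c: "cmod c = 1" "c * z = complex_of_real (cmod z)"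
  proof (cases "z = 0")
    case False
    have "cnj z / cmod z * z = complex_of_real ((cmod z)\<^sup>2) / cmod z"
      using complex_norm_square[of z] by (simp add: mult.commute)
    with False show ?thesis
      by (intro that[of "cnj z / cmod z"]) (auto simp: norm_divide power2_eq_square)
  qed (auto intro: that[of 1])
  have "cmod z = Re (cinner x (c *\<^sub>C y))"
    using c by (simp add: cinner_scaleC_right z_def)
  also have "\<dots> \<le> norm x * norm (c *\<^sub>C y)"
    by (metis inner_eq_Re_cinner norm_cauchy_schwarz)
  finally show ?thesis using c by (simp add: norm_scaleC z_def)
qed

lemma bounded_bilinear_cinner: "bounded_bilinear (cinner :: 'a::complex_inner \<Rightarrow> 'a \<Rightarrow> complex)"
proof
  show "\<exists>K. \<forall>a b. norm (cinner a (b::'a)) \<le> norm a * norm b * K"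
    by (rule exI[of _ 1]) (simp add: cmod_cinner_le)
qed (auto simp: cinner_add_left cinner_add_right scaleR_scaleC cinner_scaleC_left
    cinner_scaleC_right scaleR_conv_of_real)

lemma bounded_bilinear_scaleC:
  "bounded_bilinear (scaleC :: complex \<Rightarrow> 'a::complex_inner \<Rightarrow> 'a)"
proof
  show "\<exists>K. \<forall>a b. norm (a *\<^sub>C (b::'a)) \<le> norm a * norm b * K"
    by (rule exI[of _ 1]) (simp add: norm_scaleC)
qed (auto simp: scaleC_add_left scaleC_add_right scaleR_scaleC scaleC_scaleC mult_ac
    scaleR_conv_of_real)

interpretation cinner: bounded_bilinear "cinner :: 'a::complex_inner \<Rightarrow> 'a \<Rightarrow> complex"
  by (rule bounded_bilinear_cinner)

interpretation scaleC: bounded_bilinear "scaleC :: complex \<Rightarrow> 'a::complex_inner \<Rightarrow> 'a"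
  by (rule bounded_bilinear_scaleC)

lemmas cinner_simps = cinner_add_left cinner_add_right cinner_scaleC_left cinner_scaleC_right
  cinner.diff_left cinner.diff_right

lemma cinner_self: "cinner x x = complex_of_real ((norm x)\<^sup>2)"
proof (rule complex_eqI)
  show "Re (cinner x x) = Re (complex_of_real ((norm x)\<^sup>2))"
    by (simp add: power2_norm_eq_inner inner_eq_Re_cinner)
  show "Im (cinner x x) = Im (complex_of_real ((norm x)\<^sup>2))"
    using arg_cong[OF cinner_commute[of x x], of Im] by simp
qed

lemma cinner_eqI: "(\<And>x. cinner x y = cinner x z) \<Longrightarrow> y = z"
  by (metis inner_eq_Re_cinner vector_eq_ldot)

lemma adj_eqI:
  assumes "\<And>x y. cinner (blinfun_apply T x) y = cinner x (blinfun_apply S y)"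
  shows "adj T = S"
  unfolding adj_def
proof (rule the_equality)
  fix S' assume "\<forall>x y. cinner (blinfun_apply T x) y = cinner x (blinfun_apply S' y)"
  with assms show "S' = S" by (intro blinfun_eqI cinner_eqI) metis
qed (use assms in blast)

lemma clinear_opI: "(\<And>c x. blinfun_apply T (c *\<^sub>C x) = c *\<^sub>C blinfun_apply T x) \<Longrightarrow> clinear_op T"
  by (auto simp: clinear_op_def)

lemma clinear_opD: "clinear_op T \<Longrightarrow> blinfun_apply T (c *\<^sub>C x) = c *\<^sub>C blinfun_apply T x"
  by (auto simp: clinear_op_def)

lemma cinner_adj':
  assumes "clinear_op T"
  shows "cinner (blinfun_apply (adj T) x) y = cinner x (blinfun_apply T y)"
  by (metis assms cinner_adj cinner_commute)

lemma clinear_adj: "clinear_op T \<Longrightarrow> clinear_op (adj T)"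
  by (intro clinear_opI cinner_eqI) (simp add: cinner_scaleC_right flip: cinner_adj)

lemma clinear_add: "clinear_op S \<Longrightarrow> clinear_op T \<Longrightarrow> clinear_op (S + T)"
  by (simp add: clinear_op_def blinfun.add_left scaleC_add_right)

lemma clinear_diff: "clinear_op S \<Longrightarrow> clinear_op T \<Longrightarrow> clinear_op (S - T)"
  by (simp add: clinear_op_def blinfun.diff_left scaleC.diff_right)

lemma clinear_id: "clinear_op id_blinfun"
  by (simp add: clinear_op_def)

lemma adj_adj: "clinear_op T \<Longrightarrow> adj (adj T) = T"
  by (intro adj_eqI cinner_adj')

lemma adj_compose:
  assumes "clinear_op S" "clinear_op T"
  shows "adj (S o\<^sub>L T) = adj T o\<^sub>L adj S"
  by (intro adj_eqI) (simp add: assms cinner_adj)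

lemma adj_diff:
  assumes "clinear_op S" "clinear_op T"
  shows "adj (S - T) = adj S - adj T"
  by (intro adj_eqI) (simp add: assms cinner_adj blinfun.diff_left cinner_simps)

lemma adj_id: "adj id_blinfun = id_blinfun"
  by (intro adj_eqI) simp

lemma norm_adj_le:
  assumes "clinear_op T"
  shows "norm (adj T) \<le> norm T"
proof (rule norm_blinfun_bound)
  fix x
  let ?y = "blinfun_apply (adj T) x"
  have "complex_of_real ((norm ?y)\<^sup>2) = cinner x (blinfun_apply T ?y)"
    using cinner_self[of ?y] by (simp add: cinner_adj' assms)
  then have "(norm ?y)\<^sup>2 = cmod (cinner x (blinfun_apply T ?y))"
    by (metis abs_of_nonneg norm_of_real zero_le_power2)
  also have "\<dots> \<le> norm x * (norm T * norm ?y)"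
    by (meson cmod_cinner_le mult_left_mono norm_blinfun norm_ge_zero order_trans)
  finally show "norm ?y \<le> norm T * norm x"
    by (cases "norm ?y = 0") (auto simp: power2_eq_square mult_ac)
qed simp

text \<open>
  On complex-linear operators \<open>adj\<close> is additive and norm-decreasing; elsewhere its value is an
  unspecified default, hence the restriction to complex-linear families.
\<close>

lemma continuous_on_adj:
  fixes T :: "'x::metric_space \<Rightarrow> 'h::complex_hilbert \<Rightarrow>\<^sub>L 'h"
  assumes "continuous_on S T" "\<And>x. x \<in> S \<Longrightarrow> clinear_op (T x)"
  shows "continuous_on S (\<lambda>x. adj (T x))"
  unfolding continuous_on_iff
proof (intro ballI allI impI)
  fix x and \<epsilon> :: real assume "x \<in> S" "\<epsilon> > 0"
  then obtain d where d: "d > 0" "\<And>y. y \<in> S \<Longrightarrow> dist y x < d \<Longrightarrow> dist (T y) (T x) < \<epsilon>"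
    using assms(1) unfolding continuous_on_iff by blast
  have "dist (adj (T y)) (adj (T x)) < \<epsilon>" if "y \<in> S" "dist y x < d" for y
    using d(2)[OF that] norm_adj_le[of "T y - T x"] assms(2) \<open>x \<in> S\<close> that
    by (auto simp: dist_norm adj_diff clinear_diff)
  with \<open>d > 0\<close> show "\<exists>d>0. \<forall>y\<in>S. dist y x < d \<longrightarrow> dist (adj (T y)) (adj (T x)) < \<epsilon>" by blast
qed

subsection \<open>Unitaries\<close>

lemma unitary_adj_apply:
  assumes "unitary_op U"
  shows "blinfun_apply (adj U) (blinfun_apply U x) = x"
    and "blinfun_apply U (blinfun_apply (adj U) x) = x"
  using assms unfolding unitary_op_def
  by (metis blinfun_apply_blinfun_compose blinfun_apply_id_blinfun id_apply)+

lemma unitary_adj: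
  assumes "clinear_op U" "unitary_op U"
  shows "unitary_op (adj U)"
  using assms by (auto simp: unitary_op_def adj_adj)

lemma unitary_compose:
  assumes "clinear_op U" "unitary_op U" "clinear_op V" "unitary_op V"
  shows "unitary_op (U o\<^sub>L V)"
  unfolding unitary_op_def adj_compose[OF assms(1,3)]
  by (auto intro!: blinfun_eqI simp: unitary_adj_apply assms)

lemma unitary_cinner:
  assumes "clinear_op U" "unitary_op U"
  shows "cinner (blinfun_apply U x) (blinfun_apply U y) = cinner x y"
  by (simp add: cinner_adj assms unitary_adj_apply)

lemma unitary_norm:
  assumes "clinear_op U" "unitary_op U"
  shows "norm (blinfun_apply U x) = norm x"
  using unitary_cinner[OF assms, of x x] by (simp add: cinner_self)
    (metis norm_ge_zero of_real_eq_iff of_real_power power2_eq_iff_nonneg)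

lemma norm_unitary_conj:
  assumes "clinear_op U" "unitary_op U"
  shows "norm (adj U o\<^sub>L T o\<^sub>L U) \<le> norm T"
proof (rule norm_blinfun_bound)
  fix x
  have "norm (blinfun_apply (adj U o\<^sub>L T o\<^sub>L U) x) = norm (blinfun_apply T (blinfun_apply U x))"
    by (simp add: unitary_norm[OF clinear_adj unitary_adj] assms)
  also have "\<dots> \<le> norm T * norm (blinfun_apply U x)" by (rule norm_blinfun)
  finally show "norm (blinfun_apply (adj U o\<^sub>L T o\<^sub>L U) x) \<le> norm T * norm x"
    by (simp add: unitary_norm assms)
qed simp

subsection \<open>Rank-one operators\<close>

definition rank1 :: "'h::complex_hilbert \<Rightarrow> 'h \<Rightarrow> 'h \<Rightarrow>\<^sub>L 'h" where
  "rank1 a b = Blinfun (\<lambda>x. cinner b x *\<^sub>C a)"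

lemma rank1_apply [simp]: "blinfun_apply (rank1 a b) x = cinner b x *\<^sub>C a"
proof -
  have "bounded_linear (\<lambda>x. cinner b x *\<^sub>C a)"
    by (rule bounded_linear_compose[OF scaleC.bounded_linear_left bounded_linear_cinner_right])
  then show ?thesis by (simp add: rank1_def bounded_linear_Blinfun_apply)
qed

lemma bounded_bilinear_rank1: "bounded_bilinear rank1"
proof
  show "\<exists>K. \<forall>a b :: 'a. norm (rank1 a b) \<le> norm a * norm b * K"
  proof (intro exI[of _ 1] allI)
    fix a b :: 'a
    have "norm (rank1 a b) \<le> norm b * norm a"
    proof (rule norm_blinfun_bound)
      fix x
      show "norm (blinfun_apply (rank1 a b) x) \<le> norm b * norm a * norm x"
        using mult_right_mono[OF cmod_cinner_le[of b x], of "norm a"]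
        by (simp add: norm_scaleC mult_ac)
    qed simp
    then show "norm (rank1 a b) \<le> norm a * norm b * 1" by (simp add: mult_ac)
  qed
qed (auto intro!: blinfun_eqI simp: cinner_simps scaleC_add_left scaleC_add_right
    blinfun.add_left blinfun.scaleR_left scaleR_scaleC scaleC_scaleC mult_ac)

interpretation rank1: bounded_bilinear rank1 by (rule bounded_bilinear_rank1)

lemma clinear_rank1: "clinear_op (rank1 a b)"
  by (simp add: clinear_op_def cinner_simps scaleC_scaleC mult_ac)

lemma adj_rank1: "adj (rank1 a b) = rank1 b a"
  by (intro adj_eqI) (simp add: cinner_simps mult_ac, metis cinner_commute)

lemma cnj_mult_self_unimodular: "cmod c = 1 \<Longrightarrow> cnj c * c = 1"
  using complex_norm_square[of c] by (simp add: mult.commute)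

section \<open>Compact operators\<close>

text \<open>
  The fibre of \<^const>\<open>compact_over\<close>: over a compact space its members are exactly the continuous
  families with values in this set (\<open>compact_over_imp\<close> and \<open>compact_over_if\<close> below). This reduces all
  closure properties of the ring of families to statements about single operators.
\<close>

definition compact_ops :: "(nat \<Rightarrow> 'h::complex_hilbert) \<Rightarrow> ('h \<Rightarrow>\<^sub>L 'h) set" where
  "compact_ops e = closure (range (\<lambda>(n, a). matrix_op e n a))"

lemma matrix_op_eq_sum:
  "matrix_op e n a = (\<Sum>i<n. \<Sum>j<n. rank1 (a i j *\<^sub>C e i) (e j))"
  by (intro blinfun_eqI)
    (simp add: matrix_op_apply blinfun.sum_left scaleC_scaleC mult.commute)

lemma matrix_op_enlarge:
  assumes "n \<le> m"
  shows "matrix_op e n a = matrix_op e m (\<lambda>i j. if i < n \<and> j < n then a i j else 0)"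
proof -
  have "(\<Sum>i<m. \<Sum>j<m. rank1 ((if i < n \<and> j < n then a i j else 0) *\<^sub>C e i) (e j))
      = (\<Sum>i<n. \<Sum>j<m. rank1 ((if i < n \<and> j < n then a i j else 0) *\<^sub>C e i) (e j))"
    using assms by (intro sum.mono_neutral_right) (auto simp: scaleC.zero_left rank1.zero_left)
  also have "\<dots> = (\<Sum>i<n. \<Sum>j<n. rank1 ((if i < n \<and> j < n then a i j else 0) *\<^sub>C e i) (e j))"
    using assms by (intro sum.cong refl sum.mono_neutral_right)
      (auto simp: scaleC.zero_left rank1.zero_left)
  also have "\<dots> = (\<Sum>i<n. \<Sum>j<n. rank1 (a i j *\<^sub>C e i) (e j))"
    by (intro sum.cong refl) auto
  finally show ?thesis by (simp add: matrix_op_eq_sum)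
qed

lemma matrix_op_add: "matrix_op e n a + matrix_op e n b = matrix_op e n (\<lambda>i j. a i j + b i j)"
  by (simp add: matrix_op_eq_sum sum.distrib scaleC.add_left rank1.add_left)

lemma clinear_matrix_op: "clinear_op (matrix_op e n a)"
  by (rule clinear_opI)
    (simp add: matrix_op_apply complex_vector.scale_sum_right cinner_scaleC_right
      scaleC_scaleC mult_ac)

lemma matrix_op_in_compact_ops: "matrix_op e n a \<in> compact_ops e"
  unfolding compact_ops_def by (rule subsetD[OF closure_subset]) auto

lemma closed_compact_ops: "closed (compact_ops e)"
  by (simp add: compact_ops_def)

lemma compact_ops_approx:
  assumes "T \<in> compact_ops e" "\<epsilon> > 0"
  obtains n a where "norm (T - matrix_op e n a) < \<epsilon>"
  using assms unfolding compact_ops_def closure_approachable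
  by (force simp: dist_norm norm_minus_commute)

lemma clinear_compact_ops:
  assumes "T \<in> compact_ops e"
  shows "clinear_op T"
proof -
  have "closed {T :: 'a \<Rightarrow>\<^sub>L 'a. clinear_op T}"
    unfolding clinear_op_def
    by (intro closed_Collect_all closed_Collect_eq continuous_intros
        scaleC.continuous_on)
  moreover have "range (\<lambda>(n, a). matrix_op e n a) \<subseteq> {T. clinear_op T}"
    by (auto simp: clinear_matrix_op)
  ultimately show ?thesis
    using assms closure_minimal unfolding compact_ops_def by blast
qed

lemma compact_ops_closureI:
  assumes "\<And>\<epsilon>. \<epsilon> > 0 \<Longrightarrow> \<exists>S\<in>compact_ops e. norm (T - S) < \<epsilon>"
  shows "T \<in> compact_ops e"
proof -
  have "T \<in> closure (compact_ops e)"
    unfolding closure_approachable using assms by (simp add: dist_norm norm_minus_commute)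
  then show ?thesis by (simp add: closed_compact_ops)
qed

lemma compact_ops_add:
  assumes "S \<in> compact_ops e" "T \<in> compact_ops e"
  shows "S + T \<in> compact_ops e"
proof (rule compact_ops_closureI)
  fix \<epsilon> :: real assume "\<epsilon> > 0"
  then obtain n a m b where
    *: "norm (S - matrix_op e n a) < \<epsilon>/2" "norm (T - matrix_op e m b) < \<epsilon>/2"
    using compact_ops_approx[OF assms(1), of "\<epsilon>/2"] compact_ops_approx[OF assms(2), of "\<epsilon>/2"]
    by (metis half_gt_zero)
  have "norm ((S + T) - (matrix_op e n a + matrix_op e m b)) < \<epsilon>"
    using norm_triangle_ineq[of "S - matrix_op e n a" "T - matrix_op e m b"] *
    by (simp add: algebra_simps)
  moreover have "matrix_op e n a + matrix_op e m b \<in> compact_ops e"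
    using matrix_op_enlarge[of n "max n m" e a] matrix_op_enlarge[of m "max n m" e b]
    by (simp add: matrix_op_add matrix_op_in_compact_ops)
  ultimately show "\<exists>R\<in>compact_ops e. norm (S + T - R) < \<epsilon>" by blast
qed

lemma zero_in_compact_ops: "0 \<in> compact_ops e"
  using matrix_op_in_compact_ops[of e 0 "\<lambda>_ _. 0"] by (simp add: matrix_op_eq_sum)

lemma compact_ops_sum: "(\<And>i. i \<in> I \<Longrightarrow> T i \<in> compact_ops e) \<Longrightarrow> (\<Sum>i\<in>I. T i) \<in> compact_ops e"
  by (induction I rule: infinite_finite_induct) (auto simp: zero_in_compact_ops compact_ops_add)

lemma clinear_sum: "(\<And>i. i \<in> I \<Longrightarrow> clinear_op (T i)) \<Longrightarrow> clinear_op (\<Sum>i\<in>I. T i)"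
  by (induction I rule: infinite_finite_induct) (auto simp: clinear_add, auto simp: clinear_op_def scaleC.zero_right)

lemma adj_sum:
  assumes "\<And>i. i \<in> I \<Longrightarrow> clinear_op (T i)"
  shows "adj (\<Sum>i\<in>I. T i) = (\<Sum>i\<in>I. adj (T i))"
  using assms
  by (intro adj_eqI) (simp add: blinfun.sum_left cinner.sum_left cinner.sum_right cinner_adj)

text \<open>
  Density of the span of the basis in the form of an induction principle.
\<close>

lemma closed_subspace_eq_UNIV:
  assumes "orthonormal_basis e" "closed S" "range e \<subseteq> S" "0 \<in> S"
    and "\<And>x y. x \<in> S \<Longrightarrow> y \<in> S \<Longrightarrow> x + y \<in> S" and "\<And>c x. x \<in> S \<Longrightarrow> c *\<^sub>C x \<in> S"
  shows "x \<in> S"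
proof -
  have "complex_vector.subspace S" using assms by (auto simp: complex_vector.subspace_def)
  then have "cspan (range e) \<subseteq> S" using assms(3) complex_vector.span_minimal by blast
  then have "closure (cspan (range e)) \<subseteq> S" using assms(2) closure_minimal by blast
  then show ?thesis using assms(1) by (auto simp: orthonormal_basis_def)
qed

lemma rank1_basis_in_compact_ops: "rank1 (c *\<^sub>C e i) (e j) \<in> compact_ops e"
proof -
  obtain n where n: "i < n" "j < n" by (meson less_Suc_eq_le max.cobounded1 max.cobounded2)
  have "rank1 (c *\<^sub>C e i) (e j) = matrix_op e n (\<lambda>i' j'. if i' = i \<and> j' = j then c else 0)"
  proof -
    have "(\<Sum>i'<n. \<Sum>j'<n. rank1 ((if i' = i \<and> j' = j then c else 0) *\<^sub>C e i') (e j'))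
        = (\<Sum>i'<n. \<Sum>j'<n. if i' = i then if j' = j then rank1 (c *\<^sub>C e i) (e j) else 0 else 0)"
      by (intro sum.cong refl) (auto simp: scaleC.zero_left rank1.zero_left)
    also have "\<dots> = (\<Sum>i'<n. if i' = i then (\<Sum>j'<n. if j' = j then rank1 (c *\<^sub>C e i) (e j) else 0) else 0)"
      by (intro sum.cong refl) auto
    also have "\<dots> = rank1 (c *\<^sub>C e i) (e j)" using n by simp
    finally show ?thesis by (simp only: matrix_op_eq_sum)
  qed
  then show ?thesis by (simp only: matrix_op_in_compact_ops)
qed

lemma rank1_scale: "rank1 (c *\<^sub>C a) b = rank1 a (cnj c *\<^sub>C b)"
proof (rule blinfun_eqI)
  fix x
  show "blinfun_apply (rank1 (c *\<^sub>C a) b) x = blinfun_apply (rank1 a (cnj c *\<^sub>C b)) x"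
    by (simp only: rank1_apply cinner_scaleC_left scaleC_scaleC complex_cnj_cnj mult.commute)
qed

context
  fixes e :: "nat \<Rightarrow> 'h::complex_hilbert"
  assumes onb: "orthonormal_basis e"
begin

lemma rank1_in_compact_ops: "rank1 a b \<in> compact_ops e"
proof -
  have 1: "rank1 a (e j) \<in> compact_ops e" for a j
  proof -
    define S where "S = {a. \<forall>c. rank1 (c *\<^sub>C a) (e j) \<in> compact_ops e}"
    have "a \<in> S"
    proof (rule closed_subspace_eq_UNIV[OF onb])
      show "closed S"
      proof -
        have "closed ((\<lambda>a. rank1 (c *\<^sub>C a) (e j)) -` compact_ops e)" for c
          by (rule closed_vimage[OF closed_compact_ops])
            (intro rank1.continuous_on scaleC.continuous_on continuous_on_const continuous_on_id)
        then show ?thesis unfolding S_def by (auto intro!: closed_Collect_all simp: vimage_def)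
      qed
      show "range e \<subseteq> S"
        by (auto simp: S_def rank1_basis_in_compact_ops)
    qed (auto simp: S_def zero_in_compact_ops rank1.zero_left scaleC_add_right rank1.add_left
        compact_ops_add scaleC_scaleC scaleC.zero_right)
    then have "rank1 (1 *\<^sub>C a) (e j) \<in> compact_ops e" by (simp only: S_def mem_Collect_eq)
    then show ?thesis by (simp only: scaleC_one)
  qed
  define S where "S = {b. \<forall>a. rank1 a b \<in> compact_ops e}"
  have "b \<in> S"
  proof (rule closed_subspace_eq_UNIV[OF onb])
    show "closed S"
    proof -
      have "closed ((\<lambda>b. rank1 a b) -` compact_ops e)" for a
        by (rule closed_vimage[OF closed_compact_ops])
          (intro rank1.continuous_on continuous_on_const continuous_on_id)
      then show ?thesis unfolding S_def by (auto intro!: closed_Collect_all simp: vimage_def)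
    qed
    show "c *\<^sub>C x \<in> S" if "x \<in> S" for c x
    proof -
      have "rank1 a (c *\<^sub>C x) = rank1 (cnj c *\<^sub>C a) x" for a by (simp add: rank1_scale)
      with that show ?thesis by (simp add: S_def)
    qed
  qed (auto simp: S_def 1 zero_in_compact_ops rank1.zero_right rank1.add_right compact_ops_add)
  then show ?thesis by (simp add: S_def)
qed


lemma adj_in_compact_ops:
  assumes "T \<in> compact_ops e"
  shows "adj T \<in> compact_ops e"
proof (rule compact_ops_closureI)
  fix \<epsilon> :: real assume "\<epsilon> > 0"
  from compact_ops_approx[OF assms this] obtain n a where na: "norm (T - matrix_op e n a) < \<epsilon>" .
  have "norm (adj T - adj (matrix_op e n a)) < \<epsilon>"
    using na norm_adj_le[of "T - matrix_op e n a"] clinear_compact_ops[OF assms]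
    by (simp add: adj_diff clinear_diff clinear_matrix_op)
  moreover have "adj (matrix_op e n a) = (\<Sum>i<n. \<Sum>j<n. rank1 (e j) (a i j *\<^sub>C e i))"
    unfolding matrix_op_eq_sum by (simp add: adj_sum clinear_sum clinear_rank1 adj_rank1)
  then have "adj (matrix_op e n a) \<in> compact_ops e"
    by (simp only:) (intro compact_ops_sum rank1_in_compact_ops)
  ultimately show "\<exists>S\<in>compact_ops e. norm (adj T - S) < \<epsilon>" by blast
qed

lemma compose_in_compact_ops_left:
  assumes "clinear_op S" "T \<in> compact_ops e"
  shows "S o\<^sub>L T \<in> compact_ops e"
proof (rule compact_ops_closureI)
  fix \<epsilon> :: real assume "\<epsilon> > 0"
  then have "\<epsilon> / (norm S + 1) > 0" by (simp add: add_nonneg_pos)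
  from compact_ops_approx[OF assms(2) this] obtain n a
    where na: "norm (T - matrix_op e n a) < \<epsilon> / (norm S + 1)" .
  have "norm ((S o\<^sub>L T) - (S o\<^sub>L matrix_op e n a)) \<le> norm S * norm (T - matrix_op e n a)"
    using norm_blinfun_compose[of S "T - matrix_op e n a"]
    by (simp only: bounded_bilinear.diff_right[OF bounded_bilinear_blinfun_compose])
  also have "\<dots> \<le> norm S * (\<epsilon> / (norm S + 1))"
    using na by (intro mult_left_mono) auto
  also have "\<dots> < \<epsilon>"
    using \<open>\<epsilon> > 0\<close> add_nonneg_pos[OF norm_ge_zero[of S] zero_less_one]
    by (simp add: pos_divide_less_eq algebra_simps)
  finally have "norm ((S o\<^sub>L T) - (S o\<^sub>L matrix_op e n a)) < \<epsilon>" .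
  moreover have "S o\<^sub>L matrix_op e n a
      = (\<Sum>i<n. \<Sum>j<n. rank1 (blinfun_apply S (a i j *\<^sub>C e i)) (e j))"
    using assms(1)
    by (intro blinfun_eqI) (simp add: matrix_op_eq_sum blinfun.sum_left blinfun.sum_right clinear_opD)
  then have "S o\<^sub>L matrix_op e n a \<in> compact_ops e"
    by (simp only:) (intro compact_ops_sum rank1_in_compact_ops)
  ultimately show "\<exists>R\<in>compact_ops e. norm ((S o\<^sub>L T) - R) < \<epsilon>" by blast
qed

lemma uminus_in_compact_ops:
  assumes "T \<in> compact_ops e"
  shows "- T \<in> compact_ops e"
proof -
  have "clinear_op (0 - id_blinfun :: 'h \<Rightarrow>\<^sub>L 'h)"
    by (intro clinear_diff clinear_id clinear_opI) (simp add: scaleC.zero_right)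
  from compose_in_compact_ops_left[OF this assms]
  have "(0 - id_blinfun) o\<^sub>L T \<in> compact_ops e" .
  also have "(0 - id_blinfun) o\<^sub>L T = - T"
    by (intro blinfun_eqI) (simp add: blinfun.diff_left blinfun.minus_left)
  finally show ?thesis .
qed

subsection \<open>Compressions to finitely many coordinates\<close>

text \<open>
  The orthogonal projection onto the span of the first \<open>n\<close> basis vectors. Compressing by it turns any
  operator into a finite matrix whose entries depend continuously on the operator.
\<close>

definition trunc :: "nat \<Rightarrow> 'h \<Rightarrow>\<^sub>L 'h" where
  "trunc n = matrix_op e n (\<lambda>i j. if i = j then 1 else 0)"

lemma trunc_apply: "blinfun_apply (trunc n) x = (\<Sum>i<n. cinner (e i) x *\<^sub>C e i)"
proof -
  have "(\<Sum>j<n. ((if i = j then 1 else 0) * cinner (e j) x) *\<^sub>C e i) = cinner (e i) x *\<^sub>C e i"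
    if "i < n" for i
  proof -
    have "(\<Sum>j<n. ((if i = j then 1 else 0) * cinner (e j) x) *\<^sub>C e i)
        = (\<Sum>j<n. if i = j then cinner (e i) x *\<^sub>C e i else 0)"
      by (intro sum.cong) (auto simp: scaleC.zero_left)
    then show ?thesis using that by simp
  qed
  then show ?thesis by (simp add: trunc_def matrix_op_apply)
qed

lemma cinner_basis: "cinner (e i) (e j) = (if i = j then 1 else 0)"
  using onb by (simp add: orthonormal_basis_def)

lemma trunc_basis: "blinfun_apply (trunc n) (e j) = (if j < n then e j else 0)"
proof -
  have "(\<Sum>i<n. cinner (e i) (e j) *\<^sub>C e i) = (\<Sum>i<n. if i = j then e j else 0)"
    by (intro sum.cong) (auto simp: cinner_basis scaleC_one scaleC.zero_left)
  then show ?thesis by (simp add: trunc_apply)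
qed

lemma adj_trunc: "adj (trunc n) = trunc n"
  by (intro adj_eqI) (simp add: trunc_apply cinner.sum_left cinner.sum_right cinner_simps mult.commute
      cinner_commute[symmetric])

lemma clinear_trunc: "clinear_op (trunc n)"
  by (simp add: trunc_def clinear_matrix_op)

lemma trunc_trunc: "blinfun_apply (trunc n) (blinfun_apply (trunc n) x) = blinfun_apply (trunc n) x"
proof -
  have "blinfun_apply (trunc n) (\<Sum>i<n. cinner (e i) x *\<^sub>C e i) = (\<Sum>i<n. cinner (e i) x *\<^sub>C e i)"
    by (simp add: blinfun.sum_right clinear_opD[OF clinear_trunc] trunc_basis cong: sum.cong_simp)
  then show ?thesis by (simp only: trunc_apply[of n x])
qed

lemma norm_trunc_le: "norm (trunc n) \<le> 1"
proof (rule norm_blinfun_bound)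
  fix x
  let ?p = "blinfun_apply (trunc n) x"
  have "cinner ?p ?p = cinner x ?p"
    by (metis adj_trunc cinner_adj clinear_trunc trunc_trunc)
  then have "(norm ?p)\<^sup>2 = cmod (cinner x ?p)"
    by (metis cinner_self abs_of_nonneg norm_of_real zero_le_power2)
  also have "\<dots> \<le> norm x * norm ?p" by (rule cmod_cinner_le)
  finally show "norm ?p \<le> 1 * norm x"
    by (cases "norm ?p = 0") (auto simp: power2_eq_square)
qed simp

lemma trunc_matrix_op:
  assumes "m \<le> n"
  shows "trunc n o\<^sub>L matrix_op e m a o\<^sub>L trunc n = matrix_op e m a"
proof (rule blinfun_eqI)
  fix x
  have "cinner (e j) (blinfun_apply (trunc n) x) = cinner (e j) x" if "j < m" for j
  proof -
    have "cinner (e j) (blinfun_apply (trunc n) x) = cinner (blinfun_apply (trunc n) (e j)) x"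
      by (metis adj_trunc cinner_adj clinear_trunc)
    then show ?thesis using that assms by (simp add: trunc_basis)
  qed
  moreover have "blinfun_apply (trunc n) (e i) = e i" if "i < m" for i
    using that assms by (simp add: trunc_basis)
  ultimately show "blinfun_apply (trunc n o\<^sub>L matrix_op e m a o\<^sub>L trunc n) x
      = blinfun_apply (matrix_op e m a) x"
    by (simp add: matrix_op_apply blinfun.sum_right clinear_opD[OF clinear_trunc])
qed

lemma compression_eq_matrix_op:
  assumes "clinear_op T"
  shows "(trunc n o\<^sub>L T o\<^sub>L trunc n) = matrix_op e n (\<lambda>i j. cinner (e i) (blinfun_apply T (e j)))"
proof (rule blinfun_eqI)
  fix x
  have "cinner (e i) (blinfun_apply T (blinfun_apply (trunc n) x))
      = (\<Sum>j<n. cinner (e j) x * cinner (e i) (blinfun_apply T (e j)))" for i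
    by (simp add: trunc_apply blinfun.sum_right clinear_opD[OF assms] cinner.sum_right cinner_simps)
  then show "blinfun_apply (trunc n o\<^sub>L T o\<^sub>L trunc n) x
      = blinfun_apply (matrix_op e n (\<lambda>i j. cinner (e i) (blinfun_apply T (e j)))) x"
    by (simp add: matrix_op_apply scaleC.sum_left mult.commute
        trunc_apply[of n "blinfun_apply T _"])
qed

lemma norm_compression_le: "norm (trunc n o\<^sub>L T o\<^sub>L trunc n) \<le> norm T"
proof -
  have "norm (trunc n o\<^sub>L T o\<^sub>L trunc n) \<le> norm (trunc n) * norm T * norm (trunc n)"
    by (meson norm_blinfun_compose mult_right_mono norm_ge_zero order_trans)
  also have "\<dots> \<le> 1 * norm T * 1"
    by (intro mult_mono norm_trunc_le mult_nonneg_nonneg) auto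
  finally show ?thesis by simp
qed

text \<open>
  Compression is a contraction, so it may be tested on a nearby operator \<open>S\<close>. Used with \<open>S\<close> a matrix
  for pointwise convergence of compressions, and with \<open>S\<close> a neighbouring value of a continuous family
  for uniform convergence.
\<close>

lemma compression_error:
  "norm (T - (trunc n o\<^sub>L T o\<^sub>L trunc n))
    \<le> 2 * norm (T - S) + norm (S - (trunc n o\<^sub>L S o\<^sub>L trunc n))"
proof -
  have eq: "T - (trunc n o\<^sub>L T o\<^sub>L trunc n) = (T - S) + (S - (trunc n o\<^sub>L S o\<^sub>L trunc n))
      - (trunc n o\<^sub>L (T - S) o\<^sub>L trunc n)"
    by (intro blinfun_eqI) (simp add: blinfun.diff_left blinfun.add_left blinfun.diff_right)
  show ?thesis
    unfolding eq
    using norm_triangle_ineq4[of "(T - S) + (S - (trunc n o\<^sub>L S o\<^sub>L trunc n))"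
        "(trunc n o\<^sub>L (T - S) o\<^sub>L trunc n)"]
      norm_triangle_ineq[of "T - S" "S - (trunc n o\<^sub>L S o\<^sub>L trunc n)"]
      norm_compression_le[of n "T - S"] by linarith
qed

lemma compression_converges:
  assumes "T \<in> compact_ops e" "\<epsilon> > 0"
  obtains m where "\<And>n. n \<ge> m \<Longrightarrow> norm (T - (trunc n o\<^sub>L T o\<^sub>L trunc n)) < \<epsilon>"
proof -
  obtain m a where m: "norm (T - matrix_op e m a) < \<epsilon>/2"
    using compact_ops_approx[OF assms(1)] assms(2) half_gt_zero by metis
  show ?thesis
  proof
    fix n assume "m \<le> n"
    then show "norm (T - (trunc n o\<^sub>L T o\<^sub>L trunc n)) < \<epsilon>"
      using compression_error[of T n "matrix_op e m a"] m by (simp add: trunc_matrix_op)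
  qed
qed

lemma compact_over_imp:
  assumes "A \<in> compact_over e X"
  shows "continuous_on X A" and "\<And>x. x \<in> X \<Longrightarrow> A x \<in> compact_ops e"
proof -
  obtain M where M: "\<And>n. M n \<in> finite_matrices_over e X" "uniform_limit X M A sequentially"
    using assms by (auto simp: compact_over_def)
  have cont: "continuous_on X (M n)" for n
  proof -
    obtain k a where "\<And>i j. i < k \<Longrightarrow> j < k \<Longrightarrow> continuous_on X (a i j)"
      "M n = (\<lambda>x. matrix_op e k (\<lambda>i j. a i j x))"
      using M(1)[of n] by (auto simp: finite_matrices_over_def)
    then show ?thesis unfolding matrix_op_eq_sum
      by (auto intro!: continuous_on_sum rank1.continuous_on scaleC.continuous_on continuous_on_const)
  qed
  then show "continuous_on X A"
    by (intro uniform_limit_theorem[OF _ M(2)]) auto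
  fix x assume "x \<in> X"
  have "M n x \<in> compact_ops e" for n
    using M(1)[of n] by (auto simp: finite_matrices_over_def matrix_op_in_compact_ops)
  then show "A x \<in> compact_ops e"
    by (rule closed_sequentially[OF closed_compact_ops _ tendsto_uniform_limitI[OF M(2) \<open>x \<in> X\<close>]])
qed

text \<open>
  The compressions converge at every point, and by \<open>compression_error\<close> at a uniform rate near every
  point; finitely many such neighbourhoods cover \<open>X\<close>.
\<close>

lemma compact_over_if:
  fixes A :: "'x::metric_space \<Rightarrow> 'h \<Rightarrow>\<^sub>L 'h"
  assumes X: "compact X" and cont: "continuous_on X A"
    and comp: "\<And>x. x \<in> X \<Longrightarrow> A x \<in> compact_ops e"
  shows "A \<in> compact_over e X"
proof -
  define M where "M n x = matrix_op e n (\<lambda>i j. cinner (e i) (blinfun_apply (A x) (e j)))" for n x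
  have M: "M n x = (trunc n o\<^sub>L A x o\<^sub>L trunc n)" if "x \<in> X" for n x
    using compression_eq_matrix_op[OF clinear_compact_ops[OF comp[OF that]]] by (simp add: M_def)
  have fin: "M n \<in> finite_matrices_over e X" for n
    unfolding finite_matrices_over_def
  proof (rule CollectI, intro exI conjI allI impI)
    show "M n = (\<lambda>x. matrix_op e n (\<lambda>i j. cinner (e i) (blinfun_apply (A x) (e j))))"
      by (simp add: M_def fun_eq_iff)
    fix i j
    show "continuous_on X (\<lambda>x. cinner (e i) (blinfun_apply (A x) (e j)))"
      by (intro cinner.continuous_on blinfun.continuous_on continuous_on_const cont)
  qed
  have "uniform_limit X M A sequentially"
    unfolding uniform_limit_iff
  proof (intro allI impI)
    fix \<epsilon> :: real assume "\<epsilon> > 0"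
    have "\<exists>d m. d > 0 \<and> (\<forall>y\<in>X. dist y x < d \<longrightarrow> norm (A y - A x) < \<epsilon>/4) \<and>
        (\<forall>n\<ge>m. norm (A x - (trunc n o\<^sub>L A x o\<^sub>L trunc n)) < \<epsilon>/4)" if "x \<in> X" for x
    proof -
      have e4: "\<epsilon>/4 > 0" using \<open>\<epsilon> > 0\<close> by simp
      from compression_converges[OF comp[OF that] e4] obtain m
        where "\<And>n. n \<ge> m \<Longrightarrow> norm (A x - (trunc n o\<^sub>L A x o\<^sub>L trunc n)) < \<epsilon>/4" by blast
      moreover from cont that e4 obtain d
        where "d > 0" "\<And>y. y \<in> X \<Longrightarrow> dist y x < d \<Longrightarrow> norm (A y - A x) < \<epsilon>/4"
        unfolding continuous_on_iff dist_norm by blast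
      ultimately show ?thesis by blast
    qed
    then obtain d m where dm: "\<And>x. x \<in> X \<Longrightarrow> d x > 0"
      "\<And>x y. x \<in> X \<Longrightarrow> y \<in> X \<Longrightarrow> dist y x < d x \<Longrightarrow> norm (A y - A x) < \<epsilon>/4"
      "\<And>x n. x \<in> X \<Longrightarrow> n \<ge> m x \<Longrightarrow> norm (A x - (trunc n o\<^sub>L A x o\<^sub>L trunc n)) < \<epsilon>/4"
      by metis
    have "X \<subseteq> (\<Union>x\<in>X. ball x (d x))" using dm(1) by force
    from compactE_image[OF X _ this] obtain C
      where C: "C \<subseteq> X" "finite C" "X \<subseteq> (\<Union>x\<in>C. ball x (d x))" by auto
    have "dist (M n y) (A y) < \<epsilon>" if "y \<in> X" and n: "n \<ge> Max (insert 0 (m ` C))" for y n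
    proof -
      obtain x where x: "x \<in> C" "dist x y < d x" using C(3) \<open>y \<in> X\<close> by auto
      then have "m x \<le> n" "x \<in> X" using n C(1,2) by auto
      then have "norm (A y - (trunc n o\<^sub>L A y o\<^sub>L trunc n)) < \<epsilon>"
        using compression_error[of "A y" n "A x"] dm(2)[of x y] dm(3)[of x n] x(2) that
          \<open>\<epsilon> > 0\<close>
        by (simp add: dist_commute)
      then show ?thesis using that by (simp add: M dist_norm norm_minus_commute)
    qed
    then show "\<forall>\<^sub>F n in sequentially. \<forall>x\<in>X. dist (M n x) (A x) < \<epsilon>"
      unfolding eventually_sequentially by blast
  qed
  with fin show ?thesis by (auto simp: compact_over_def)
qed

end

subsection \<open>Compact operators have relatively compact image of the unit ball\<close>

lemma matrix_op_image_compact: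
  "\<exists>C. compact C \<and> blinfun_apply (matrix_op e n a) ` cball 0 1 \<subseteq> C"
proof -
  have rank1: "\<exists>C. compact C \<and> blinfun_apply (rank1 a b) ` cball 0 1 \<subseteq> C" for a b :: 'a
  proof (intro exI conjI)
    show "compact ((\<lambda>c. c *\<^sub>C a) ` cball 0 (norm b))"
      by (intro compact_continuous_image scaleC.continuous_on continuous_intros compact_cball)
    show "blinfun_apply (rank1 a b) ` cball 0 1 \<subseteq> (\<lambda>c. c *\<^sub>C a) ` cball 0 (norm b)"
    proof safe
      fix x :: 'a assume "x \<in> cball 0 1"
      then have "cmod (cinner b x) \<le> norm b * 1"
        using order_trans[OF cmod_cinner_le mult_left_mono] by (metis mem_cball_0 norm_ge_zero)
      then show "blinfun_apply (rank1 a b) x \<in> (\<lambda>c. c *\<^sub>C a) ` cball 0 (norm b)" by auto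
    qed
  qed
  have sum: "\<exists>C. compact C \<and> blinfun_apply (\<Sum>i\<in>I. T i) ` cball 0 1 \<subseteq> C"
    if T: "\<And>i. \<exists>C. compact C \<and> blinfun_apply (T i) ` cball 0 1 \<subseteq> C"
    for I :: "nat set" and T :: "nat \<Rightarrow> 'a \<Rightarrow>\<^sub>L 'a"
  proof (induction I rule: infinite_finite_induct)
    case (insert i I)
    obtain C D where "compact C" "blinfun_apply (T i) ` cball 0 1 \<subseteq> C"
      "compact D" "blinfun_apply (\<Sum>i\<in>I. T i) ` cball 0 1 \<subseteq> D"
      using T[of i] insert.IH by blast
    then show ?case using insert.hyps compact_sums'[of C D]
      by (intro exI[of _ "\<Union>x\<in>C. \<Union>y\<in>D. {x + y}"]) (force simp: blinfun.add_left image_subset_iff)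
  qed (auto intro: exI[of _ "{0}"])
  show ?thesis unfolding matrix_op_eq_sum by (intro sum rank1)
qed

text \<open>
  The image of the unit ball under a matrix lies in a compact set, so the image under a norm limit of
  matrices is totally bounded.
\<close>

lemma compact_ops_convergent_subseq:
  assumes T: "T \<in> compact_ops e" and u: "\<And>k::nat. norm (u k) \<le> 1"
  obtains r y where "strict_mono r" "(\<lambda>k. blinfun_apply T (u (r k))) \<longlonglongrightarrow> y"
proof -
  let ?S = "closure (blinfun_apply T ` cball 0 1)"
  have "\<exists>K. finite K \<and> ?S \<subseteq> (\<Union>x\<in>K. ball x \<epsilon>)" if "\<epsilon> > 0" for \<epsilon>
  proof -
    have e4: "\<epsilon>/4 > 0" using that by simp
    from compact_ops_approx[OF T e4] obtain n a where na: "norm (T - matrix_op e n a) < \<epsilon>/4" .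
    obtain C where C: "compact C" "blinfun_apply (matrix_op e n a) ` cball 0 1 \<subseteq> C"
      using matrix_op_image_compact by blast
    obtain K where K: "finite K" "C \<subseteq> (\<Union>x\<in>K. ball x (\<epsilon>/4))"
      using C(1) e4 unfolding compact_eq_totally_bounded by metis
    have "blinfun_apply T ` cball 0 1 \<subseteq> (\<Union>x\<in>K. cball x (\<epsilon>/2))"
    proof safe
      fix x :: 'a assume x: "x \<in> cball 0 1"
      let ?m = "blinfun_apply (matrix_op e n a) x"
      obtain k where k: "k \<in> K" "dist k ?m < \<epsilon>/4" using C(2) K(2) x by force
      have "dist ?m (blinfun_apply T x) \<le> norm (T - matrix_op e n a) * norm x"
        using norm_blinfun[of "T - matrix_op e n a" x]
        by (simp add: dist_norm blinfun.diff_left norm_minus_commute)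
      also have "\<dots> \<le> norm (T - matrix_op e n a) * 1" using x by (intro mult_left_mono) auto
      finally have "dist k (blinfun_apply T x) \<le> \<epsilon>/2"
        using k(2) na dist_triangle[of k "blinfun_apply T x" ?m] by linarith
      with k(1) show "blinfun_apply T x \<in> (\<Union>x\<in>K. cball x (\<epsilon>/2))" by auto
    qed
    then have "?S \<subseteq> (\<Union>x\<in>K. cball x (\<epsilon>/2))"
      by (intro closure_minimal closed_UN K(1)) auto
    also have "\<dots> \<subseteq> (\<Union>x\<in>K. ball x \<epsilon>)" using that by force
    finally show ?thesis using K(1) by blast
  qed
  then have "compact ?S"
    by (simp add: compact_eq_totally_bounded complete_eq_closed)
  moreover have "blinfun_apply T (u k) \<in> ?S" for k
    using u[of k] by (intro subsetD[OF closure_subset]) auto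
  ultimately obtain y r where "strict_mono r" "((\<lambda>k. blinfun_apply T (u k)) \<circ> r) \<longlonglongrightarrow> y"
    unfolding compact_def by metis
  then show ?thesis using that by (simp add: o_def)
qed

section \<open>Normal compact operators\<close>

lemma adj_add:
  assumes "clinear_op S" "clinear_op T"
  shows "adj (S + T) = adj S + adj T"
  by (intro adj_eqI) (simp add: assms cinner_adj blinfun.add_left cinner_simps)

lemma normal_opD:
  "normal_op T \<Longrightarrow> blinfun_apply (adj T) (blinfun_apply T x) = blinfun_apply T (blinfun_apply (adj T) x)"
  unfolding normal_op_def by (metis blinfun_apply_blinfun_compose)

text \<open>
  For normal \<open>T\<close> the square norm of \<open>T* v - cnj \<mu> v\<close> expands into the square norm of \<open>T v - \<mu> v\<close>.
\<close>

lemma normal_eigenvector_adj: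
  assumes T: "clinear_op T" "normal_op T" and v: "blinfun_apply T v = \<mu> *\<^sub>C v"
  shows "blinfun_apply (adj T) v = cnj \<mu> *\<^sub>C v"
proof -
  let ?d = "blinfun_apply (adj T) v - cnj \<mu> *\<^sub>C v"
  have 1: "cinner (blinfun_apply (adj T) v) (blinfun_apply (adj T) v) = cnj \<mu> * \<mu> * cinner v v"
    by (simp add: cinner_adj'[OF T(1)] normal_opD[OF T(2), symmetric])
      (simp add: cinner_adj[OF T(1), symmetric] v cinner_simps)
  have 2: "cinner (blinfun_apply (adj T) v) v = \<mu> * cinner v v"
    by (simp add: cinner_adj'[OF T(1)] v cinner_simps)
  have 3: "cinner v (blinfun_apply (adj T) v) = cnj \<mu> * cinner v v"
    by (simp add: cinner_adj[OF T(1), symmetric] v cinner_simps)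
  have "cinner ?d ?d = 0"
    by (simp only: cinner_simps 1 2 3) (simp add: algebra_simps)
  then show ?thesis by (simp add: cinner_self)
qed

lemma normal_eigenvectors_orthogonal:
  assumes T: "clinear_op T" "normal_op T"
    and v: "blinfun_apply T v = \<mu> *\<^sub>C v" and w: "blinfun_apply T w = \<nu> *\<^sub>C w" and "\<mu> \<noteq> \<nu>"
  shows "cinner v w = 0"
proof -
  have "\<nu> * cinner v w = cinner v (blinfun_apply T w)" by (simp add: w cinner_simps)
  also have "\<dots> = \<mu> * cinner v w"
    by (simp add: cinner_adj'[OF T(1), symmetric] normal_eigenvector_adj[OF T v] cinner_simps)
  finally show ?thesis using \<open>\<mu> \<noteq> \<nu>\<close> by simp
qed

lemma normal_eigenvectors_orthonormal:
  assumes T: "clinear_op T" "normal_op T" and inj: "inj_on l I"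
    and v: "\<And>i. i \<in> I \<Longrightarrow> norm (v i) = 1" "\<And>i. i \<in> I \<Longrightarrow> blinfun_apply T (v i) = l i *\<^sub>C v i"
    and ij: "i \<in> I" "j \<in> I"
  shows "cinner (v i) (v j) = (if i = j then 1 else 0)"
proof (cases "i = j")
  case True
  then show ?thesis using v(1)[OF ij(1)] by (simp add: cinner_self)
next
  case False
  with inj ij have "l i \<noteq> l j" by (auto dest: inj_onD)
  from normal_eigenvectors_orthogonal[OF T v(2)[OF ij(1)] v(2)[OF ij(2)] this] False
  show ?thesis by simp
qed

lemma cinner_selfadjoint:
  assumes "clinear_op S" "adj S = S"
  shows "cinner (blinfun_apply S x) y = cinner x (blinfun_apply S y)"
  using cinner_adj[OF assms(1)] assms(2) by simp

text \<open>
  Let \<open>s\<close> be the norm of \<open>S\<close> on \<open>E\<close>. A maximizing sequence of unit vectors is asymptotically fixed by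
  \<open>S\<^sup>2 / s\<^sup>2\<close>; compactness of \<open>S\<close> lets it converge to a vector \<open>x\<close> with \<open>S\<^sup>2 x = s\<^sup>2 x\<close>. Then
  \<open>S x + s x\<close> is an eigenvector for \<open>s\<close>, unless it vanishes and \<open>x\<close> is one for \<open>- s\<close>.
\<close>

lemma selfadjoint_eigenvector_in_subspace:
  assumes S: "S \<in> compact_ops e" "adj S = S"
    and E: "closed E" "complex_vector.subspace E" "\<exists>x\<in>E. x \<noteq> 0"
    and inv: "\<And>x. x \<in> E \<Longrightarrow> blinfun_apply S x \<in> E"
  obtains x r where "x \<in> E" "x \<noteq> 0" "blinfun_apply S x = complex_of_real r *\<^sub>C x"
    "\<forall>y\<in>E. norm (blinfun_apply S y) \<le> \<bar>r\<bar> * norm y"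
proof -
  note lin = clinear_compact_ops[OF S(1)]
  note scale = complex_vector.subspace_scale[OF E(2)]
  define N where "N = {norm (blinfun_apply S x) |x. x \<in> E \<and> norm x = 1}"
  define s where "s = Sup N"
  have bdd: "bdd_above N"
  proof (rule bdd_aboveI)
    fix a assume "a \<in> N"
    then obtain x where "norm x = 1" "a = norm (blinfun_apply S x)" by (auto simp: N_def)
    then show "a \<le> norm S" using norm_blinfun[of S x] by simp
  qed
  obtain x0 where x0: "x0 \<in> E" "x0 \<noteq> 0" using E(3) by blast
  have unit: "complex_of_real (1 / norm x) *\<^sub>C x \<in> E \<and> norm (complex_of_real (1 / norm x) *\<^sub>C x) = 1"
    if "x \<in> E" "x \<noteq> 0" for x
    using that by (auto simp: norm_scaleC scale norm_divide)
  have ne: "N \<noteq> {}" using unit[OF x0] by (auto simp: N_def)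
  have le: "norm (blinfun_apply S y) \<le> s * norm y" if "y \<in> E" for y
  proof (cases "y = 0")
    case False
    then have "norm (blinfun_apply S (complex_of_real (1 / norm y) *\<^sub>C y)) \<in> N"
      using unit[OF that] by (auto simp: N_def)
    then have "norm (blinfun_apply S (complex_of_real (1 / norm y) *\<^sub>C y)) \<le> s"
      unfolding s_def by (rule cSup_upper[OF _ bdd])
    then show ?thesis using False
      by (simp add: clinear_opD[OF lin] norm_scaleC norm_divide field_simps)
  qed simp
  have "s \<ge> 0"
    using ne cSup_upper2[OF _ _ bdd, of _ 0] unfolding s_def by (fastforce simp: N_def)
  show ?thesis
  proof (cases "s = 0")
    case True
    then show ?thesis
      using le x0 by (intro that[of x0 0] ballI) (auto simp: scaleC.zero_left)
  next
    case False
    with \<open>s \<ge> 0\<close> have "s > 0" by simp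
    have "\<exists>u\<in>E. norm u = 1 \<and> s - inverse (real (Suc k)) < norm (blinfun_apply S u)" for k
      using less_cSupD[OF ne, of "s - inverse (real (Suc k))"] unfolding s_def N_def by auto
    then obtain u where u: "\<And>k. u k \<in> E" "\<And>k. norm (u k) = 1"
      "\<And>k. s - inverse (real (Suc k)) < norm (blinfun_apply S (u k))"
      by metis
    have "(\<lambda>k. s - inverse (real (Suc k))) \<longlonglongrightarrow> s - 0"
      by (intro tendsto_intros LIMSEQ_inverse_real_of_nat)
    then have s_lim: "(\<lambda>k. s - inverse (real (Suc k))) \<longlonglongrightarrow> s" by simp
    have norm_lim: "(\<lambda>k. norm (blinfun_apply S (u k))) \<longlonglongrightarrow> s"
    proof (rule tendsto_sandwich[OF _ _ s_lim tendsto_const])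
      show "\<forall>\<^sub>F k in sequentially. s - inverse (real (Suc k)) \<le> norm (blinfun_apply S (u k))"
        using u(3) by (intro always_eventually allI less_imp_le)
      show "\<forall>\<^sub>F k in sequentially. norm (blinfun_apply S (u k)) \<le> s"
      proof (intro always_eventually allI)
        show "norm (blinfun_apply S (u k)) \<le> s" for k using le[OF u(1)[of k]] u(2)[of k] by simp
      qed
    qed
    obtain q y where q: "strict_mono q" "(\<lambda>k. blinfun_apply S (u (q k))) \<longlonglongrightarrow> y"
      using compact_ops_convergent_subseq[OF S(1), of u] u(2) by (metis order_refl)
    let ?S2 = "\<lambda>x. blinfun_apply S (blinfun_apply S x)"
    have sq: "(norm (?S2 (u k) - complex_of_real (s\<^sup>2) *\<^sub>C u k))\<^sup>2
        \<le> s\<^sup>2 * (s\<^sup>2 - (norm (blinfun_apply S (u k)))\<^sup>2)" for k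
    proof -
      have "complex_of_real ((norm (?S2 (u k) - complex_of_real (s\<^sup>2) *\<^sub>C u k))\<^sup>2)
          = complex_of_real ((norm (?S2 (u k)))\<^sup>2 - 2 * s\<^sup>2 * (norm (blinfun_apply S (u k)))\<^sup>2 + s^4)"
        unfolding cinner_self[symmetric]
        by (simp add: cinner_simps cinner_selfadjoint[OF lin S(2)])
          (simp add: cinner_selfadjoint[OF lin S(2), symmetric] cinner_self u(2) algebra_simps
            power4_eq_xxxx power2_eq_square)
      then have "(norm (?S2 (u k) - complex_of_real (s\<^sup>2) *\<^sub>C u k))\<^sup>2
          = (norm (?S2 (u k)))\<^sup>2 - 2 * s\<^sup>2 * (norm (blinfun_apply S (u k)))\<^sup>2 + s^4"
        by (simp only: of_real_eq_iff)
      moreover have "(norm (?S2 (u k)))\<^sup>2 \<le> s\<^sup>2 * (norm (blinfun_apply S (u k)))\<^sup>2"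
        using power_mono[OF le[OF inv[OF u(1)[of k]]], of 2] by (simp add: power_mult_distrib)
      ultimately show ?thesis by (simp add: algebra_simps power4_eq_xxxx power2_eq_square)
    qed
    have "(\<lambda>k. s\<^sup>2 * (s\<^sup>2 - (norm (blinfun_apply S (u k)))\<^sup>2)) \<longlonglongrightarrow> s\<^sup>2 * (s\<^sup>2 - s\<^sup>2)"
      by (intro tendsto_intros norm_lim)
    then have "(\<lambda>k. s\<^sup>2 * (s\<^sup>2 - (norm (blinfun_apply S (u k)))\<^sup>2)) \<longlonglongrightarrow> 0" by simp
    then have "(\<lambda>k. (norm (?S2 (u k) - complex_of_real (s\<^sup>2) *\<^sub>C u k))\<^sup>2) \<longlonglongrightarrow> 0"
      by (rule Lim_null_comparison[rotated]) (use sq in \<open>intro always_eventually allI, simp\<close>)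
    then have "(\<lambda>k. sqrt ((norm (?S2 (u k) - complex_of_real (s\<^sup>2) *\<^sub>C u k))\<^sup>2)) \<longlonglongrightarrow> sqrt 0"
      by (rule tendsto_real_sqrt)
    then have "(\<lambda>k. ?S2 (u k) - complex_of_real (s\<^sup>2) *\<^sub>C u k) \<longlonglongrightarrow> 0"
      by (simp add: tendsto_norm_zero_iff)
    from LIMSEQ_subseq_LIMSEQ[OF this q(1)]
    have 1: "(\<lambda>k. ?S2 (u (q k)) - complex_of_real (s\<^sup>2) *\<^sub>C u (q k)) \<longlonglongrightarrow> 0" by (simp add: o_def)
    have 2: "(\<lambda>k. ?S2 (u (q k))) \<longlonglongrightarrow> blinfun_apply S y"
      by (intro blinfun.tendsto tendsto_const q(2))
    define x where "x = complex_of_real (1 / s\<^sup>2) *\<^sub>C blinfun_apply S y"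
    have "(\<lambda>k. complex_of_real (1 / s\<^sup>2) *\<^sub>C
          (?S2 (u (q k)) - (?S2 (u (q k)) - complex_of_real (s\<^sup>2) *\<^sub>C u (q k))))
        \<longlonglongrightarrow> complex_of_real (1 / s\<^sup>2) *\<^sub>C (blinfun_apply S y - 0)"
      by (intro scaleC.tendsto tendsto_const tendsto_diff 1 2)
    then have ux: "(\<lambda>k. u (q k)) \<longlonglongrightarrow> x"
      using \<open>s > 0\<close> by (simp add: x_def scaleC_scaleC scaleC_one flip: of_real_mult of_real_power)
    have "x \<in> E" using closed_sequentially[OF E(1) _ ux] u(1) by blast
    have "norm x = 1" using LIMSEQ_unique[OF tendsto_norm[OF ux]] u(2) by simp
    have "(\<lambda>k. blinfun_apply S (u (q k))) \<longlonglongrightarrow> blinfun_apply S x"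
      by (intro blinfun.tendsto tendsto_const ux)
    with q(2) have Sx: "blinfun_apply S x = y" by (rule LIMSEQ_unique[symmetric])
    have "complex_of_real (s\<^sup>2) *\<^sub>C x = blinfun_apply S y"
      using \<open>s > 0\<close> by (simp add: x_def scaleC_scaleC scaleC_one flip: of_real_mult of_real_power)
    then have S2x: "?S2 x = complex_of_real (s\<^sup>2) *\<^sub>C x" by (simp only: Sx)
    define z where "z = blinfun_apply S x + complex_of_real s *\<^sub>C x"
    show ?thesis
    proof (cases "z = 0")
      case True
      then have "blinfun_apply S x = complex_of_real (- s) *\<^sub>C x"
        by (simp add: z_def scaleC.minus_left eq_neg_iff_add_eq_0)
      then show ?thesis
        using \<open>x \<in> E\<close> \<open>norm x = 1\<close> le \<open>s > 0\<close> by (intro that[of x "- s"] ballI) auto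
    next
      case False
      have "blinfun_apply S z = complex_of_real s *\<^sub>C z"
        by (simp add: z_def blinfun.add_right clinear_opD[OF lin] S2x scaleC_add_right
            scaleC_scaleC power2_eq_square)
      moreover have "z \<in> E"
        unfolding z_def by (intro complex_vector.subspace_add[OF E(2)] inv scale \<open>x \<in> E\<close>)
      ultimately show ?thesis using False le \<open>s > 0\<close> by (intro that[of z s] ballI) auto
    qed
  qed
qed

text \<open>
  The selfadjoint case applied to \<open>T* T\<close> gives an eigenspace \<open>E1\<close> on which \<open>T\<close> attains its norm. It
  reduces \<open>T\<close>, and a second application, to \<open>T + T*\<close> on \<open>E1\<close>, leaves a quadratic equation for \<open>T\<close>.
\<close>

lemma normal_eigenvector_in_subspace:
  assumes onb: "orthonormal_basis e" and T: "T \<in> compact_ops e" "normal_op T"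
    and E: "closed E" "complex_vector.subspace E" "\<exists>x\<in>E. x \<noteq> 0"
    and inv: "\<And>x. x \<in> E \<Longrightarrow> blinfun_apply T x \<in> E" "\<And>x. x \<in> E \<Longrightarrow> blinfun_apply (adj T) x \<in> E"
  obtains x \<mu> where "x \<in> E" "x \<noteq> 0" "blinfun_apply T x = \<mu> *\<^sub>C x"
    "\<forall>y\<in>E. norm (blinfun_apply T y) \<le> cmod \<mu> * norm y"
proof -
  note lin = clinear_compact_ops[OF T(1)]
  note ops = lin clinear_adj[OF lin]
  define S where "S = adj T o\<^sub>L T"
  have S: "S \<in> compact_ops e" "adj S = S"
    unfolding S_def by (auto simp: compose_in_compact_ops_left[OF onb] ops T adj_compose adj_adj)
  have cS: "cinner y (blinfun_apply S y) = complex_of_real ((norm (blinfun_apply T y))\<^sup>2)" for y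
    by (simp add: S_def cinner_adj[OF lin, symmetric] cinner_self)
  have S_inv: "blinfun_apply S x \<in> E" if "x \<in> E" for x
    unfolding S_def blinfun_apply_blinfun_compose by (rule inv(2)[OF inv(1)[OF that]])
  obtain x0 r where
    x0: "x0 \<in> E" "x0 \<noteq> 0" "blinfun_apply S x0 = complex_of_real r *\<^sub>C x0"
    and S_le: "\<forall>y\<in>E. norm (blinfun_apply S y) \<le> \<bar>r\<bar> * norm y"
    using selfadjoint_eigenvector_in_subspace[OF S E S_inv] .
  have "r * (norm x0)\<^sup>2 = (norm (blinfun_apply T x0))\<^sup>2"
    using cS[of x0] by (simp add: x0(3) cinner_simps cinner_self flip: of_real_mult of_real_power)
  moreover have "(norm x0)\<^sup>2 > 0" using x0(2) by simp
  ultimately have "r \<ge> 0" by (smt (verit) mult_neg_pos zero_le_power2)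
  have T_le: "(norm (blinfun_apply T y))\<^sup>2 \<le> r * (norm y)\<^sup>2" if "y \<in> E" for y
  proof -
    have "(norm (blinfun_apply T y))\<^sup>2 = cmod (cinner y (blinfun_apply S y))"
      by (simp add: cS norm_power)
    also have "\<dots> \<le> norm y * (\<bar>r\<bar> * norm y)"
      by (meson bspec[OF S_le that] cmod_cinner_le mult_left_mono norm_ge_zero order_trans)
    finally show ?thesis using \<open>r \<ge> 0\<close> by (simp add: power2_eq_square mult_ac)
  qed
  define E1 where "E1 = {x \<in> E. blinfun_apply S x = complex_of_real r *\<^sub>C x}"
  have E1: "closed E1" "complex_vector.subspace E1" "\<exists>x\<in>E1. x \<noteq> 0"
  proof -
    have "closed {x. blinfun_apply S x = complex_of_real r *\<^sub>C x}"
      by (intro closed_Collect_eq blinfun.continuous_on scaleC.continuous_on continuous_on_const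
          continuous_on_id)
    with E(1) show "closed E1" unfolding E1_def by (simp add: Collect_conj_eq closed_Int)
    show "complex_vector.subspace E1"
      using E(2) clinear_compact_ops[OF S(1)]
      by (auto simp: complex_vector.subspace_def E1_def blinfun.add_right scaleC_add_right
          clinear_opD scaleC_scaleC mult.commute)
    show "\<exists>x\<in>E1. x \<noteq> 0" using x0 by (auto simp: E1_def)
  qed
  have inv1: "blinfun_apply T x \<in> E1" "blinfun_apply (adj T) x \<in> E1" if "x \<in> E1" for x
  proof -
    have *: "x \<in> E" "blinfun_apply (adj T) (blinfun_apply T x) = complex_of_real r *\<^sub>C x"
      using that by (auto simp: E1_def S_def)
    show "blinfun_apply T x \<in> E1"
      using * by (simp add: E1_def S_def inv normal_opD[OF T(2)])
        (simp add: normal_opD[OF T(2), symmetric] clinear_opD[OF lin])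
    show "blinfun_apply (adj T) x \<in> E1"
      using * by (simp add: E1_def S_def inv normal_opD[OF T(2), symmetric] clinear_opD[OF ops(2)])
  qed
  define R where "R = T + adj T"
  have R: "R \<in> compact_ops e" "adj R = R"
    unfolding R_def
    by (auto simp: compact_ops_add adj_in_compact_ops[OF onb] T adj_add ops adj_adj add.commute)
  have R_inv: "blinfun_apply R x \<in> E1" if "x \<in> E1" for x
    using complex_vector.subspace_add[OF E1(2) inv1[OF that]] by (simp add: R_def blinfun.add_left)
  obtain x p where
    x: "x \<in> E1" "x \<noteq> 0" "blinfun_apply R x = complex_of_real p *\<^sub>C x"
      "\<forall>y\<in>E1. norm (blinfun_apply R y) \<le> \<bar>p\<bar> * norm y"
    using selfadjoint_eigenvector_in_subspace[OF R E1 R_inv] .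
  \<comment> \<open>On \<open>x\<close> the adjoint acts as \<open>p - T\<close>, so that \<open>T* T x = r x\<close> becomes a quadratic equation for \<open>T\<close>.\<close>
  define d where "d = csqrt ((complex_of_real p)\<^sup>2 - 4 * complex_of_real r)"
  define a where "a = (complex_of_real p + d) / 2"
  define b where "b = (complex_of_real p - d) / 2"
  have d2: "d\<^sup>2 = (complex_of_real p)\<^sup>2 - 4 * complex_of_real r" by (simp add: d_def)
  have ab: "a + b = complex_of_real p" "a * b = complex_of_real r"
  proof -
    show "a + b = complex_of_real p" by (simp add: a_def b_def field_simps)
    have "a * b = ((complex_of_real p)\<^sup>2 - d\<^sup>2) / 4" by (simp add: a_def b_def power2_eq_square algebra_simps)
    then show "a * b = complex_of_real r" by (simp add: d2)
  qed
  have adjx: "blinfun_apply (adj T) x = complex_of_real p *\<^sub>C x - blinfun_apply T x"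
    using x(3) by (simp add: R_def blinfun.add_left algebra_simps)
  have "blinfun_apply T (blinfun_apply (adj T) x) = complex_of_real r *\<^sub>C x"
    using x(1) by (simp add: E1_def S_def normal_opD[OF T(2)])
  then have "complex_of_real p *\<^sub>C blinfun_apply T x - blinfun_apply T (blinfun_apply T x) = complex_of_real r *\<^sub>C x"
    by (simp add: adjx blinfun.diff_right clinear_opD[OF lin])
  then have TT: "blinfun_apply T (blinfun_apply T x) = (a + b) *\<^sub>C blinfun_apply T x - (a * b) *\<^sub>C x"
    by (simp add: ab algebra_simps)
  obtain y \<mu> where y: "y \<in> E1" "y \<noteq> 0" "blinfun_apply T y = \<mu> *\<^sub>C y"
  proof (cases "blinfun_apply T x = b *\<^sub>C x")
    case False
    define y where "y = blinfun_apply T x - b *\<^sub>C x"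
    have "blinfun_apply T y = a *\<^sub>C y"
      by (simp add: y_def blinfun.diff_right clinear_opD[OF lin] TT scaleC_add_left
          scaleC.diff_right scaleC_scaleC)
    moreover have "y \<in> E1"
      unfolding y_def by (intro complex_vector.subspace_diff[OF E1(2)] inv1 x(1)
          complex_vector.subspace_scale[OF E1(2)])
    moreover have "y \<noteq> 0" using False by (simp add: y_def)
    ultimately show ?thesis by (intro that[of y a])
  next
    case True
    then show ?thesis using x by (intro that[of x b])
  qed
  have "(cmod \<mu>)\<^sup>2 * (norm y)\<^sup>2 = r * (norm y)\<^sup>2"
  proof -
    have "complex_of_real r * cinner y y = complex_of_real ((norm (\<mu> *\<^sub>C y))\<^sup>2)"
      using cS[of y] y(1) by (simp add: E1_def cinner_simps y(3))
    then show ?thesis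
      by (auto simp add: cinner_self norm_scaleC power_mult_distrib simp flip: of_real_mult of_real_power)
  qed
  then have r: "r = (cmod \<mu>)\<^sup>2" using y(2) by auto
  show ?thesis
  proof (rule that[OF _ y(2,3)])
    show "y \<in> E" using y(1) by (simp add: E1_def)
    show "\<forall>z\<in>E. norm (blinfun_apply T z) \<le> cmod \<mu> * norm z"
    proof
      fix z assume "z \<in> E"
      from T_le[OF this] have "(norm (blinfun_apply T z))\<^sup>2 \<le> (cmod \<mu> * norm z)\<^sup>2"
        by (simp add: r power_mult_distrib)
      then show "norm (blinfun_apply T z) \<le> cmod \<mu> * norm z"
        by (rule power2_le_imp_le) simp
    qed
  qed
qed

lemma EigI: "blinfun_apply T u = \<mu> *\<^sub>C u \<Longrightarrow> norm u = 1 \<Longrightarrow> \<mu> \<in> Eig T"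
  unfolding Eig_def by (intro CollectI exI[of _ u] conjI) (simp_all, auto)

lemma Eig_unit_eigenvector:
  assumes "clinear_op T" "\<mu> \<in> Eig T"
  obtains u where "norm u = 1" "blinfun_apply T u = \<mu> *\<^sub>C u"
proof -
  obtain v where v: "v \<noteq> 0" "blinfun_apply T v = \<mu> *\<^sub>C v"
    using assms(2) unfolding Eig_def by blast
  show ?thesis
  proof (rule that)
    show "norm (complex_of_real (1 / norm v) *\<^sub>C v) = 1"
      using v(1) by (simp add: norm_scaleC norm_divide)
    show "blinfun_apply T (complex_of_real (1 / norm v) *\<^sub>C v)
        = \<mu> *\<^sub>C complex_of_real (1 / norm v) *\<^sub>C v"
      by (simp add: clinear_opD[OF assms(1)] v(2) scaleC_scaleC mult.commute)
  qed
qed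

lemma multiplicity_free_eigenvector_unique:
  assumes "multiplicity_free T" "blinfun_apply T u = \<mu> *\<^sub>C u" "blinfun_apply T v = \<mu> *\<^sub>C v"
    "norm u = 1" "norm v = 1"
  obtains c where "cmod c = 1" "v = c *\<^sub>C u"
proof -
  have uv: "u \<in> eigenspace T \<mu>" "v \<in> eigenspace T \<mu>" using assms by (auto simp: eigenspace_def)
  have "\<mu> \<in> Eig T" using assms(2,4) unfolding Eig_def by (intro CollectI exI[of _ u]) auto
  then have "cdim (eigenspace T \<mu>) = 1" using assms(1) by (simp add: multiplicity_free_def)
  moreover obtain B where "B \<subseteq> eigenspace T \<mu>" "\<not> complex_vector.dependent B"
    "eigenspace T \<mu> \<subseteq> cspan B" "card B = cdim (eigenspace T \<mu>)"
    using complex_vector.basis_exists[of "eigenspace T \<mu>"] .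
  ultimately obtain b where "eigenspace T \<mu> \<subseteq> cspan {b}" using card_1_singletonE by metis
  then obtain p q where p: "u = p *\<^sub>C b" and q: "v = q *\<^sub>C b"
    using uv unfolding complex_vector.span_singleton by blast
  have "p \<noteq> 0" using p assms(4) by (auto simp: scaleC.zero_left)
  then have v: "v = (q / p) *\<^sub>C u" by (simp add: p q scaleC_scaleC)
  moreover have "cmod (q / p) = 1"
    using assms(4,5) arg_cong[OF v, of norm] by (simp add: norm_scaleC)
  ultimately show ?thesis using that by blast
qed

text \<open>
  The orthogonal complement of the given eigenvectors reduces \<open>T\<close>, so its norm there is the modulus of
  an eigenvalue with an eigenvector in that complement. Multiplicity one excludes the listed
  eigenvalues.
\<close>

lemma spectral_tail_norm_le:
  assumes onb: "orthonormal_basis e" and T: "T \<in> compact_ops e" "normal_op T" "multiplicity_free T"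
    and I: "finite I" "inj_on l I"
    and v: "\<And>i. i \<in> I \<Longrightarrow> norm (v i) = 1" "\<And>i. i \<in> I \<Longrightarrow> blinfun_apply T (v i) = l i *\<^sub>C v i"
    and small: "\<And>\<mu>. \<mu> \<in> Eig T \<Longrightarrow> \<mu> \<notin> l ` I \<Longrightarrow> cmod \<mu> \<le> \<epsilon>" and "\<epsilon> \<ge> 0"
  shows "norm (T - (\<Sum>i\<in>I. rank1 (l i *\<^sub>C v i) (v i))) \<le> \<epsilon>"
proof (rule norm_blinfun_bound[OF \<open>\<epsilon> \<ge> 0\<close>])
  note lin = clinear_compact_ops[OF T(1)]
  define E where "E = {x. \<forall>i\<in>I. cinner (v i) x = 0}"
  have "E = (\<Inter>i\<in>I. {x. cinner (v i) x = 0})" by (auto simp: E_def)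
  also have "closed \<dots>"
    by (intro closed_INT ballI closed_Collect_eq cinner.continuous_on continuous_on_const
        continuous_on_id)
  finally have "closed E" .
  have "complex_vector.subspace E"
    by (auto simp: complex_vector.subspace_def E_def cinner_simps cinner.zero_right)
  have inv: "blinfun_apply T x \<in> E" "blinfun_apply (adj T) x \<in> E" if "x \<in> E" for x
    using that normal_eigenvector_adj[OF lin T(2) v(2)]
    by (auto simp: E_def cinner_adj'[OF lin, symmetric] cinner_adj[OF lin, symmetric] v(2) cinner_simps)
  have E_le: "norm (blinfun_apply T x) \<le> \<epsilon> * norm x" if "x \<in> E" for x
  proof (cases "\<exists>x\<in>E. x \<noteq> 0")
    case True
    obtain y \<mu> where y: "y \<in> E" "y \<noteq> 0" "blinfun_apply T y = \<mu> *\<^sub>C y"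
      and le: "\<forall>z\<in>E. norm (blinfun_apply T z) \<le> cmod \<mu> * norm z"
      using normal_eigenvector_in_subspace[OF onb T(1,2) \<open>closed E\<close>
          \<open>complex_vector.subspace E\<close> True inv] .
    have "\<mu> \<notin> l ` I"
    proof
      assume "\<mu> \<in> l ` I"
      then obtain i where i: "i \<in> I" "\<mu> = l i" by blast
      define y' where "y' = complex_of_real (1 / norm y) *\<^sub>C y"
      have "norm y' = 1" "blinfun_apply T y' = l i *\<^sub>C y'"
        using y(2,3) by (auto simp: y'_def norm_scaleC norm_divide clinear_opD[OF lin] scaleC_scaleC i mult.commute)
      from multiplicity_free_eigenvector_unique[OF T(3) v(2)[OF i(1)] this(2) v(1)[OF i(1)] this(1)]
      obtain c where c: "cmod c = 1" "y' = c *\<^sub>C v i" .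
      have "cinner (v i) y' = 0" using y(1) i by (simp add: E_def y'_def cinner_simps)
      then have "c = 0" using v(1)[OF i(1)] by (simp add: c cinner_simps cinner_self)
      with c(1) show False by simp
    qed
    moreover have "\<mu> \<in> Eig T" using y by (auto simp: Eig_def)
    ultimately have "cmod \<mu> \<le> \<epsilon>" using small by blast
    then show ?thesis using bspec[OF le that] by (meson mult_right_mono norm_ge_zero order_trans)
  qed (use that in auto)
  fix x
  define q where "q = (\<Sum>i\<in>I. cinner (v i) x *\<^sub>C v i)"
  have orth: "cinner (v i) (v j) = (if i = j then 1 else 0)" if "i \<in> I" "j \<in> I" for i j
    using normal_eigenvectors_orthonormal[OF lin T(2) I(2) v that] .
  have "cinner (v i) q = cinner (v i) x" if "i \<in> I" for i
  proof -
    have "cinner (v i) q = (\<Sum>j\<in>I. if i = j then cinner (v j) x else 0)"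
      unfolding q_def cinner.sum_right using orth that by (intro sum.cong) (auto simp: cinner_simps)
    then show ?thesis using that I(1) by simp
  qed
  then have "x - q \<in> E" by (simp add: E_def cinner_simps)
  then have "cinner q (x - q) = 0"
    by (subst q_def) (simp add: cinner.sum_left cinner_simps E_def)
  moreover from this have "cinner (x - q) q = 0" using cinner_commute[of "x - q" q] by simp
  ultimately have "cinner (q + (x - q)) (q + (x - q)) = cinner q q + cinner (x - q) (x - q)"
    by (simp only: cinner_add_left cinner_add_right) simp
  then have "cinner x x = cinner q q + cinner (x - q) (x - q)" by simp
  then have "(norm x)\<^sup>2 = (norm q)\<^sup>2 + (norm (x - q))\<^sup>2"
    unfolding cinner_self by (simp only: of_real_eq_iff flip: of_real_add)
  then have "(norm (x - q))\<^sup>2 \<le> (norm x)\<^sup>2" by simp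
  then have "norm (x - q) \<le> norm x" by (rule power2_le_imp_le) simp
  have "blinfun_apply (T - (\<Sum>i\<in>I. rank1 (l i *\<^sub>C v i) (v i))) x = blinfun_apply T (x - q)"
    by (simp add: blinfun.diff_left blinfun.diff_right blinfun.sum_left q_def blinfun.sum_right
        clinear_opD[OF lin] v(2) cong: sum.cong_simp)
  then have "norm (blinfun_apply (T - (\<Sum>i\<in>I. rank1 (l i *\<^sub>C v i) (v i))) x) \<le> \<epsilon> * norm (x - q)"
    using E_le[OF \<open>x - q \<in> E\<close>] by simp
  also have "\<dots> \<le> \<epsilon> * norm x" using \<open>norm (x - q) \<le> norm x\<close> \<open>\<epsilon> \<ge> 0\<close> by (rule mult_left_mono)
  finally show "norm (blinfun_apply (T - (\<Sum>i\<in>I. rank1 (l i *\<^sub>C v i) (v i))) x) \<le> \<epsilon> * norm x" .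
qed

text \<open>
  Conjugation by \<open>U\<close> turns the finite-rank spectral part of \<open>A\<close> exactly into that of \<open>B\<close>; phases cancel
  in rank-one projections. Only the two spectral tails contribute. With \<open>A = B\<close> this also bounds how far
  a unitary that preserves the large eigenlines is from commuting with \<open>B\<close>.
\<close>

lemma conjugation_error_le:
  assumes onb: "orthonormal_basis e"
    and A: "A \<in> compact_ops e" "normal_op A" "multiplicity_free A"
    and B: "B \<in> compact_ops e" "normal_op B" "multiplicity_free B"
    and I: "finite I" "inj_on l I"
    and v: "\<And>i. i \<in> I \<Longrightarrow> norm (v i) = 1" "\<And>i. i \<in> I \<Longrightarrow> blinfun_apply A (v i) = l i *\<^sub>C v i"
    and w: "\<And>i. i \<in> I \<Longrightarrow> norm (w i) = 1" "\<And>i. i \<in> I \<Longrightarrow> blinfun_apply B (w i) = l i *\<^sub>C w i"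
    and small: "\<And>\<mu>. \<mu> \<in> Eig A \<union> Eig B \<Longrightarrow> \<mu> \<notin> l ` I \<Longrightarrow> cmod \<mu> \<le> \<epsilon>" and "\<epsilon> \<ge> 0"
    and U: "clinear_op U" "unitary_op U"
    and Uw: "\<And>i. i \<in> I \<Longrightarrow> \<exists>c. cmod c = 1 \<and> blinfun_apply U (w i) = c *\<^sub>C v i"
  shows "norm (B - (adj U o\<^sub>L A o\<^sub>L U)) \<le> 2 * \<epsilon>"
proof -
  define A' where "A' = (\<Sum>i\<in>I. rank1 (l i *\<^sub>C v i) (v i))"
  define B' where "B' = (\<Sum>i\<in>I. rank1 (l i *\<^sub>C w i) (w i))"
  have conj: "adj U o\<^sub>L A' o\<^sub>L U = B'"
  proof (rule blinfun_eqI)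
    fix x
    have "cinner (v i) (blinfun_apply U x) *\<^sub>C l i *\<^sub>C blinfun_apply (adj U) (v i)
        = cinner (w i) x *\<^sub>C l i *\<^sub>C w i" if i: "i \<in> I" for i
    proof -
      obtain c where c: "cmod c = 1" "blinfun_apply U (w i) = c *\<^sub>C v i" using Uw[OF i] by blast
      have "v i = cnj c *\<^sub>C blinfun_apply U (w i)"
        by (simp add: c scaleC_scaleC cnj_mult_self_unimodular scaleC_one)
      then have "cinner (v i) (blinfun_apply U x) = c * cinner (w i) x"
        "blinfun_apply (adj U) (v i) = cnj c *\<^sub>C w i"
        by (simp_all add: cinner_simps unitary_cinner[OF U] clinear_opD[OF clinear_adj[OF U(1)]]
            unitary_adj_apply[OF U(2)])
      then show ?thesis
        using cnj_mult_self_unimodular[OF c(1)] by (simp add: scaleC_scaleC mult_ac)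
    qed
    then show "blinfun_apply (adj U o\<^sub>L A' o\<^sub>L U) x = blinfun_apply B' x"
      by (simp add: A'_def B'_def blinfun.sum_left blinfun.sum_right
          clinear_opD[OF clinear_adj[OF U(1)]])
  qed
  have diff: "B - (adj U o\<^sub>L A o\<^sub>L U) = (B - B') - (adj U o\<^sub>L (A - A') o\<^sub>L U)"
    by (rule blinfun_eqI) (simp add: conj[symmetric] blinfun.diff_left blinfun.diff_right)
  have "norm (B - B') \<le> \<epsilon>"
    unfolding B'_def using small by (intro spectral_tail_norm_le[OF onb B I w _ \<open>\<epsilon> \<ge> 0\<close>]) auto
  moreover have "norm (A - A') \<le> \<epsilon>"
    unfolding A'_def using small by (intro spectral_tail_norm_le[OF onb A I v _ \<open>\<epsilon> \<ge> 0\<close>]) auto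
  ultimately show ?thesis
    unfolding diff
    using norm_triangle_ineq4[of "B - B'" "adj U o\<^sub>L (A - A') o\<^sub>L U"]
      norm_unitary_conj[OF U, of "A - A'"] by linarith
qed

section \<open>Moving frames by unitaries close to the identity\<close>

definition unitary_perturbation :: "(nat \<Rightarrow> 'h::complex_hilbert) \<Rightarrow> ('h \<Rightarrow>\<^sub>L 'h) \<Rightarrow> bool" where
  "unitary_perturbation e U \<longleftrightarrow> unitary_op U \<and> U - id_blinfun \<in> compact_ops e"

lemma unitary_perturbation_clinear:
  assumes "unitary_perturbation e U"
  shows "clinear_op U"
  using clinear_add[OF clinear_compact_ops clinear_id, of "U - id_blinfun" e] assms
  by (simp add: unitary_perturbation_def)

lemma unitary_perturbation_unitary: "unitary_perturbation e U \<Longrightarrow> unitary_op U"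
  by (simp add: unitary_perturbation_def)

lemma unitary_perturbation_id: "unitary_perturbation e id_blinfun"
  by (auto simp: unitary_perturbation_def zero_in_compact_ops unitary_op_def adj_id
      intro!: blinfun_eqI)

lemma unitary_perturbation_compose:
  assumes "orthonormal_basis e" "unitary_perturbation e U" "unitary_perturbation e V"
  shows "unitary_perturbation e (U o\<^sub>L V)"
proof -
  have "(U o\<^sub>L V) - id_blinfun = (U o\<^sub>L (V - id_blinfun)) + (U - id_blinfun)"
    by (rule blinfun_eqI) (simp add: blinfun.diff_left blinfun.add_left blinfun.diff_right)
  also have "\<dots> \<in> compact_ops e"
    using assms by (intro compact_ops_add compose_in_compact_ops_left unitary_perturbation_clinear)
      (auto simp: unitary_perturbation_def)
  finally show ?thesis
    using assms unitary_perturbation_clinear[of e] unitary_compose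
    by (auto simp: unitary_perturbation_def)
qed

lemma unitary_perturbation_adj:
  assumes "orthonormal_basis e" "unitary_perturbation e U"
  shows "unitary_perturbation e (adj U)"
proof -
  note lin = unitary_perturbation_clinear[OF assms(2)]
  have "adj (U - id_blinfun) \<in> compact_ops e"
    using assms by (intro adj_in_compact_ops) (auto simp: unitary_perturbation_def)
  then have "adj U - id_blinfun \<in> compact_ops e"
    by (simp add: adj_diff lin clinear_id adj_id)
  then show ?thesis
    using unitary_adj[OF lin] assms(2) by (simp add: unitary_perturbation_def)
qed

text \<open>
  With \<open>a = u - f\<close> this is \<open>I - a a* / (a* u)\<close>, a rank-one perturbation sending \<open>u\<close> to \<open>f\<close>. The real
  normalization \<open>2 / (a* a)\<close> of a Householder reflection would require a real inner product of \<open>u\<close> and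
  \<open>f\<close>; for unit vectors \<open>a* u\<close> keeps the operator unitary in the complex case and vanishes only for
  \<open>u = f\<close>.
\<close>

definition householder :: "'h::complex_hilbert \<Rightarrow> 'h \<Rightarrow> 'h \<Rightarrow>\<^sub>L 'h" where
  "householder u f = id_blinfun - rank1 (inverse (cinner (u - f) u) *\<^sub>C (u - f)) (u - f)"

context
  fixes u f :: "'h::complex_hilbert"
  assumes u: "norm u = 1" and f: "norm f = 1" and ne: "cinner f u \<noteq> 1"
begin

lemma householder_denom: "cinner (u - f) u = 1 - cinner f u" "cinner (u - f) u \<noteq> 0"
  using ne u by (auto simp: cinner_simps cinner_self)

lemma householder_apply: "blinfun_apply (householder u f) u = f"
  using householder_denom(2)
  by (simp add: householder_def blinfun.diff_left scaleC_scaleC scaleC_one)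

lemma householder_fix:
  assumes "cinner u x = 0" "cinner f x = 0"
  shows "blinfun_apply (householder u f) x = x"
  using assms by (simp add: householder_def blinfun.diff_left cinner_simps scaleC.zero_left)

lemma householder_unitary: "unitary_op (householder u f)"
proof -
  define a where "a = u - f"
  define z where "z = cinner f u"
  define b where "b = inverse (1 - z)"
  have z: "1 - z \<noteq> 0" using ne by (simp add: z_def)
  have aa: "cinner a a = (1 - z) + cnj (1 - z)"
    using cinner_commute[of u f] cinner_self[of u] cinner_self[of f]
    unfolding a_def z_def cinner.diff_left cinner.diff_right by (simp add: u f)
  \<comment> \<open>Equivalent to \<open>|1 - b a* a| = 1\<close>, that is, unitarity of \<open>I - b a a*\<close> on the line of \<open>a\<close>.\<close>
  have key: "b + cnj b = b * cnj b * cinner a a"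
    using z unfolding aa b_def by (simp add: field_simps complex_cnj_inverse)
  have H: "householder u f = id_blinfun - rank1 (b *\<^sub>C a) a"
    by (simp add: householder_def householder_denom a_def b_def z_def)
  have adjH: "adj (householder u f) = id_blinfun - rank1 (cnj b *\<^sub>C a) a"
    unfolding H by (simp add: adj_diff clinear_id clinear_rank1 adj_id adj_rank1 rank1_scale)
  have *: "blinfun_apply (id_blinfun - rank1 (c *\<^sub>C a) a) (blinfun_apply (id_blinfun - rank1 (d *\<^sub>C a) a) x) = x"
    if "c + d = c * d * cinner a a" for c d x
  proof -
    have "blinfun_apply (id_blinfun - rank1 (c *\<^sub>C a) a) (blinfun_apply (id_blinfun - rank1 (d *\<^sub>C a) a) x)
        = x - (cinner a x * (c + d - c * d * cinner a a)) *\<^sub>C a"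
      by (simp add: blinfun.diff_left cinner_simps scaleC_scaleC scaleC.diff_left scaleC_add_left
          algebra_simps)
    then show ?thesis using that by (simp add: scaleC.zero_left)
  qed
  show ?thesis
    unfolding unitary_op_def adjH unfolding H
    using key by (auto intro!: blinfun_eqI simp: * mult_ac add.commute)
qed

end

lemma householder_perturbation:
  assumes "orthonormal_basis e" "norm u = 1" "norm f = 1" "cinner f u \<noteq> 1"
  shows "unitary_perturbation e (householder u f)"
  using householder_unitary[OF assms(2-4)]
    uminus_in_compact_ops[OF assms(1) rank1_in_compact_ops[OF assms(1)]]
  by (simp add: unitary_perturbation_def householder_def)

lemma norm_eq_1_of_cinner_self: "cinner x x = 1 \<Longrightarrow> norm x = 1"
  using norm_ge_zero[of x] unfolding cinner_self of_real_eq_1_iff power2_eq_1_iff by linarith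

text \<open>
  Coefficients of vectors in the span of the basis vanish from some index on; a compact set is covered
  by \<open>\<epsilon>\<close>-balls around finitely many such vectors.
\<close>

lemma basis_coefficients_eventually_small:
  assumes onb: "orthonormal_basis e" and C: "compact C" and "\<epsilon> > 0"
  obtains N where "\<forall>k\<ge>N. \<forall>x\<in>C. cmod (cinner (e k) x) < \<epsilon>"
proof -
  define D where "D = {y. \<exists>N. \<forall>k\<ge>N. cinner (e k) y = 0}"
  have "complex_vector.subspace D"
    unfolding complex_vector.subspace_def
  proof (intro conjI ballI allI)
    show "0 \<in> D" by (simp add: D_def cinner.zero_right)
    fix x y assume "x \<in> D" "y \<in> D"
    then obtain M N where "\<forall>k\<ge>M. cinner (e k) x = 0" "\<forall>k\<ge>N. cinner (e k) y = 0"
      by (auto simp: D_def)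
    then show "x + y \<in> D"
      unfolding D_def by (intro CollectI exI[of _ "max M N"]) (simp add: cinner_simps)
  next
    fix c x assume "x \<in> D"
    then show "c *\<^sub>C x \<in> D" by (auto simp: D_def cinner_simps)
  qed
  moreover have "e i \<in> D" for i
    unfolding D_def by (intro CollectI exI[of _ "Suc i"]) (use onb in \<open>auto simp: orthonormal_basis_def\<close>)
  ultimately have "cspan (range e) \<subseteq> D" by (intro complex_vector.span_minimal) auto
  then have dense: "closure D = UNIV"
    using onb closure_mono unfolding orthonormal_basis_def by blast
  have norm_e: "norm (e k) = 1" for k
  proof -
    have "cinner (e k) (e k) = 1" using onb by (simp add: orthonormal_basis_def)
    then show ?thesis by (rule norm_eq_1_of_cinner_self)
  qed
  have "\<exists>d. d \<in> D \<and> dist d x < \<epsilon>" for x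
  proof -
    have "x \<in> closure D" using dense by simp
    then show ?thesis using \<open>\<epsilon> > 0\<close> unfolding closure_approachable by blast
  qed
  then have "C \<subseteq> (\<Union>d\<in>D. ball d \<epsilon>)" by (auto, blast)
  from compactE_image[OF C _ this] obtain D' where D': "D' \<subseteq> D" "finite D'" "C \<subseteq> (\<Union>d\<in>D'. ball d \<epsilon>)"
    by auto
  have "\<forall>d\<in>D'. \<exists>N. \<forall>k\<ge>N. cinner (e k) d = 0" using D'(1) by (auto simp: D_def)
  then obtain N where N: "\<And>d k. d \<in> D' \<Longrightarrow> k \<ge> N d \<Longrightarrow> cinner (e k) d = 0" by metis
  have "cmod (cinner (e k) x) < \<epsilon>" if k: "k \<ge> Max (insert 0 (N ` D'))" and x: "x \<in> C" for k x
  proof -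
    obtain d where d: "d \<in> D'" "dist d x < \<epsilon>" using D'(3) x by auto
    have "N d \<le> k" using k D'(2) d(1) by simp
    then have "cinner (e k) x = cinner (e k) (x - d)" using N[OF d(1)] by (simp add: cinner_simps)
    then have "cmod (cinner (e k) x) \<le> norm (x - d)"
      using cmod_cinner_le[of "e k" "x - d"] by (simp add: norm_e)
    with d(2) show ?thesis by (simp add: dist_norm norm_minus_commute)
  qed
  then show ?thesis by (intro that) blast
qed

text \<open>
  Move the vectors of the frame one at a time. Once all but one are basis vectors, the remaining one is
  a unit vector field orthogonal to them; it stays away from \<open>e m\<close> for large \<open>m\<close>, and the Householder
  reflection onto \<open>e m\<close> fixes everything orthogonal to both, in particular the vectors already in place.
  The index set \<open>P\<close> lets several frames be moved to the same basis vectors. The last clause records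
  that the unitary depends only on the values of the frame, so that closed paths of frames give closed
  paths of unitaries.
\<close>

lemma frames_to_basis:
  fixes F :: "'b \<Rightarrow> 'i \<Rightarrow> 'x::topological_space \<Rightarrow> 'h::complex_hilbert"
  assumes onb: "orthonormal_basis e" and "finite P" and X: "compact X" and "finite I"
    and "\<And>b i. b \<in> P \<Longrightarrow> i \<in> I \<Longrightarrow> continuous_on X (F b i)"
    and "\<And>b i j x. b \<in> P \<Longrightarrow> i \<in> I \<Longrightarrow> j \<in> I \<Longrightarrow> x \<in> X \<Longrightarrow>
      cinner (F b i x) (F b j x) = (if i = j then 1 else 0)"
  shows "\<exists>k V. inj_on k I \<and> (\<forall>b\<in>P. continuous_on X (V b) \<and>
    (\<forall>x\<in>X. unitary_perturbation e (V b x) \<and> (\<forall>i\<in>I. blinfun_apply (V b x) (F b i x) = e (k i))) \<and>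
    (\<forall>x\<in>X. \<forall>y\<in>X. (\<forall>i\<in>I. F b i x = F b i y) \<longrightarrow> V b x = V b y))"
  using \<open>finite I\<close> assms(5,6)
proof (induction I)
  case empty
  show ?case
    by (intro exI[of _ "\<lambda>_. 0"] exI[of _ "\<lambda>_ _. id_blinfun"])
      (auto simp: unitary_perturbation_id)
next
  case (insert j I)
  have cinner_e: "cinner (e k) (e m) = (if k = m then 1 else 0)" for k m
    using onb by (simp add: orthonormal_basis_def)
  have "\<exists>k V. inj_on k I \<and> (\<forall>b\<in>P. continuous_on X (V b) \<and>
    (\<forall>x\<in>X. unitary_perturbation e (V b x) \<and> (\<forall>i\<in>I. blinfun_apply (V b x) (F b i x) = e (k i))) \<and>
    (\<forall>x\<in>X. \<forall>y\<in>X. (\<forall>i\<in>I. F b i x = F b i y) \<longrightarrow> V b x = V b y))"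
    by (rule insert.IH) (simp_all add: insert.prems)
  then obtain k V where kV: "inj_on k I \<and> (\<forall>b\<in>P. continuous_on X (V b) \<and>
    (\<forall>x\<in>X. unitary_perturbation e (V b x) \<and> (\<forall>i\<in>I. blinfun_apply (V b x) (F b i x) = e (k i))) \<and>
    (\<forall>x\<in>X. \<forall>y\<in>X. (\<forall>i\<in>I. F b i x = F b i y) \<longrightarrow> V b x = V b y))"
    by (elim exE) auto
  have inj: "inj_on k I"
    and cont: "\<And>b. b \<in> P \<Longrightarrow> continuous_on X (V b)"
    and V: "\<And>b x. b \<in> P \<Longrightarrow> x \<in> X \<Longrightarrow> unitary_perturbation e (V b x)"
    and VF: "\<And>b x i. b \<in> P \<Longrightarrow> x \<in> X \<Longrightarrow> i \<in> I \<Longrightarrow> blinfun_apply (V b x) (F b i x) = e (k i)"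
    and V_eq: "\<And>b x y. b \<in> P \<Longrightarrow> x \<in> X \<Longrightarrow> y \<in> X \<Longrightarrow> \<forall>i\<in>I. F b i x = F b i y \<Longrightarrow> V b x = V b y"
    using kV by blast+
  define u where "u b x = blinfun_apply (V b x) (F b j x)" for b x
  have u_cont: "continuous_on X (u b)" if "b \<in> P" for b
    unfolding u_def using that by (intro blinfun.continuous_on cont insert.prems(1)) auto
  have u_norm: "norm (u b x) = 1" if "b \<in> P" "x \<in> X" for b x
  proof -
    have "cinner (F b j x) (F b j x) = 1" using insert.prems(2)[of b j j x] that by simp
    then have "norm (F b j x) = 1" by (rule norm_eq_1_of_cinner_self)
    then show ?thesis
      unfolding u_def using V[OF that] by (metis unitary_norm unitary_perturbation_clinear unitary_perturbation_unitary)
  qed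
  have u_orth: "cinner (u b x) (e (k i)) = 0" if "b \<in> P" "x \<in> X" "i \<in> I" for b x i
  proof -
    have "cinner (u b x) (e (k i)) = cinner (F b j x) (F b i x)"
      unfolding u_def VF[OF that, symmetric]
      using V[OF that(1,2)] unitary_cinner unitary_perturbation_clinear unitary_perturbation_unitary
      by metis
    also have "\<dots> = 0" using insert.prems(2)[of b j i x] that insert.hyps(2) by auto
    finally show ?thesis .
  qed
  have "compact (\<Union>b\<in>P. u b ` X)"
    using \<open>finite P\<close> u_cont X by (intro compact_UN compact_continuous_image) auto
  from basis_coefficients_eventually_small[OF onb this zero_less_one]
  obtain N where N: "\<forall>k\<ge>N. \<forall>x\<in>\<Union>b\<in>P. u b ` X. cmod (cinner (e k) x) < 1" .
  define m where "m = Max (insert N (Suc ` k ` I))"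
  have "N \<le> m" and m: "k i < m" if "i \<in> I" for i
    using insert.hyps(1) that by (auto simp: m_def Suc_le_eq[symmetric] intro: Max_ge)
  have "N \<le> m" using insert.hyps(1) by (simp add: m_def)
  have ne: "cinner (e m) (u b x) \<noteq> 1" if "b \<in> P" "x \<in> X" for b x
    using N \<open>N \<le> m\<close> that by fastforce
  have norm_e: "norm (e m) = 1"
    using cinner_e[of m m] by (simp add: norm_eq_1_of_cinner_self)
  define W where "W b x = householder (u b x) (e m) o\<^sub>L V b x" for b x
  have 1: "continuous_on X (W b)" if "b \<in> P" for b
  proof -
    have "cinner (u b x - e m) (u b x) \<noteq> 0" if "x \<in> X" for x
      using householder_denom(2)[OF u_norm norm_e ne] that \<open>b \<in> P\<close> by blast
    then have "continuous_on X (\<lambda>x. householder (u b x) (e m))"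
      unfolding householder_def using u_cont[OF that]
      by (intro continuous_on_diff continuous_on_const rank1.continuous_on scaleC.continuous_on
          continuous_on_inverse cinner.continuous_on) auto
    then show ?thesis
      unfolding W_def using cont[OF that]
      by (intro bounded_bilinear.continuous_on[OF bounded_bilinear_blinfun_compose])
  qed
  have 2: "unitary_perturbation e (W b x)" if "b \<in> P" "x \<in> X" for b x
    unfolding W_def using that
    by (intro unitary_perturbation_compose[OF onb] householder_perturbation[OF onb] V u_norm ne norm_e)
  have 3: "blinfun_apply (W b x) (F b i x) = e ((k(j := m)) i)"
    if "b \<in> P" "x \<in> X" "i \<in> insert j I" for b x i
  proof (cases "i = j")
    case True
    then show ?thesis
      using householder_apply[OF u_norm[OF that(1,2)] norm_e ne[OF that(1,2)]]
      by (simp add: W_def u_def[symmetric])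
  next
    case False
    with that(3) have i: "i \<in> I" by simp
    have "cinner (e m) (e (k i)) = 0" using m[OF i] by (simp add: cinner_e)
    from householder_fix[OF u_norm[OF that(1,2)] norm_e ne[OF that(1,2)] u_orth[OF that(1,2) i] this]
    show ?thesis using False VF[OF that(1,2) i] by (simp add: W_def)
  qed
  have 4: "W b x = W b y"
    if "b \<in> P" "x \<in> X" "y \<in> X" "\<forall>i\<in>insert j I. F b i x = F b i y" for b x y
  proof -
    have "V b x = V b y" using that by (intro V_eq) auto
    then show ?thesis using that(4) by (simp add: W_def u_def)
  qed
  have 5: "inj_on (k(j := m)) (insert j I)"
    using inj m insert.hyps(2) by (auto simp: inj_on_def)
  show ?case
    by (rule exI[of _ "k(j := m)"], rule exI[of _ W]) (intro conjI ballI impI 1 2 3 4 5, auto)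
qed

text \<open>
  Both frames are moved to the same basis vectors, and one of the two unitaries is inverted.
\<close>

lemma frames_conjugate:
  fixes v w :: "'i \<Rightarrow> 'x::metric_space \<Rightarrow> 'h::complex_hilbert"
  assumes onb: "orthonormal_basis e" and X: "compact X" and I: "finite I"
    and v: "\<And>i. i \<in> I \<Longrightarrow> continuous_on X (v i)"
      "\<And>i j x. i \<in> I \<Longrightarrow> j \<in> I \<Longrightarrow> x \<in> X \<Longrightarrow> cinner (v i x) (v j x) = (if i = j then 1 else 0)"
    and w: "\<And>i. i \<in> I \<Longrightarrow> continuous_on X (w i)"
      "\<And>i j x. i \<in> I \<Longrightarrow> j \<in> I \<Longrightarrow> x \<in> X \<Longrightarrow> cinner (w i x) (w j x) = (if i = j then 1 else 0)"
  obtains U where "continuous_on X U" "\<forall>x\<in>X. unitary_perturbation e (U x)"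
    "\<forall>x\<in>X. \<forall>i\<in>I. blinfun_apply (U x) (w i x) = v i x"
    "\<forall>x\<in>X. \<forall>y\<in>X. (\<forall>i\<in>I. w i x = w i y \<and> v i x = v i y) \<longrightarrow> U x = U y"
proof -
  define F where "F b = (if b then v else w)" for b
  have "\<exists>k V. inj_on k I \<and> (\<forall>b\<in>UNIV. continuous_on X (V b) \<and>
    (\<forall>x\<in>X. unitary_perturbation e (V b x) \<and> (\<forall>i\<in>I. blinfun_apply (V b x) (F b i x) = e (k i))) \<and>
    (\<forall>x\<in>X. \<forall>y\<in>X. (\<forall>i\<in>I. F b i x = F b i y) \<longrightarrow> V b x = V b y))"
    by (rule frames_to_basis[OF onb _ X I]) (use v w in \<open>auto simp: F_def\<close>)
  then obtain k V where kV: "\<forall>b\<in>UNIV. continuous_on X (V b) \<and>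
    (\<forall>x\<in>X. unitary_perturbation e (V b x) \<and> (\<forall>i\<in>I. blinfun_apply (V b x) (F b i x) = e (k i))) \<and>
    (\<forall>x\<in>X. \<forall>y\<in>X. (\<forall>i\<in>I. F b i x = F b i y) \<longrightarrow> V b x = V b y)"
    by (elim exE) auto
  have cont: "\<And>b. continuous_on X (V b)"
    and V: "\<And>b x. x \<in> X \<Longrightarrow> unitary_perturbation e (V b x)"
    and VF: "\<And>b x i. x \<in> X \<Longrightarrow> i \<in> I \<Longrightarrow> blinfun_apply (V b x) (F b i x) = e (k i)"
    and V_eq: "\<And>b x y. x \<in> X \<Longrightarrow> y \<in> X \<Longrightarrow> \<forall>i\<in>I. F b i x = F b i y \<Longrightarrow> V b x = V b y"
    using kV by blast+
  define U where "U x = adj (V True x) o\<^sub>L V False x" for x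
  show ?thesis
  proof (rule that)
    show "continuous_on X U"
      unfolding U_def using V unitary_perturbation_clinear
      by (auto intro!: bounded_bilinear.continuous_on[OF bounded_bilinear_blinfun_compose] continuous_on_adj cont)
    show "\<forall>x\<in>X. unitary_perturbation e (U x)"
      unfolding U_def
      by (intro ballI unitary_perturbation_compose[OF onb] unitary_perturbation_adj[OF onb] V)
    show "\<forall>x\<in>X. \<forall>i\<in>I. blinfun_apply (U x) (w i x) = v i x"
    proof (intro ballI)
      fix x i assume xi: "x \<in> X" "i \<in> I"
      have "blinfun_apply (U x) (w i x) = blinfun_apply (adj (V True x)) (e (k i))"
        using VF[OF xi, of False] by (simp add: U_def F_def)
      also have "e (k i) = blinfun_apply (V True x) (v i x)"
        using VF[OF xi, of True] by (simp add: F_def)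
      finally show "blinfun_apply (U x) (w i x) = v i x"
        using unitary_adj_apply(1)[OF unitary_perturbation_unitary[OF V[OF xi(1)]]] by simp
    qed
    show "\<forall>x\<in>X. \<forall>y\<in>X. (\<forall>i\<in>I. w i x = w i y \<and> v i x = v i y) \<longrightarrow> U x = U y"
    proof (intro ballI impI)
      fix x y assume xy: "x \<in> X" "y \<in> X" and eq: "\<forall>i\<in>I. w i x = w i y \<and> v i x = v i y"
      have "V b x = V b y" for b using eq by (intro V_eq xy) (auto simp: F_def)
      then show "U x = U y" by (simp add: U_def)
    qed
  qed
qed

section \<open>Continuous selections of eigenvalues and eigenvectors\<close>

locale eigenvalue_family =
  fixes e :: "nat \<Rightarrow> 'h::complex_hilbert" and A :: "real \<Rightarrow> 'h \<Rightarrow>\<^sub>L 'h"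
  assumes onb: "orthonormal_basis e"
    and cont: "continuous_on {0..1} A"
    and comp: "\<And>x. x \<in> {0..1} \<Longrightarrow> A x \<in> compact_ops e"
    and normal: "\<And>x. x \<in> {0..1} \<Longrightarrow> normal_op (A x)"
    and simple: "\<And>x. x \<in> {0..1} \<Longrightarrow> multiplicity_free (A x)"
    and nonzero: "\<And>x. x \<in> {0..1} \<Longrightarrow> 0 \<notin> Eig (A x)"
begin

lemma lin: "x \<in> {0..1} \<Longrightarrow> clinear_op (A x)"
  using clinear_compact_ops[OF comp] .

lemma unit_eigenvector:
  assumes "x \<in> {0..1}" "\<mu> \<in> Eig (A x)"
  obtains u where "norm u = 1" "blinfun_apply (A x) u = \<mu> *\<^sub>C u"
  using Eig_unit_eigenvector[OF lin[OF assms(1)] assms(2)] .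

text \<open>
  The source of all continuity below: \<open>A x0\<close> maps the \<open>u k\<close> to a sequence with a convergent subsequence,
  which up to a null sequence is \<open>\<mu> k u k\<close>. Since the limit of the \<open>\<mu> k\<close> is not \<open>0\<close>, the \<open>u k\<close> converge
  as well.
\<close>

lemma eigenvector_limit:
  assumes x: "\<And>k::nat. x k \<in> {0..1}" "x \<longlonglongrightarrow> x0"
    and u: "\<And>k. norm (u k) = 1" "\<And>k. blinfun_apply (A (x k)) (u k) = \<mu> k *\<^sub>C u k"
    and \<mu>: "\<mu> \<longlonglongrightarrow> \<mu>0" "\<mu>0 \<noteq> 0"
  obtains r y where "strict_mono r" "(\<lambda>k. u (r k)) \<longlonglongrightarrow> y" "norm y = 1"
    "blinfun_apply (A x0) y = \<mu>0 *\<^sub>C y"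
proof -
  have x0: "x0 \<in> {0..1}" using closed_sequentially[OF closed_atLeastAtMost x] .
  obtain r z where r: "strict_mono r" "(\<lambda>k. blinfun_apply (A x0) (u (r k))) \<longlonglongrightarrow> z"
    using compact_ops_convergent_subseq[OF comp[OF x0], of u] u(1) by auto
  have "(\<lambda>k. A (x k)) \<longlonglongrightarrow> A x0"
    using continuous_on_tendsto_compose[OF cont x(2) x0] x(1) by simp
  then have "(\<lambda>k. A (x (r k)) - A x0) \<longlonglongrightarrow> 0"
    using LIMSEQ_subseq_LIMSEQ[OF _ r(1)] by (auto simp: o_def LIM_zero_iff)
  then have "(\<lambda>k. norm (A (x (r k)) - A x0)) \<longlonglongrightarrow> 0" by (rule tendsto_norm_zero)
  then have "(\<lambda>k. blinfun_apply (A (x (r k)) - A x0) (u (r k))) \<longlonglongrightarrow> 0"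
  proof (rule Lim_null_comparison[rotated], intro always_eventually allI)
    show "norm (blinfun_apply (A (x (r k)) - A x0) (u (r k))) \<le> norm (A (x (r k)) - A x0)" for k
      using norm_blinfun[of "A (x (r k)) - A x0" "u (r k)"] u(1) by simp
  qed
  from tendsto_add[OF this r(2)] have Au: "(\<lambda>k. \<mu> (r k) *\<^sub>C u (r k)) \<longlonglongrightarrow> z"
    by (simp add: blinfun.diff_left u(2))
  have \<mu>r: "(\<lambda>k. \<mu> (r k)) \<longlonglongrightarrow> \<mu>0"
    using LIMSEQ_subseq_LIMSEQ[OF \<mu>(1) r(1)] by (simp add: o_def)
  define y where "y = inverse \<mu>0 *\<^sub>C z"
  have "(\<lambda>k. inverse (\<mu> (r k)) *\<^sub>C (\<mu> (r k) *\<^sub>C u (r k))) \<longlonglongrightarrow> y"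
    unfolding y_def by (intro scaleC.tendsto tendsto_inverse \<mu>r \<mu>(2) Au)
  moreover have "\<forall>\<^sub>F k in sequentially. inverse (\<mu> (r k)) *\<^sub>C (\<mu> (r k) *\<^sub>C u (r k)) = u (r k)"
    using tendsto_imp_eventually_ne[OF \<mu>r \<mu>(2)]
    by eventually_elim (simp add: scaleC_scaleC scaleC_one)
  ultimately have uy: "(\<lambda>k. u (r k)) \<longlonglongrightarrow> y" by (rule Lim_transform_eventually)
  have "norm y = 1" using LIMSEQ_unique[OF tendsto_norm[OF uy]] u(1) by simp
  moreover have "(\<lambda>k. blinfun_apply (A x0) (u (r k))) \<longlonglongrightarrow> blinfun_apply (A x0) y"
    by (intro blinfun.tendsto tendsto_const uy)
  then have "blinfun_apply (A x0) y = z" using r(2) LIMSEQ_unique by blast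
  then have "blinfun_apply (A x0) y = \<mu>0 *\<^sub>C y"
    using \<mu>(2) by (simp add: y_def scaleC_scaleC scaleC_one)
  ultimately show ?thesis using that[OF r(1) uy] by blast
qed

text \<open>
  Two distinct eigenvalues approaching \<open>\<mu>0\<close> have orthogonal eigenvectors. In the limit these would be
  two orthogonal unit vectors in the eigenline of \<open>\<mu>0\<close>.
\<close>

lemma eigenvalue_locally_unique:
  assumes x0: "x0 \<in> {0..1}" and "\<mu>0 \<noteq> 0"
  obtains d where "d > 0" "\<forall>x\<in>{0..1}. \<forall>\<mu>\<in>Eig (A x). \<forall>\<nu>\<in>Eig (A x).
      dist x x0 < d \<longrightarrow> dist \<mu> \<mu>0 < d \<longrightarrow> dist \<nu> \<mu>0 < d \<longrightarrow> \<mu> = \<nu>"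
proof (rule ccontr)
  assume no: "\<not> thesis"
  have "\<exists>x \<mu> \<nu>. x \<in> {0..1} \<and> \<mu> \<in> Eig (A x) \<and> \<nu> \<in> Eig (A x) \<and> \<mu> \<noteq> \<nu> \<and>
      dist x x0 < inverse (real (Suc k)) \<and> dist \<mu> \<mu>0 < inverse (real (Suc k)) \<and>
      dist \<nu> \<mu>0 < inverse (real (Suc k))" for k
    using no that[of "inverse (real (Suc k))"] by fastforce
  then obtain x \<mu> \<nu> where x: "\<And>k. x k \<in> {0..1}"
    and \<mu>: "\<And>k. \<mu> k \<in> Eig (A (x k))" and \<nu>: "\<And>k. \<nu> k \<in> Eig (A (x k))"
    and ne: "\<And>k. \<mu> k \<noteq> \<nu> k"
    and lim: "\<And>k. dist (x k) x0 < inverse (real (Suc k))" "\<And>k. dist (\<mu> k) \<mu>0 < inverse (real (Suc k))"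
      "\<And>k. dist (\<nu> k) \<mu>0 < inverse (real (Suc k))"
    by metis
  have null: "f \<longlonglongrightarrow> l" if "\<And>k. dist (f k) l < inverse (real (Suc k))" for f :: "nat \<Rightarrow> 'x::metric_space" and l
    by (subst tendsto_dist_iff, rule Lim_null_comparison[OF _ LIMSEQ_inverse_real_of_nat])
      (use that in \<open>auto intro!: always_eventually less_imp_le\<close>)
  have "\<exists>u. norm u = 1 \<and> blinfun_apply (A (x k)) u = \<mu> k *\<^sub>C u" for k
    using unit_eigenvector[OF x \<mu>] by metis
  then obtain u where u: "\<And>k. norm (u k) = 1" "\<And>k. blinfun_apply (A (x k)) (u k) = \<mu> k *\<^sub>C u k" by metis
  have "\<exists>v. norm v = 1 \<and> blinfun_apply (A (x k)) v = \<nu> k *\<^sub>C v" for k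
    using unit_eigenvector[OF x \<nu>] by metis
  then obtain v where v: "\<And>k. norm (v k) = 1" "\<And>k. blinfun_apply (A (x k)) (v k) = \<nu> k *\<^sub>C v k" by metis
  obtain r y where r: "strict_mono r" and y: "(\<lambda>k. u (r k)) \<longlonglongrightarrow> y" "norm y = 1"
    "blinfun_apply (A x0) y = \<mu>0 *\<^sub>C y"
    using eigenvector_limit[OF x null[OF lim(1)] u null[OF lim(2)] \<open>\<mu>0 \<noteq> 0\<close>] .
  have sub: "(\<lambda>k. f (r k)) \<longlonglongrightarrow> l" if "f \<longlonglongrightarrow> l" for f :: "nat \<Rightarrow> 'x::metric_space" and l
    using LIMSEQ_subseq_LIMSEQ[OF that r] by (simp add: o_def)
  obtain s z where s: "strict_mono s" and z: "(\<lambda>k. v (r (s k))) \<longlonglongrightarrow> z" "norm z = 1"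
    "blinfun_apply (A x0) z = \<mu>0 *\<^sub>C z"
    using eigenvector_limit[of "\<lambda>k. x (r k)" x0 "\<lambda>k. v (r k)" "\<lambda>k. \<nu> (r k)" \<mu>0,
        OF x sub[OF null[OF lim(1)]] v sub[OF null[OF lim(3)]] \<open>\<mu>0 \<noteq> 0\<close>] .
  have "(\<lambda>k. u (r (s k))) \<longlonglongrightarrow> y" using LIMSEQ_subseq_LIMSEQ[OF y(1) s] by (simp add: o_def)
  then have "(\<lambda>k. cinner (u (r (s k))) (v (r (s k)))) \<longlonglongrightarrow> cinner y z"
    by (intro cinner.tendsto z(1))
  moreover have "cinner (u k) (v k) = 0" for k
    using normal_eigenvectors_orthogonal[OF lin[OF x] normal[OF x] u(2) v(2) ne] .
  ultimately have "cinner y z = 0" by (simp add: LIMSEQ_const_iff)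
  moreover obtain c where "cmod c = 1" "z = c *\<^sub>C y"
    using multiplicity_free_eigenvector_unique[OF simple[OF x0] y(3) z(3) y(2) z(2)] .
  ultimately show False using y(2) by (auto simp: cinner_simps cinner_self)
qed

definition selection :: "(real \<Rightarrow> complex) \<Rightarrow> bool" where
  "selection l \<longleftrightarrow> continuous_on {0..1} l \<and> (\<forall>x\<in>{0..1}. l x \<in> Eig (A x))"

lemma selection_nonzero: "selection l \<Longrightarrow> x \<in> {0..1} \<Longrightarrow> l x \<noteq> 0"
  using nonzero unfolding selection_def by metis

text \<open>
  The set where two selections agree is closed by continuity and open by local uniqueness.
\<close>

lemma selections_agree:
  assumes l: "selection l" "selection l'" and x: "x \<in> {0..1}" "y \<in> {0..1}" and "l x = l' x"
  shows "l y = l' y"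
proof -
  have "(l x = l' x) = (l y = l' y)"
  proof (rule connected_local_const[OF connected_Icc x], rule ballI)
    fix t :: real assume t: "t \<in> {0..1}"
    have lim: "(l \<longlongrightarrow> l t) (at t within {0..1})" "(l' \<longlongrightarrow> l' t) (at t within {0..1})"
      using l t by (auto simp: selection_def continuous_on_def)
    show "\<forall>\<^sub>F s in at t within {0..1}. (l t = l' t) = (l s = l' s)"
    proof (cases "l t = l' t")
      case True
      obtain d where d: "d > 0" "\<forall>x\<in>{0..1}. \<forall>\<mu>\<in>Eig (A x). \<forall>\<nu>\<in>Eig (A x).
          dist x t < d \<longrightarrow> dist \<mu> (l t) < d \<longrightarrow> dist \<nu> (l t) < d \<longrightarrow> \<mu> = \<nu>"
        using eigenvalue_locally_unique[OF t selection_nonzero[OF l(1) t]] .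
      have "\<forall>\<^sub>F s in at t within {0..1}. dist s t < d"
        using d(1) by (auto simp: eventually_at)
      moreover have "\<forall>\<^sub>F s in at t within {0..1}. s \<in> {0..1}"
        by (auto simp: eventually_at intro: exI[of _ 1])
      moreover note tendstoD[OF lim(1) d(1)] tendstoD[OF lim(2) d(1)]
      ultimately show ?thesis
      proof eventually_elim
        case (elim s)
        then have "l s = l' s" using d(2) l True by (auto simp: selection_def)
        with True show ?case by simp
      qed
    next
      case False
      have "\<forall>\<^sub>F s in at t within {0..1}. l s - l' s \<noteq> 0"
        using False by (intro tendsto_imp_eventually_ne[OF tendsto_diff[OF lim]]) simp
      then show ?thesis by eventually_elim (use False in auto)
    qed
  qed
  with \<open>l x = l' x\<close> show ?thesis by simp
qed

lemma compact_large_eigenvalues: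
  assumes "\<epsilon> > 0"
  shows "compact {(x, \<mu>). x \<in> {0..1} \<and> \<mu> \<in> Eig (A x) \<and> \<epsilon> \<le> cmod \<mu>}" (is "compact ?C")
proof -
  obtain R where R: "\<forall>T\<in>A ` {0..1}. norm T \<le> R"
    using compact_imp_bounded[OF compact_continuous_image[OF cont compact_Icc]] unfolding bounded_iff by blast
  have "cmod \<mu> \<le> R" if x: "x \<in> {0..1}" and \<mu>: "\<mu> \<in> Eig (A x)" for x \<mu>
  proof -
    obtain u where u: "norm u = 1" "blinfun_apply (A x) u = \<mu> *\<^sub>C u" using unit_eigenvector[OF x \<mu>] .
    have "cmod \<mu> = norm (blinfun_apply (A x) u)" by (simp add: u norm_scaleC)
    also have "\<dots> \<le> norm (A x)" using norm_blinfun[of "A x" u] by (simp add: u)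
    also have "\<dots> \<le> R" using R x by blast
    finally show ?thesis .
  qed
  then have "?C \<subseteq> {0..1} \<times> cball 0 R" by auto
  then have "bounded ?C"
    by (rule bounded_subset[OF bounded_Times[OF bounded_closed_interval bounded_cball]])
  moreover have "closed ?C"
    unfolding closed_sequential_limits
  proof (intro allI impI, elim conjE)
    fix p :: "nat \<Rightarrow> real \<times> complex" and q assume p: "\<forall>n. p n \<in> ?C" and lim: "p \<longlonglongrightarrow> q"
    define x where "x n = fst (p n)" for n
    define \<mu> where "\<mu> n = snd (p n)" for n
    have x: "\<And>n. x n \<in> {0..1}" and \<mu>: "\<And>n. \<mu> n \<in> Eig (A (x n))" and ge: "\<And>n. \<epsilon> \<le> cmod (\<mu> n)"
      using p by (auto simp: x_def \<mu>_def split_beta)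
    have xlim: "x \<longlonglongrightarrow> fst q" and \<mu>lim: "\<mu> \<longlonglongrightarrow> snd q"
      unfolding x_def \<mu>_def using lim by (auto intro: tendsto_intros)
    have ge': "\<epsilon> \<le> cmod (snd q)"
      using ge by (intro LIMSEQ_le_const[OF tendsto_norm[OF \<mu>lim]]) auto
    then have "snd q \<noteq> 0" using assms by auto
    have "\<exists>u. norm u = 1 \<and> blinfun_apply (A (x k)) u = \<mu> k *\<^sub>C u" for k
      using unit_eigenvector[OF x \<mu>] by metis
    then obtain u where u: "\<And>k. norm (u k) = 1" "\<And>k. blinfun_apply (A (x k)) (u k) = \<mu> k *\<^sub>C u k" by metis
    obtain r y where "strict_mono r" "(\<lambda>k. u (r k)) \<longlonglongrightarrow> y" and y: "norm y = 1"
      "blinfun_apply (A (fst q)) y = snd q *\<^sub>C y"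
      using eigenvector_limit[OF x xlim u \<mu>lim \<open>snd q \<noteq> 0\<close>] .
    have "fst q \<in> {0..1}" using closed_sequentially[OF closed_atLeastAtMost x xlim] .
    then have "fst q \<in> {0..1} \<and> snd q \<in> Eig (A (fst q)) \<and> \<epsilon> \<le> cmod (snd q)"
      using ge' EigI[OF y(2,1)] by blast
    then show "q \<in> ?C" by (simp add: split_beta)
  qed
  ultimately show ?thesis by (simp add: compact_eq_bounded_closed)
qed

text \<open>
  Near a point \<open>(x0, \<mu>0)\<close> of the compact set of large eigenvalues there are, by local uniqueness, no
  eigenvalues except those on the selection through \<open>(x0, \<mu>0)\<close> provided by condition (1). So finitely
  many selections suffice. They are indexed by their value at \<open>0\<close>, which discards repetitions, because
  selections that agree at one point agree everywhere.
\<close>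

lemma finitely_many_large_selections:
  assumes cond: "condition1_interval A" and "\<epsilon> > 0"
  obtains I l where "finite I" "\<forall>i\<in>I. selection (l i)"
    "\<forall>x\<in>{0..1}. inj_on (\<lambda>i. l i x) I"
    "\<forall>x\<in>{0..1}. \<forall>\<mu>\<in>Eig (A x). \<epsilon> \<le> cmod \<mu> \<longrightarrow> \<mu> \<in> (\<lambda>i. l i x) ` (I :: complex set)"
proof -
  define C where "C = {(x, \<mu>). x \<in> {0..1} \<and> \<mu> \<in> Eig (A x) \<and> \<epsilon> \<le> cmod \<mu>}"
  have C_iff: "(x, \<mu>) \<in> C \<longleftrightarrow> x \<in> {0..1} \<and> \<mu> \<in> Eig (A x) \<and> \<epsilon> \<le> cmod \<mu>" for x \<mu>
    by (simp add: C_def)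
  have C_compact: "compact C" unfolding C_def by (rule compact_large_eigenvalues[OF \<open>\<epsilon> > 0\<close>])
  have "\<exists>l d. selection l \<and> d > 0 \<and> (\<forall>x \<mu>. (x, \<mu>) \<in> C \<longrightarrow> dist x (fst p) < d \<longrightarrow> dist \<mu> (snd p) < d \<longrightarrow> \<mu> = l x)"
    if "p \<in> C" for p
  proof -
    obtain x0 \<mu>0 where p: "p = (x0, \<mu>0)" by (cases p)
    have x0: "x0 \<in> {0..1}" "\<mu>0 \<in> Eig (A x0)" using that by (auto simp: p C_iff)
    have "\<exists>l. continuous_on {0..1} l \<and> l x0 = \<mu>0 \<and> (\<forall>x\<in>{0..1}. l x \<in> Eig (A x))"
      using cond x0 unfolding condition1_interval_def by blast
    then obtain l where l: "selection l" "l x0 = \<mu>0" unfolding selection_def by blast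
    obtain d where d: "d > 0" "\<forall>x\<in>{0..1}. \<forall>\<mu>\<in>Eig (A x). \<forall>\<nu>\<in>Eig (A x).
        dist x x0 < d \<longrightarrow> dist \<mu> \<mu>0 < d \<longrightarrow> dist \<nu> \<mu>0 < d \<longrightarrow> \<mu> = \<nu>"
      using eigenvalue_locally_unique[OF x0(1), of \<mu>0] selection_nonzero[OF l(1) x0(1)] l(2) by metis
    have "continuous_on {0..1} l" using l(1) by (simp add: selection_def)
    then obtain d' where d': "d' > 0" "\<forall>x\<in>{0..1}. dist x x0 < d' \<longrightarrow> dist (l x) \<mu>0 < d"
      using d(1) x0(1) l(2) unfolding continuous_on_iff by metis
    have "\<mu> = l x" if "(x, \<mu>) \<in> C" "dist x x0 < min d d'" "dist \<mu> \<mu>0 < min d d'" for x \<mu>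
    proof -
      have x: "x \<in> {0..1}" "\<mu> \<in> Eig (A x)" using that(1) by (auto simp: C_iff)
      moreover have "l x \<in> Eig (A x)" using l(1) x(1) unfolding selection_def by blast
      moreover have "dist (l x) \<mu>0 < d" using d'(2) x(1) that(2) by simp
      moreover have "dist x x0 < d" "dist \<mu> \<mu>0 < d" using that by simp_all
      ultimately show ?thesis using d(2) by blast
    qed
    moreover have "0 < min d d'" using d(1) d'(1) by simp
    ultimately show ?thesis using l(1) unfolding p fst_conv snd_conv by blast
  qed
  then obtain L d where L: "\<And>p. p \<in> C \<Longrightarrow> selection (L p)" and d: "\<And>p. p \<in> C \<Longrightarrow> d p > 0"
    and Ld: "\<And>p x \<mu>. p \<in> C \<Longrightarrow> (x, \<mu>) \<in> C \<Longrightarrow> dist x (fst p) < d p \<Longrightarrow> dist \<mu> (snd p) < d p \<Longrightarrow> \<mu> = L p x"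
    by metis
  have "C \<subseteq> (\<Union>p\<in>C. ball p (d p))" using d by (auto intro: centre_in_ball[THEN iffD2])
  from compactE_image[OF C_compact _ this]
  obtain K where K: "K \<subseteq> C" "finite K" "C \<subseteq> (\<Union>p\<in>K. ball p (d p))" by auto
  define I where "I = (\<lambda>p. L p 0) ` K"
  define l where "l i = L (SOME p. p \<in> K \<and> L p 0 = i)" for i
  have some: "\<exists>p\<in>K. l i = L p \<and> L p 0 = i" if "i \<in> I" for i
  proof -
    have "\<exists>p. p \<in> K \<and> L p 0 = i" using that by (auto simp: I_def)
    from someI_ex[OF this] show ?thesis unfolding l_def by blast
  qed
  have sel: "selection (l i)" and l0: "l i 0 = i" if "i \<in> I" for i
    using some[OF that] L K(1) by auto
  show ?thesis
  proof (rule that)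
    show "finite I" using K(2) by (simp add: I_def)
    show "\<forall>i\<in>I. selection (l i)" using sel by blast
    show "\<forall>x\<in>{0..1}. inj_on (\<lambda>i. l i x) I"
    proof (intro ballI inj_onI)
      fix x i j assume x: "x \<in> {0..1::real}" and ij: "i \<in> I" "j \<in> I" "l i x = l j x"
      have "l i 0 = l j 0" using selections_agree[OF sel sel x _ ij(3)] ij by simp
      then show "i = j" using ij by (simp add: l0)
    qed
    show "\<forall>x\<in>{0..1}. \<forall>\<mu>\<in>Eig (A x). \<epsilon> \<le> cmod \<mu> \<longrightarrow> \<mu> \<in> (\<lambda>i. l i x) ` I"
    proof (intro ballI impI)
      fix x \<mu> assume x: "x \<in> {0..1}" "\<mu> \<in> Eig (A x)" "\<epsilon> \<le> cmod \<mu>"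
      then have xC: "(x, \<mu>) \<in> C" by (simp add: C_iff)
      then obtain p where p: "p \<in> K" "dist p (x, \<mu>) < d p" using K(3) by auto
      have "dist x (fst p) \<le> dist p (x, \<mu>)" "dist \<mu> (snd p) \<le> dist p (x, \<mu>)"
        using dist_fst_le[of p "(x, \<mu>)"] dist_snd_le[of p "(x, \<mu>)"] by (simp_all add: dist_commute)
      then have eq: "\<mu> = L p x" using p K(1) by (intro Ld xC) auto
      have i: "L p 0 \<in> I" using p(1) by (auto simp: I_def)
      have "selection (L p)" using L K(1) p(1) by blast
      from selections_agree[OF sel[OF i] this _ x(1), of 0] have "l (L p 0) x = L p x"
        using l0[OF i] by simp
      with eq i show "\<mu> \<in> (\<lambda>i. l i x) ` I" by (metis image_eqI)
    qed
  qed
qed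

text \<open>
  Projecting a fixed eigenvector at \<open>x0\<close> to the eigenlines at nearby points gives a continuous local
  choice \<open>p\<close>. Its values do not depend on the phases of the arbitrary unit eigenvectors \<open>u x\<close>, which is
  why it is continuous although \<open>u\<close> is not. Local choices on adjacent intervals are glued after a change of
  phase, as in Bolzano's bisection argument.
\<close>

lemma continuous_unit_eigenvector:
  assumes l: "selection l"
  obtains v where "continuous_on {0..1} v"
    "\<forall>x\<in>{0..1}. norm (v x) = 1 \<and> blinfun_apply (A x) (v x) = l x *\<^sub>C v x"
proof -
  define Q where "Q a b \<longleftrightarrow> 0 \<le> a \<longrightarrow> b \<le> 1 \<longrightarrow> (\<exists>v. continuous_on {a..b} v \<and>
      (\<forall>x\<in>{a..b}. norm (v x) = 1 \<and> blinfun_apply (A x) (v x) = l x *\<^sub>C v x))" for a b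
  have "\<exists>u. norm u = 1 \<and> blinfun_apply (A x) u = l x *\<^sub>C u" if "x \<in> {0..1}" for x
    using unit_eigenvector[OF that] l that unfolding selection_def by metis
  then obtain u where u: "\<And>x. x \<in> {0..1} \<Longrightarrow> norm (u x) = 1"
    "\<And>x. x \<in> {0..1} \<Longrightarrow> blinfun_apply (A x) (u x) = l x *\<^sub>C u x" by metis
  have "Q 0 1"
  proof (rule Bolzano)
    show "(0::real) \<le> 1" by simp
    fix a b c assume "Q a b" "Q b c" and abc: "a \<le> b" "b \<le> c"
    show "Q a c"
      unfolding Q_def
    proof (intro impI)
      assume "0 \<le> a" "c \<le> 1"
      then obtain v w where v: "continuous_on {a..b} v"
          "\<forall>x\<in>{a..b}. norm (v x) = 1 \<and> blinfun_apply (A x) (v x) = l x *\<^sub>C v x"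
        and w: "continuous_on {b..c} w"
          "\<forall>x\<in>{b..c}. norm (w x) = 1 \<and> blinfun_apply (A x) (w x) = l x *\<^sub>C w x"
        using \<open>Q a b\<close> \<open>Q b c\<close> abc unfolding Q_def by (meson order_trans)
      have b: "b \<in> {0..1}" "b \<in> {a..b}" "b \<in> {b..c}" using abc \<open>0 \<le> a\<close> \<open>c \<le> 1\<close> by auto
      obtain k where k: "cmod k = 1" "v b = k *\<^sub>C w b"
        using multiplicity_free_eigenvector_unique[OF simple[OF b(1)], of "w b" "l b" "v b"] v(2) w(2) b by metis
      define f where "f x = (if x \<le> b then v x else k *\<^sub>C w x)" for x
      have "continuous_on ({a..b} \<union> {b..c}) (\<lambda>x. if x \<le> b then v x else k *\<^sub>C w x)"
      proof (rule continuous_on_If)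
        show "continuous_on {b..c} (\<lambda>x. k *\<^sub>C w x)"
          by (intro scaleC.continuous_on continuous_on_const w(1))
      qed (use v(1) k(2) abc in auto)
      moreover have "{a..b} \<union> {b..c} = {a..c}" using abc by auto
      ultimately have "continuous_on {a..c} f" unfolding f_def by simp
      moreover have "norm (f x) = 1 \<and> blinfun_apply (A x) (f x) = l x *\<^sub>C f x" if "x \<in> {a..c}" for x
        using v(2) w(2) that k(1) \<open>0 \<le> a\<close> \<open>c \<le> 1\<close> clinear_opD[OF lin, of x]
        by (simp add: f_def norm_scaleC scaleC_scaleC mult.commute)
      ultimately show "\<exists>v. continuous_on {a..c} v \<and>
          (\<forall>x\<in>{a..c}. norm (v x) = 1 \<and> blinfun_apply (A x) (v x) = l x *\<^sub>C v x)" by blast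
    qed
  next
    fix x0 :: real assume "0 \<le> x0" "x0 \<le> 1"
    then have x0: "x0 \<in> {0..1}" by simp
    define p where "p x = cinner (u x) (u x0) *\<^sub>C u x" for x
    have p_cont: "continuous_on {0..1} p"
    proof (rule ccontr)
      assume "\<not> continuous_on {0..1} p"
      then obtain x \<eta> where x: "x \<in> {0..1}" "\<eta> > 0"
        and "\<And>d. d > 0 \<Longrightarrow> \<exists>y\<in>{0..1}. dist y x < d \<and> \<not> dist (p y) (p x) < \<eta>"
        unfolding continuous_on_iff by blast
      then have "\<exists>y. y \<in> {0..1} \<and> dist y x < inverse (real (Suc k)) \<and> \<not> dist (p y) (p x) < \<eta>" for k
        by (metis inverse_positive_iff_positive of_nat_0_less_iff zero_less_Suc)
      then obtain y where y: "\<And>k. y k \<in> {0..1}" "\<And>k. dist (y k) x < inverse (real (Suc k))"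
        "\<And>k. \<not> dist (p (y k)) (p x) < \<eta>" by metis
      have ylim: "y \<longlonglongrightarrow> x"
        by (subst tendsto_dist_iff, rule Lim_null_comparison[OF _ LIMSEQ_inverse_real_of_nat])
          (use y(2) in \<open>auto intro!: always_eventually less_imp_le\<close>)
      have llim: "(\<lambda>k. l (y k)) \<longlonglongrightarrow> l x"
        using continuous_on_tendsto_compose[of "{0..1}" l, OF _ ylim x(1)] l y(1)
        by (simp add: selection_def)
      obtain r z where r: "strict_mono r" and z: "(\<lambda>k. u (y (r k))) \<longlonglongrightarrow> z" "norm z = 1"
        "blinfun_apply (A x) z = l x *\<^sub>C z"
        using eigenvector_limit[OF y(1) ylim u(1)[OF y(1)] u(2)[OF y(1)] llim selection_nonzero[OF l x(1)]] .
      obtain c where c: "cmod c = 1" "z = c *\<^sub>C u x"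
        using multiplicity_free_eigenvector_unique[OF simple[OF x(1)] u(2)[OF x(1)] z(3) u(1)[OF x(1)] z(2)] .
      have "(\<lambda>k. p (y (r k))) \<longlonglongrightarrow> cinner z (u x0) *\<^sub>C z"
        unfolding p_def by (intro scaleC.tendsto cinner.tendsto tendsto_const z(1))
      also have "cinner z (u x0) *\<^sub>C z = p x"
        using cnj_mult_self_unimodular[OF c(1)]
        by (simp add: c(2) p_def cinner_simps scaleC_scaleC mult_ac)
      finally have "\<forall>\<^sub>F k in sequentially. dist (p (y (r k))) (p x) < \<eta>"
        using x(2) by (rule tendstoD)
      then show False using y(3) by (auto simp: eventually_sequentially)
    qed
    have "p x0 = u x0" using u(1)[OF x0] by (simp add: p_def cinner_self scaleC_one)
    obtain d where d: "d > 0" "\<forall>x\<in>{0..1}. dist x x0 < d \<longrightarrow> dist (p x) (p x0) < 1"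
      using p_cont x0 unfolding continuous_on_iff by (metis zero_less_one)
    have p_ne: "p x \<noteq> 0" if "x \<in> {0..1}" "dist x x0 < d" for x
      using d(2) that \<open>p x0 = u x0\<close> u(1)[OF x0] by (auto simp: dist_norm)
    have "Q a b" if "a \<le> x0" "x0 \<le> b" "b - a < d" for a b
      unfolding Q_def
    proof (intro impI)
      assume "0 \<le> a" "b \<le> 1"
      then have sub: "{a..b} \<subseteq> {0..1}" by auto
      define v where "v x = complex_of_real (1 / norm (p x)) *\<^sub>C p x" for x
      have ne: "p x \<noteq> 0" if "x \<in> {a..b}" for x
      proof (rule p_ne)
        show "x \<in> {0..1}" using sub that by blast
        have "a \<le> x" "x \<le> b" using that by auto
        then show "dist x x0 < d"
          using \<open>a \<le> x0\<close> \<open>x0 \<le> b\<close> \<open>b - a < d\<close> unfolding dist_real_def by linarith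
      qed
      have "continuous_on {a..b} v"
        unfolding v_def using continuous_on_subset[OF p_cont sub] ne
        by (intro scaleC.continuous_on continuous_on_of_real continuous_on_divide continuous_on_norm
            continuous_on_const) auto
      moreover have "norm (v x) = 1 \<and> blinfun_apply (A x) (v x) = l x *\<^sub>C v x" if "x \<in> {a..b}" for x
      proof -
        have x: "x \<in> {0..1}" using sub that by blast
        show ?thesis
          using ne[OF that]
          by (simp add: v_def norm_scaleC norm_divide clinear_opD[OF lin[OF x]])
            (simp add: p_def clinear_opD[OF lin[OF x]] u(2)[OF x] scaleC_scaleC mult_ac)
      qed
      ultimately show "\<exists>v. continuous_on {a..b} v \<and>
          (\<forall>x\<in>{a..b}. norm (v x) = 1 \<and> blinfun_apply (A x) (v x) = l x *\<^sub>C v x)" by blast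
    qed
    then show "\<exists>d>0. \<forall>a b. a \<le> x0 \<and> x0 \<le> b \<and> b - a < d \<longrightarrow> Q a b" using d(1) by blast
  qed
  then show ?thesis using that unfolding Q_def by auto
qed

end

section \<open>Approximate equivalence over the interval\<close>

lemma continuous_on_compose_op:
  fixes S T :: "'x::topological_space \<Rightarrow> 'h::complex_hilbert \<Rightarrow>\<^sub>L 'h"
  shows "continuous_on X S \<Longrightarrow> continuous_on X T \<Longrightarrow> continuous_on X (\<lambda>x. S x o\<^sub>L T x)"
  by (rule bounded_bilinear.continuous_on[OF bounded_bilinear_blinfun_compose])

text \<open>
  The last conclusion is what survives at the two ends of a closed path: large eigenvectors of \<open>B\<close> are sent
  to eigenvectors of \<open>A\<close> for the same eigenvalue, whichever selection carries it at that end.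
\<close>

lemma intertwiner_on_interval:
  assumes A: "eigenvalue_family e A" and B: "eigenvalue_family e B"
    and Eig: "\<And>x. x \<in> {0..1} \<Longrightarrow> Eig (A x) = Eig (B x)"
    and cond: "condition1_interval A" and "\<epsilon> > 0"
  obtains U where "continuous_on {0..1} U" "\<forall>x\<in>{0..1}. unitary_perturbation e (U x)"
    "\<forall>x\<in>{0..1}. norm (B x - (adj (U x) o\<^sub>L A x o\<^sub>L U x)) \<le> 2 * \<epsilon>"
    "\<forall>x\<in>{0..1}. finite {\<mu> \<in> Eig (B x). \<epsilon> \<le> cmod \<mu>}"
    "\<forall>x\<in>{0..1}. \<forall>\<mu> b. \<epsilon> \<le> cmod \<mu> \<longrightarrow> norm b = 1 \<longrightarrow> blinfun_apply (B x) b = \<mu> *\<^sub>C b \<longrightarrow>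
       blinfun_apply (A x) (blinfun_apply (U x) b) = \<mu> *\<^sub>C blinfun_apply (U x) b"
proof -
  interpret A: eigenvalue_family e A by fact
  interpret B: eigenvalue_family e B by fact
  obtain I :: "complex set" and l where I: "finite I" and sel: "\<forall>i\<in>I. A.selection (l i)"
    and inj: "\<forall>x\<in>{0..1}. inj_on (\<lambda>i. l i x) I"
    and large: "\<forall>x\<in>{0..1}. \<forall>\<mu>\<in>Eig (A x). \<epsilon> \<le> cmod \<mu> \<longrightarrow> \<mu> \<in> (\<lambda>i. l i x) ` I"
    using A.finitely_many_large_selections[OF cond \<open>\<epsilon> > 0\<close>] .
  have selB: "B.selection (l i)" if "i \<in> I" for i
    using sel that Eig unfolding A.selection_def B.selection_def by auto
  have "\<forall>i\<in>I. \<exists>v. continuous_on {0..1} v \<and>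
      (\<forall>x\<in>{0..1}. norm (v x) = 1 \<and> blinfun_apply (A x) (v x) = l i x *\<^sub>C v x)"
    using A.continuous_unit_eigenvector sel by metis
  then obtain v where v: "\<And>i. i \<in> I \<Longrightarrow> continuous_on {0..1} (v i)"
    "\<And>i x. i \<in> I \<Longrightarrow> x \<in> {0..1} \<Longrightarrow> norm (v i x) = 1"
    "\<And>i x. i \<in> I \<Longrightarrow> x \<in> {0..1} \<Longrightarrow> blinfun_apply (A x) (v i x) = l i x *\<^sub>C v i x"
    by metis
  have "\<forall>i\<in>I. \<exists>w. continuous_on {0..1} w \<and>
      (\<forall>x\<in>{0..1}. norm (w x) = 1 \<and> blinfun_apply (B x) (w x) = l i x *\<^sub>C w x)"
    using B.continuous_unit_eigenvector selB by metis
  then obtain w where w: "\<And>i. i \<in> I \<Longrightarrow> continuous_on {0..1} (w i)"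
    "\<And>i x. i \<in> I \<Longrightarrow> x \<in> {0..1} \<Longrightarrow> norm (w i x) = 1"
    "\<And>i x. i \<in> I \<Longrightarrow> x \<in> {0..1} \<Longrightarrow> blinfun_apply (B x) (w i x) = l i x *\<^sub>C w i x"
    by metis
  have v_orth: "cinner (v i x) (v j x) = (if i = j then 1 else 0)" if "i \<in> I" "j \<in> I" "x \<in> {0..1}" for i j x
    using normal_eigenvectors_orthonormal[OF A.lin[OF that(3)] A.normal[OF that(3)] bspec[OF inj that(3)]
        v(2)[OF _ that(3)] v(3)[OF _ that(3)] that(1,2)] .
  have w_orth: "cinner (w i x) (w j x) = (if i = j then 1 else 0)" if "i \<in> I" "j \<in> I" "x \<in> {0..1}" for i j x
    using normal_eigenvectors_orthonormal[OF B.lin[OF that(3)] B.normal[OF that(3)] bspec[OF inj that(3)]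
        w(2)[OF _ that(3)] w(3)[OF _ that(3)] that(1,2)] .
  obtain U where U: "continuous_on {0..1} U" "\<forall>x\<in>{0..1}. unitary_perturbation e (U x)"
    and Uw: "\<forall>x\<in>{0..1}. \<forall>i\<in>I. blinfun_apply (U x) (w i x) = v i x"
    and "\<forall>x\<in>{0..1}. \<forall>y\<in>{0..1}. (\<forall>i\<in>I. w i x = w i y \<and> v i x = v i y) \<longrightarrow> U x = U y"
    using frames_conjugate[OF A.onb compact_Icc I v(1) v_orth w(1) w_orth] .
  have lin: "clinear_op (U x)" if "x \<in> {0..1}" for x
    using U(2) that unitary_perturbation_clinear by blast
  show ?thesis
  proof (rule that[OF U]; intro ballI allI impI)
    fix x :: real assume x: "x \<in> {0..1}"
    show "norm (B x - (adj (U x) o\<^sub>L A x o\<^sub>L U x)) \<le> 2 * \<epsilon>"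
    proof (rule conjugation_error_le[OF A.onb A.comp[OF x] A.normal[OF x] A.simple[OF x]
          B.comp[OF x] B.normal[OF x] B.simple[OF x] I, of "\<lambda>i. l i x" "\<lambda>i. v i x" "\<lambda>i. w i x"])
      show "inj_on (\<lambda>i. l i x) I" using inj x by blast
      show "cmod \<mu> \<le> \<epsilon>" if "\<mu> \<in> Eig (A x) \<union> Eig (B x)" "\<mu> \<notin> (\<lambda>i. l i x) ` I" for \<mu>
        using large x Eig[OF x] that by (metis Un_absorb linear)
      show "\<exists>c. cmod c = 1 \<and> blinfun_apply (U x) (w i x) = c *\<^sub>C v i x" if "i \<in> I" for i
        using Uw x that by (intro exI[of _ 1]) (simp add: scaleC_one)
      show "unitary_op (U x)" using U(2) x unitary_perturbation_unitary by blast
    qed (use v w x lin \<open>\<epsilon> > 0\<close> in auto)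
  next
    fix x :: real assume x: "x \<in> {0..1}"
    have "{\<mu> \<in> Eig (B x). \<epsilon> \<le> cmod \<mu>} \<subseteq> (\<lambda>i. l i x) ` I"
      using large x Eig[OF x] by blast
    then show "finite {\<mu> \<in> Eig (B x). \<epsilon> \<le> cmod \<mu>}" using I finite_surj by blast
  next
    fix x :: real and \<mu> b
    assume x: "x \<in> {0..1}" and \<mu>: "\<epsilon> \<le> cmod \<mu>" and b: "norm b = 1" "blinfun_apply (B x) b = \<mu> *\<^sub>C b"
    have "\<mu> \<in> Eig (A x)" using EigI[OF b(2,1)] Eig[OF x] by simp
    then obtain i where i: "i \<in> I" "\<mu> = l i x" using large x \<mu> by blast
    obtain c where c: "b = c *\<^sub>C w i x"
      using multiplicity_free_eigenvector_unique[OF B.simple[OF x] w(3)[OF i(1) x] _ w(2)[OF i(1) x] b(1)]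
        b(2) i(2) by metis
    have "blinfun_apply (U x) b = c *\<^sub>C v i x"
      using Uw x i(1) by (simp add: c clinear_opD[OF lin[OF x]])
    then show "blinfun_apply (A x) (blinfun_apply (U x) b) = \<mu> *\<^sub>C blinfun_apply (U x) b"
      by (simp add: clinear_opD[OF A.lin[OF x]] v(3)[OF i(1) x] i(2) scaleC_scaleC mult.commute)
  qed
qed

section \<open>Closing up the two ends\<close>

lemma unimodular_path:
  assumes "cmod c = 1"
  obtains \<gamma> :: "real \<Rightarrow> complex" where "continuous_on UNIV \<gamma>" "\<And>t. cmod (\<gamma> t) = 1" "\<gamma> 0 = cnj c" "\<gamma> 1 = 1"
proof
  let ?\<gamma> = "\<lambda>t. cis (- Arg c * (1 - t))"
  have "c \<noteq> 0" using assms by auto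
  then have "cis (Arg c) = c" using assms by (simp add: cis_Arg sgn_div_norm)
  then show "?\<gamma> 0 = cnj c" by (simp add: cis_cnj[symmetric])
  show "continuous_on UNIV ?\<gamma>" by (intro continuous_intros)
qed auto

text \<open>
  Let \<open>b \<mu>\<close> be unit eigenvectors of \<open>T\<close> for its large eigenvalues. The path \<open>Y t = U 1* U t\<close> joins
  \<open>U 1* U 0\<close> to the identity, and \<open>Y 0\<close> multiplies every \<open>b \<mu>\<close> by a phase. Rotating these phases away
  turns \<open>Y t (b \<mu>)\<close> into a closed path of frames \<open>f \<mu> t\<close>, and \<open>frames_conjugate\<close> gives a closed path \<open>X\<close>
  of unitaries with \<open>X t (f \<mu> t) = b \<mu>\<close>. Then \<open>Z t = X 0* X t Y t\<close> has the same ends as \<open>Y\<close>, and it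
  preserves all lines spanned by the \<open>b \<mu>\<close>.
\<close>

lemma ends_correction:
  assumes onb: "orthonormal_basis e"
    and T: "T \<in> compact_ops e" "normal_op T" "multiplicity_free T"
    and fin: "finite {\<mu> \<in> Eig T. \<epsilon> \<le> cmod \<mu>}" and "\<epsilon> > 0"
    and U: "continuous_on {0..1::real} U" "\<forall>t\<in>{0..1}. unitary_perturbation e (U t)"
    and ends: "\<And>\<mu> b. \<epsilon> \<le> cmod \<mu> \<Longrightarrow> norm b = 1 \<Longrightarrow> blinfun_apply T b = \<mu> *\<^sub>C b \<Longrightarrow>
      \<exists>c. cmod c = 1 \<and> blinfun_apply (U 0) b = c *\<^sub>C blinfun_apply (U 1) b"
  obtains Z where "continuous_on {0..1::real} Z" "\<forall>t\<in>{0..1}. unitary_perturbation e (Z t)"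
    "Z 0 = adj (U 1) o\<^sub>L U 0" "Z 1 = id_blinfun"
    "\<forall>t\<in>{0..1}. norm (T - (adj (Z t) o\<^sub>L T o\<^sub>L Z t)) \<le> 2 * \<epsilon>"
proof -
  note up_lin = unitary_perturbation_clinear and up_un = unitary_perturbation_unitary
  define M where "M = {\<mu> \<in> Eig T. \<epsilon> \<le> cmod \<mu>}"
  have M: "finite M" using fin by (simp add: M_def)
  have "\<forall>\<mu>\<in>M. \<exists>b. norm b = 1 \<and> blinfun_apply T b = \<mu> *\<^sub>C b"
    using Eig_unit_eigenvector[OF clinear_compact_ops[OF T(1)]] unfolding M_def
    by (metis (no_types, lifting) mem_Collect_eq)
  then obtain b where b: "\<And>\<mu>. \<mu> \<in> M \<Longrightarrow> norm (b \<mu>) = 1" "\<And>\<mu>. \<mu> \<in> M \<Longrightarrow> blinfun_apply T (b \<mu>) = \<mu> *\<^sub>C b \<mu>"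
    by metis
  have b_orth: "cinner (b \<mu>) (b \<nu>) = (if \<mu> = \<nu> then 1 else 0)" if "\<mu> \<in> M" "\<nu> \<in> M" for \<mu> \<nu>
    using normal_eigenvectors_orthonormal[OF clinear_compact_ops[OF T(1)] T(2) inj_on_id2 b that] .
  have "\<forall>\<mu>\<in>M. \<exists>c. cmod c = 1 \<and> blinfun_apply (U 0) (b \<mu>) = c *\<^sub>C blinfun_apply (U 1) (b \<mu>)"
  proof
    fix \<mu> assume "\<mu> \<in> M"
    then have "\<epsilon> \<le> cmod \<mu>" by (simp add: M_def)
    from ends[OF this b[OF \<open>\<mu> \<in> M\<close>]]
    show "\<exists>c. cmod c = 1 \<and> blinfun_apply (U 0) (b \<mu>) = c *\<^sub>C blinfun_apply (U 1) (b \<mu>)" .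
  qed
  then obtain c where c: "\<And>\<mu>. \<mu> \<in> M \<Longrightarrow> cmod (c \<mu>) = 1"
    "\<And>\<mu>. \<mu> \<in> M \<Longrightarrow> blinfun_apply (U 0) (b \<mu>) = c \<mu> *\<^sub>C blinfun_apply (U 1) (b \<mu>)" by metis
  have "\<forall>\<mu>\<in>M. \<exists>\<gamma> :: real \<Rightarrow> complex. continuous_on UNIV \<gamma> \<and> (\<forall>t. cmod (\<gamma> t) = 1) \<and> \<gamma> 0 = cnj (c \<mu>) \<and> \<gamma> 1 = 1"
    using unimodular_path[OF c(1)] by metis
  then obtain \<gamma> :: "complex \<Rightarrow> real \<Rightarrow> complex" where \<gamma>: "\<And>\<mu>. \<mu> \<in> M \<Longrightarrow> continuous_on UNIV (\<gamma> \<mu>)"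
    "\<And>\<mu> t. \<mu> \<in> M \<Longrightarrow> cmod (\<gamma> \<mu> t) = 1" "\<And>\<mu>. \<mu> \<in> M \<Longrightarrow> \<gamma> \<mu> 0 = cnj (c \<mu>)" "\<And>\<mu>. \<mu> \<in> M \<Longrightarrow> \<gamma> \<mu> 1 = 1"
    by metis
  define Y where "Y t = adj (U 1) o\<^sub>L U t" for t
  have U1: "unitary_perturbation e (U 1)" using U(2) by simp
  have Y: "unitary_perturbation e (Y t)" if "t \<in> {0..1}" for t
    unfolding Y_def using U(2) that U1
    by (intro unitary_perturbation_compose[OF onb] unitary_perturbation_adj[OF onb]) auto
  have Y_cont: "continuous_on {0..1} Y"
    unfolding Y_def by (intro continuous_on_compose_op continuous_on_const U(1))
  have Y1: "Y 1 = id_blinfun" using up_un[OF U1] by (simp add: Y_def unitary_op_def)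
  have Y0: "blinfun_apply (Y 0) (b \<mu>) = c \<mu> *\<^sub>C b \<mu>" if "\<mu> \<in> M" for \<mu>
    by (simp add: Y_def c(2)[OF that] clinear_opD[OF clinear_adj[OF up_lin[OF U1]]]
        unitary_adj_apply[OF up_un[OF U1]])
  define f where "f \<mu> t = \<gamma> \<mu> t *\<^sub>C blinfun_apply (Y t) (b \<mu>)" for \<mu> t
  have f_cont: "continuous_on {0..1} (f \<mu>)" if "\<mu> \<in> M" for \<mu>
    unfolding f_def by (intro scaleC.continuous_on blinfun.continuous_on continuous_on_const Y_cont
        continuous_on_subset[OF \<gamma>(1)[OF that]]) simp
  have f_orth: "cinner (f \<mu> t) (f \<nu> t) = (if \<mu> = \<nu> then 1 else 0)"
    if "\<mu> \<in> M" "\<nu> \<in> M" "t \<in> {0..1}" for \<mu> \<nu> t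
    using unitary_cinner[OF up_lin[OF Y[OF that(3)]] up_un[OF Y[OF that(3)]]] b_orth[OF that(1,2)]
      cnj_mult_self_unimodular[OF \<gamma>(2)[OF that(1)]]
    by (auto simp: f_def cinner_simps mult.commute)
  have f0: "f \<mu> 0 = b \<mu>" and f1: "f \<mu> 1 = b \<mu>" if "\<mu> \<in> M" for \<mu>
    using Y0[OF that] \<gamma>(3,4)[OF that] cnj_mult_self_unimodular[OF c(1)[OF that]]
    by (simp_all add: f_def scaleC_scaleC scaleC_one Y1)
  obtain X where X: "continuous_on {0..1} X" "\<forall>t\<in>{0..1}. unitary_perturbation e (X t)"
    and Xf: "\<forall>t\<in>{0..1}. \<forall>\<mu>\<in>M. blinfun_apply (X t) (f \<mu> t) = b \<mu>"
    and X_eq: "\<forall>s\<in>{0..1}. \<forall>t\<in>{0..1}. (\<forall>\<mu>\<in>M. f \<mu> s = f \<mu> t \<and> b \<mu> = b \<mu>) \<longrightarrow> X s = X t"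
    using frames_conjugate[OF onb compact_Icc M continuous_on_const b_orth f_cont f_orth] .
  have X01: "X 1 = X 0" using X_eq f0 f1 by simp
  have X0: "unitary_perturbation e (X 0)" using X(2) by simp
  define Z where "Z t = adj (X 0) o\<^sub>L (X t o\<^sub>L Y t)" for t
  have Z: "unitary_perturbation e (Z t)" if "t \<in> {0..1}" for t
    unfolding Z_def using X(2) that X0
    by (intro unitary_perturbation_compose[OF onb] unitary_perturbation_adj[OF onb] Y) auto
  have X0b: "blinfun_apply (adj (X 0)) (b \<mu>) = b \<mu>" if "\<mu> \<in> M" for \<mu>
  proof -
    have "blinfun_apply (X 0) (b \<mu>) = b \<mu>" using Xf that f0[OF that] by force
    then show ?thesis using unitary_adj_apply(1)[OF up_un[OF X0], of "b \<mu>"] by simp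
  qed
  have Zb: "blinfun_apply (Z t) (b \<mu>) = cnj (\<gamma> \<mu> t) *\<^sub>C b \<mu>" if "t \<in> {0..1}" "\<mu> \<in> M" for t \<mu>
  proof -
    have Xt: "clinear_op (X t)" using X(2) that(1) up_lin by blast
    have "blinfun_apply (Y t) (b \<mu>) = cnj (\<gamma> \<mu> t) *\<^sub>C f \<mu> t"
      using cnj_mult_self_unimodular[OF \<gamma>(2)[OF that(2)]] by (simp add: f_def scaleC_scaleC scaleC_one)
    then show ?thesis
      using Xf that by (simp add: Z_def clinear_opD[OF Xt] clinear_opD[OF clinear_adj[OF up_lin[OF X0]]] X0b)
  qed
  show ?thesis
  proof (rule that[of Z])
    show "continuous_on {0..1} Z"
      unfolding Z_def by (intro continuous_on_compose_op continuous_on_const X(1) Y_cont)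
    show "\<forall>t\<in>{0..1}. unitary_perturbation e (Z t)" using Z by blast
    show "Z 0 = adj (U 1) o\<^sub>L U 0"
      by (rule blinfun_eqI) (simp add: Z_def unitary_adj_apply[OF up_un[OF X0]] Y_def)
    show "Z 1 = id_blinfun"
      by (rule blinfun_eqI) (simp add: Z_def unitary_adj_apply[OF up_un[OF X0]] X01 Y1)
    show "\<forall>t\<in>{0..1}. norm (T - (adj (Z t) o\<^sub>L T o\<^sub>L Z t)) \<le> 2 * \<epsilon>"
    proof
      fix t :: real assume t: "t \<in> {0..1}"
      show "norm (T - (adj (Z t) o\<^sub>L T o\<^sub>L Z t)) \<le> 2 * \<epsilon>"
      proof (rule conjugation_error_le[OF onb T T M inj_on_id2 b b])
        show "cmod \<mu> \<le> \<epsilon>" if "\<mu> \<in> Eig T \<union> Eig T" "\<mu> \<notin> (\<lambda>x. x) ` M" for \<mu>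
          using that by (auto simp: M_def)
        show "\<exists>c. cmod c = 1 \<and> blinfun_apply (Z t) (b \<mu>) = c *\<^sub>C b \<mu>" if "\<mu> \<in> M" for \<mu>
          using Zb[OF t that] \<gamma>(2)[OF that] by (intro exI[of _ "cnj (\<gamma> \<mu> t)"]) simp
      qed (use \<open>\<epsilon> > 0\<close> up_lin[OF Z[OF t]] up_un[OF Z[OF t]] in auto)
    qed
  qed
qed

text \<open>
  Replace \<open>U\<close> by \<open>U x Z (h x)\<close> with the correction \<open>Z\<close> of \<open>ends_correction\<close> for \<open>T = B 1\<close>, where \<open>h\<close> is
  \<open>1\<close> except near the end point and \<open>h 1 = 0\<close>. Near the end point \<open>B x\<close> is close to \<open>B 1\<close>, which almost
  commutes with \<open>Z\<close>; elsewhere \<open>Z (h x)\<close> is the identity.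
\<close>

lemma approx_equivalence_closed_path:
  assumes A: "eigenvalue_family e A" and B: "eigenvalue_family e B"
    and Eig: "\<And>x. x \<in> {0..1} \<Longrightarrow> Eig (A x) = Eig (B x)"
    and loop: "A 0 = A 1" "B 0 = B 1"
    and cond: "condition1_interval A" and "\<epsilon> > 0"
  obtains U where "continuous_on {0..1} U" "\<forall>x\<in>{0..1}. unitary_perturbation e (U x)" "U 0 = U 1"
    "\<forall>x\<in>{0..1}. norm (B x - (adj (U x) o\<^sub>L A x o\<^sub>L U x)) < \<epsilon>"
proof -
  interpret A: eigenvalue_family e A by fact
  interpret B: eigenvalue_family e B by fact
  note up_lin = unitary_perturbation_clinear and up_un = unitary_perturbation_unitary
  \<comment> \<open>The error is \<open>2 \<eta>\<close> from \<open>U\<close>, \<open>2 \<eta>\<close> from \<open>Z\<close>, and \<open>\<eta>\<close> twice for replacing \<open>B x\<close> by \<open>B 1\<close>.\<close>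
  define \<eta> where "\<eta> = \<epsilon> / 7"
  have "\<eta> > 0" using \<open>\<epsilon> > 0\<close> by (simp add: \<eta>_def)
  obtain U where U: "continuous_on {0..1} U" "\<forall>x\<in>{0..1}. unitary_perturbation e (U x)"
    and U_err: "\<forall>x\<in>{0..1}. norm (B x - (adj (U x) o\<^sub>L A x o\<^sub>L U x)) \<le> 2 * \<eta>"
    and fin: "\<forall>x\<in>{0..1}. finite {\<mu> \<in> Eig (B x). \<eta> \<le> cmod \<mu>}"
    and U_eig: "\<forall>x\<in>{0..1}. \<forall>\<mu> b. \<eta> \<le> cmod \<mu> \<longrightarrow> norm b = 1 \<longrightarrow> blinfun_apply (B x) b = \<mu> *\<^sub>C b \<longrightarrow>
       blinfun_apply (A x) (blinfun_apply (U x) b) = \<mu> *\<^sub>C blinfun_apply (U x) b"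
    using intertwiner_on_interval[OF A B Eig cond \<open>\<eta> > 0\<close>] .
  have U01: "unitary_perturbation e (U 0)" "unitary_perturbation e (U 1)" using U(2) by auto
  have one: "(1::real) \<in> {0..1}" and zero: "(0::real) \<in> {0..1}" by auto
  have ends: "\<exists>c. cmod c = 1 \<and> blinfun_apply (U 0) b = c *\<^sub>C blinfun_apply (U 1) b"
    if \<mu>: "\<eta> \<le> cmod \<mu>" and b: "norm b = 1" "blinfun_apply (B 1) b = \<mu> *\<^sub>C b" for \<mu> b
  proof -
    have "blinfun_apply (A 1) (blinfun_apply (U 1) b) = \<mu> *\<^sub>C blinfun_apply (U 1) b"
      using U_eig one \<mu> b by blast
    moreover have "blinfun_apply (A 1) (blinfun_apply (U 0) b) = \<mu> *\<^sub>C blinfun_apply (U 0) b"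
      using U_eig zero \<mu> b loop by metis
    moreover have "norm (blinfun_apply (U 1) b) = 1" "norm (blinfun_apply (U 0) b) = 1"
      using unitary_norm[OF up_lin[OF U01(1)] up_un[OF U01(1)]]
        unitary_norm[OF up_lin[OF U01(2)] up_un[OF U01(2)]] b(1) by simp_all
    ultimately show ?thesis
      using multiplicity_free_eigenvector_unique[OF A.simple[OF one]] by metis
  qed
  obtain Z where Z: "continuous_on {0..1::real} Z" "\<forall>t\<in>{0..1}. unitary_perturbation e (Z t)"
    and Z01: "Z 0 = adj (U 1) o\<^sub>L U 0" "Z 1 = id_blinfun"
    and Z_err: "\<forall>t\<in>{0..1}. norm (B 1 - (adj (Z t) o\<^sub>L B 1 o\<^sub>L Z t)) \<le> 2 * \<eta>"
    using ends_correction[OF A.onb B.comp[OF one] B.normal[OF one] B.simple[OF one] bspec[OF fin one]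
        \<open>\<eta> > 0\<close> U ends] .
  obtain d0 where d0: "d0 > 0" "\<forall>x\<in>{0..1}. dist x 1 < d0 \<longrightarrow> dist (B x) (B 1) < \<eta>"
    using B.cont one \<open>\<eta> > 0\<close> unfolding continuous_on_iff by blast
  define d where "d = min d0 1"
  have d: "0 < d" "d \<le> 1" "d \<le> d0" using d0(1) by (auto simp: d_def)
  \<comment> \<open>The bound \<open>d \<le> 1\<close> makes \<open>h 0 = 1\<close>.\<close>
  define h where "h x = min 1 ((1 - x) / d)" for x
  have h_range: "h x \<in> {0..1}" if "x \<in> {0..1}" for x using that d(1) by (auto simp: h_def)
  have h0: "h 0 = 1" using d by (simp add: h_def)
  have h1: "h 1 = 0" by (simp add: h_def)
  have h_cont: "continuous_on {0..1} h" unfolding h_def using d(1) by (intro continuous_intros) auto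
  define V where "V x = U x o\<^sub>L Z (h x)" for x
  have Zh: "unitary_perturbation e (Z (h x))" if "x \<in> {0..1}" for x using Z(2) h_range[OF that] by blast
  show ?thesis
  proof (rule that[of V])
    show "continuous_on {0..1} V"
      unfolding V_def using h_range
      by (intro continuous_on_compose_op U(1) continuous_on_compose2[OF Z(1) h_cont]) auto
    show "\<forall>x\<in>{0..1}. unitary_perturbation e (V x)"
      unfolding V_def using U(2) Zh by (auto intro: unitary_perturbation_compose[OF A.onb])
    show "V 0 = V 1"
      by (rule blinfun_eqI) (simp add: V_def h0 h1 Z01 unitary_adj_apply[OF up_un[OF U01(2)]])
    show "\<forall>x\<in>{0..1}. norm (B x - (adj (V x) o\<^sub>L A x o\<^sub>L V x)) < \<epsilon>"
    proof
      fix x :: real assume x: "x \<in> {0..1}"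
      define z where "z = Z (h x)"
      have z: "clinear_op z" "unitary_op z"
        unfolding z_def using Zh[OF x] up_lin up_un by auto
      have Ux: "clinear_op (U x)" using U(2) x up_lin by blast
      have B_err: "norm (B x - (adj z o\<^sub>L B x o\<^sub>L z)) \<le> 4 * \<eta>"
      proof (cases "dist x 1 < d")
        case True
        then have near: "norm (B x - B 1) < \<eta>" using d0(2) d(3) x by (simp add: dist_norm)
        have split: "B x - (adj z o\<^sub>L B x o\<^sub>L z)
            = (B x - B 1) + (B 1 - (adj z o\<^sub>L B 1 o\<^sub>L z)) - (adj z o\<^sub>L (B x - B 1) o\<^sub>L z)"
          by (rule blinfun_eqI) (simp add: blinfun.diff_left blinfun.add_left blinfun.diff_right)
        have "norm (B 1 - (adj z o\<^sub>L B 1 o\<^sub>L z)) \<le> 2 * \<eta>"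
          using Z_err h_range[OF x] by (simp add: z_def)
        then show ?thesis
          unfolding split
          using near norm_unitary_conj[OF z, of "B x - B 1"]
            norm_triangle_ineq[of "B x - B 1" "B 1 - (adj z o\<^sub>L B 1 o\<^sub>L z)"]
            norm_triangle_ineq4[of "(B x - B 1) + (B 1 - (adj z o\<^sub>L B 1 o\<^sub>L z))" "adj z o\<^sub>L (B x - B 1) o\<^sub>L z"]
          by linarith
      next
        case False
        then have "h x = 1" using x d(1) by (simp add: h_def dist_real_def min_def field_simps)
        then have "z = id_blinfun" by (simp add: z_def Z01)
        then have "B x - (adj z o\<^sub>L B x o\<^sub>L z) = 0"
          by (intro blinfun_eqI) (simp add: adj_id blinfun.diff_left)
        then show ?thesis using \<open>\<eta> > 0\<close> by simp
      qed
      have split: "B x - (adj (V x) o\<^sub>L A x o\<^sub>L V x) = (B x - (adj z o\<^sub>L B x o\<^sub>L z))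
          + (adj z o\<^sub>L (B x - (adj (U x) o\<^sub>L A x o\<^sub>L U x)) o\<^sub>L z)"
        unfolding V_def z_def[symmetric] adj_compose[OF Ux z(1)]
        by (rule blinfun_eqI) (simp add: blinfun.diff_left blinfun.add_left blinfun.diff_right)
      show "norm (B x - (adj (V x) o\<^sub>L A x o\<^sub>L V x)) < \<epsilon>"
        unfolding split
        using B_err bspec[OF U_err x] \<open>\<eta> > 0\<close>
          norm_unitary_conj[OF z, of "B x - (adj (U x) o\<^sub>L A x o\<^sub>L U x)"]
          norm_triangle_ineq[of "B x - (adj z o\<^sub>L B x o\<^sub>L z)"
            "adj z o\<^sub>L (B x - (adj (U x) o\<^sub>L A x o\<^sub>L U x)) o\<^sub>L z"] \<eta>_def
        by linarith
    qed
  qed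
qed

section \<open>From the interval to the circle\<close>

abbreviation circle_param :: "real \<Rightarrow> complex" where
  "circle_param x \<equiv> exp (2 * complex_of_real pi * complex_of_real x * \<i>)"

lemma circle_param_in_sphere: "circle_param x \<in> sphere 0 1"
  using norm_exp_i_times[of "2 * pi * x"] by (simp add: mult_ac)

lemma circle_param_surj:
  assumes "z \<in> sphere 0 1"
  obtains x where "x \<in> {0..1}" "z = circle_param x"
proof (rule that)
  show "Arg2pi z / (2 * pi) \<in> {0..1}"
    using Arg2pi_ge_0[of z] Arg2pi_lt_2pi[of z] by (auto simp: field_simps)
  show "z = circle_param (Arg2pi z / (2 * pi))"
    using Arg2pi_eq[of z] assms by (simp add: mult.commute)
qed

lemma circle_param_eq_imp:
  assumes "x \<in> {0..1}" "y \<in> {0..1}" "circle_param x = circle_param y"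
  shows "x = y \<or> {x, y} = {0, 1}"
proof -
  from assms(3) obtain n :: int
    where "2 * complex_of_real pi * complex_of_real x * \<i> = 2 * complex_of_real pi * complex_of_real y * \<i> + complex_of_real (real_of_int (2 * n) * pi) * \<i>"
    unfolding exp_eq by blast
  then have "\<i> * complex_of_real (2 * pi * x) = \<i> * complex_of_real (2 * pi * (y + real_of_int n))"
    by (simp add: algebra_simps)
  then have "2 * pi * x = 2 * pi * (y + real_of_int n)"
    by (simp only: mult_cancel_left complex_i_not_zero of_real_eq_iff) simp
  then have "x = y + real_of_int n" by simp
  moreover from this have "n = -1 \<or> n = 0 \<or> n = 1" using assms(1,2) by auto
  ultimately show ?thesis using assms(1,2) by auto
qed

text \<open>
  The parametrization is a continuous map from a compact space onto a Hausdorff space, so it is closed,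
  and closed sets can be tested upstairs.
\<close>

lemma descend_to_circle:
  fixes g :: "real \<Rightarrow> 'a::topological_space"
  assumes g: "continuous_on {0..1} g" "g 0 = g 1"
  obtains G where "continuous_on (sphere 0 1) G" "\<forall>x\<in>{0..1}. G (circle_param x) = g x"
proof -
  define G where "G z = g (Arg2pi z / (2 * pi))" for z
  have G: "G (circle_param x) = g x" if x: "x \<in> {0..1}" for x
  proof -
    define y where "y = Arg2pi (circle_param x) / (2 * pi)"
    have "y \<in> {0..1}"
      unfolding y_def using Arg2pi_ge_0 Arg2pi_lt_2pi by (auto simp: field_simps less_imp_le)
    moreover have "circle_param y = circle_param x"
      unfolding y_def using Arg2pi_eq[of "circle_param x"] circle_param_in_sphere[of x] by (simp add: mult.commute)
    ultimately have "y = x \<or> {y, x} = {0, 1}" using circle_param_eq_imp x by blast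
    then have "g y = g x" using g(2) by (auto simp: doubleton_eq_iff)
    then show ?thesis by (simp add: G_def y_def)
  qed
  have "continuous_on (sphere 0 1) G"
    unfolding continuous_on_closed_vimage[OF closed_sphere]
  proof (intro allI impI)
    fix B :: "'a set" assume "closed B"
    have "G -` B \<inter> sphere 0 1 = circle_param ` (g -` B \<inter> {0..1})"
    proof (intro equalityI subsetI)
      fix z assume z: "z \<in> G -` B \<inter> sphere 0 1"
      obtain x where "x \<in> {0..1}" "z = circle_param x" using circle_param_surj z by blast
      with z G show "z \<in> circle_param ` (g -` B \<inter> {0..1})" by auto
    next
      fix z assume "z \<in> circle_param ` (g -` B \<inter> {0..1})"
      then show "z \<in> G -` B \<inter> sphere 0 1" using G circle_param_in_sphere by auto
    qed
    also have "compact (circle_param ` (g -` B \<inter> {0..1}))"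
    proof (rule compact_continuous_image)
      have "closed (g -` B \<inter> {0..1})"
        using g(1) \<open>closed B\<close> continuous_on_closed_vimage[OF closed_atLeastAtMost] by blast
      then show "compact (g -` B \<inter> {0..1})"
        by (simp add: compact_eq_bounded_closed bounded_Int)
    qed (intro continuous_intros)
    finally show "closed (G -` B \<inter> sphere 0 1)" by (rule compact_imp_closed)
  qed
  with G that show ?thesis by blast
qed

theorem corollary3p16:
  fixes e :: "nat \<Rightarrow> 'h::complex_hilbert"
    and A B :: "complex \<Rightarrow> 'h \<Rightarrow>\<^sub>L 'h"
  assumes "orthonormal_basis e"
    and "A \<in> compact_over e (sphere 0 1)"
    and "B \<in> compact_over e (sphere 0 1)"
    and "\<forall>x\<in>sphere 0 1. normal_op (A x)"
    and "\<forall>x\<in>sphere 0 1. normal_op (B x)"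
    and "\<forall>x\<in>sphere 0 1. multiplicity_free (A x)"
    and "\<forall>x\<in>sphere 0 1. multiplicity_free (B x)"
    and "\<forall>x\<in>sphere 0 1. Eig (A x) = Eig (B x) \<and> Eig (A x) \<subseteq> UNIV - {0}"
    and "condition1_circle A"
  shows "approx_unitarily_equivalent e (sphere 0 1) A B"
proof -
  note onb = assms(1)
  have param: "continuous_on {0..1} circle_param" "circle_param ` {0..1} \<subseteq> sphere 0 1"
    using circle_param_in_sphere by (auto intro!: continuous_intros)
  have family: "eigenvalue_family e (\<lambda>x. D (circle_param x))"
    if "D \<in> compact_over e (sphere 0 1)" "\<forall>x\<in>sphere 0 1. normal_op (D x)"
      "\<forall>x\<in>sphere 0 1. multiplicity_free (D x)" "\<forall>x\<in>sphere 0 1. 0 \<notin> Eig (D x)" for D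
    by (unfold_locales; (rule onb continuous_on_compose2[OF compact_over_imp(1)[OF onb that(1)] param]
          compact_over_imp(2)[OF onb that(1) circle_param_in_sphere])?)
      (use that(2-4) circle_param_in_sphere in blast)+
  have nonzero: "\<forall>x\<in>sphere 0 1. 0 \<notin> Eig (A x)" "\<forall>x\<in>sphere 0 1. 0 \<notin> Eig (B x)"
    using assms(8) by blast+
  have famA: "eigenvalue_family e (\<lambda>x. A (circle_param x))"
    by (rule family[OF assms(2,4,6) nonzero(1)])
  have famB: "eigenvalue_family e (\<lambda>x. B (circle_param x))"
    by (rule family[OF assms(3,5,7) nonzero(2)])
  have ends: "circle_param 0 = circle_param 1" by simp
  show ?thesis
    unfolding approx_unitarily_equivalent_def
  proof (intro allI impI)
    fix \<epsilon> :: real assume "\<epsilon> > 0"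
    have Eig: "Eig (A (circle_param x)) = Eig (B (circle_param x))" for x
      using assms(8) circle_param_in_sphere by blast
    obtain V where V: "continuous_on {0..1} V" "\<forall>x\<in>{0..1}. unitary_perturbation e (V x)" "V 0 = V 1"
      and err: "\<forall>x\<in>{0..1}. norm (B (circle_param x) - (adj (V x) o\<^sub>L A (circle_param x) o\<^sub>L V x)) < \<epsilon>"
      using approx_equivalence_closed_path[OF famA famB Eig _ _ assms(9)[unfolded condition1_circle_def] \<open>\<epsilon> > 0\<close>]
        ends by metis
    obtain U where U: "continuous_on (sphere 0 1) U" "\<forall>x\<in>{0..1}. U (circle_param x) = V x"
      using descend_to_circle[OF V(1,3)] .
    have pert: "unitary_perturbation e (U z)" and "norm (B z - (adj (U z) o\<^sub>L A z o\<^sub>L U z)) < \<epsilon>"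
      if z: "z \<in> sphere 0 1" for z
    proof -
      obtain x where x: "x \<in> {0..1}" "z = circle_param x" using circle_param_surj[OF z] .
      show "unitary_perturbation e (U z)" "norm (B z - (adj (U z) o\<^sub>L A z o\<^sub>L U z)) < \<epsilon>"
        using V(2) err U(2) x by auto
    qed
    moreover have "(\<lambda>z. U z - id_blinfun) \<in> compact_over e (sphere 0 1)"
      using pert by (intro compact_over_if[OF onb compact_sphere] continuous_on_diff continuous_on_const U(1))
        (auto simp: unitary_perturbation_def)
    ultimately show "\<exists>U. continuous_on (sphere 0 1) U \<and> (\<forall>x\<in>sphere 0 1. unitary_op (U x))
        \<and> (\<lambda>x. U x - id_blinfun) \<in> compact_over e (sphere 0 1)
        \<and> (\<forall>x\<in>sphere 0 1. norm (B x - (adj (U x) o\<^sub>L A x o\<^sub>L U x)) < \<epsilon>)"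
      using U(1) unitary_perturbation_unitary by blast
  qed
qed

end
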